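(* Let $M>0$, $\zeta\ge 1$ and $0<\alpha<0.5$ be fixed. Consider a sequence of problems indexed by $n$, with dimension $d=d(n)$ and minimum leaf size $k=k(n)$, in each of which we have $n$ independent and identically distributed training examples $(X_i,Y_i)\in[0,1]^d\times[-M,M]$. Suppose that the features $X_i$ have a density $f$ on $[0,1]^d$ with $\zeta^{-1}\le f(x)\le\zeta$ for all $x\in[0,1]^d$, and that $$\lim_{n\to\infty}\frac{\log(n)\,\max\{\log(d),\,\log\log(n)\}}{k}=0.$$ Then $$\lim_{n,d,k\to\infty}\mathbb{P}\left[\sup_{x\in[0,1]^d,\ \Lambda\in\mathcal{V}_{\alpha,k}}\left|T_\Lambda(x)-T^*_\Lambda(x)\right|\le 9M\sqrt{\frac{\log(n/k)\,\bigl(\log(dk)+3\log\log(n)\bigr)}{\log\bigl((1-\alpha)^{-1}\bigr)}}\,\frac{1}{\sqrt{k}}\right]=1.$$ Moreover, if in addition $\liminf d/n>0$, then $$\mathbb{P}\left[\sup_{x\in[0,1]^d,\ \Lambda\in\mathcal{V}_{\alpha,k}}\left|T_\Lambda(x)-T^*_\Lambda(x)\right|\le 9M\sqrt{\frac{\log(n)\log(d)}{\log\bigl((1-\alpha)^{-1}\bigr)}}\,\frac{1}{\sqrt{k}}\right]\to 1.$$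
   Context: Recursive partitioning: starting from the root node $\nu=[0,1]^d$, repeatedly select a currently unsplit node $\nu$, a splitting variable $j\in\{1,\dots,d\}$ and a threshold $\tau\in[0,1]$, and split $\nu$ into two children $\nu_-=\nu\cap\{x:x_j\le\tau\}$ and $\nu_+=\nu\cap\{x:x_j>\tau\}$. The final unsplit nodes (leaves, or terminal nodes) form a partition $\Lambda$ of $[0,1]^d$; $L(x)$ denotes the unique element of $\Lambda$ containing $x$. A partition $\Lambda$ is $\{\alpha,k\}$-valid if it can be generated by a recursive partitioning scheme in which each child node contains at least a fraction $\alpha$ of the data points $X_i$ in its parent node, and each terminal node contains at least $k$ training examples. $\mathcal{V}_{\alpha,k}$ is the (data-dependent) set of $\{\alpha,k\}$-valid partitions. For $\Lambda\in\mathcal{V}_{\alpha,k}$ the valid tree is $T_\Lambda(x)=\frac{1}{|\{i:X_i\in L(x)\}|}\sum_{\{i:X_i\in L(x)\}}Y_i$, and the partition-optimal tree is $T^*_\Lambda(x)=\mathbb{E}[Y\mid X\in L(x)]$, where $(X,Y)$ is a new independent sample from the data-generating distribution (so the leaf $L(x)$ is treated as fixed in this expectation).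
   Formalization: The first bound is proved under the extra condition limsup k/n < 1, since for k = n the only valid partition is the whole cube and the printed bound is 0, so the claim fails; the second bound is as stated. *)

theory Defs
  imports "HOL-Probability.Probability"
begin

(* Points of R^d are functions nat => real with coordinates 0, ..., d - 1, equal to
   undefined elsewhere, so that the dimension d may vary. *)

definition cube :: "nat \<Rightarrow> (nat \<Rightarrow> real) set" where
  "cube d = ({..<d} \<rightarrow>\<^sub>E {0..1})"

definition cube_lebesgue :: "nat \<Rightarrow> (nat \<Rightarrow> real) measure" where
  "cube_lebesgue d = (\<Pi>\<^sub>M j\<in>{..<d}. restrict_space lborel {0..1})"

(* Only the underlying measurable space [0,1]^d x [-M,M] matters here; random elements of it
   are examples (x, y) with x in cube d and y in [-M,M]. *)

definition example_space :: "nat \<Rightarrow> real \<Rightarrow> ((nat \<Rightarrow> real) \<times> real) measure" where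
  "example_space d M = cube_lebesgue d \<Otimes>\<^sub>M restrict_space borel {-M..M}"

definition iid_sample :: "'a measure \<Rightarrow> 'b measure \<Rightarrow> nat \<Rightarrow> (nat \<Rightarrow> 'a \<Rightarrow> 'b) \<Rightarrow> bool" where
  "iid_sample P D n Z \<longleftrightarrow>
     prob_space P \<and> prob_space.indep_vars P (\<lambda>_. D) Z {..<n} \<and> (\<forall>i<n. distr P D (Z i) = D)"

definition points_in :: "nat \<Rightarrow> (nat \<Rightarrow> nat \<Rightarrow> real) \<Rightarrow> (nat \<Rightarrow> real) set \<Rightarrow> nat set" where
  "points_in n X \<nu> = {i. i < n \<and> X i \<in> \<nu>}"

(* The current sets of unsplit nodes reachable by recursive partitioning when every split
   gives each child at least a fraction \<alpha> of the data points of its parent. *)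

inductive_set recursive_partitions ::
    "nat \<Rightarrow> real \<Rightarrow> nat \<Rightarrow> (nat \<Rightarrow> nat \<Rightarrow> real) \<Rightarrow> (nat \<Rightarrow> real) set set set"
  for d :: nat and \<alpha> :: real and n :: nat and X :: "nat \<Rightarrow> nat \<Rightarrow> real" where
  root: "{cube d} \<in> recursive_partitions d \<alpha> n X"
| split: "\<lbrakk>\<Lambda> \<in> recursive_partitions d \<alpha> n X; \<nu> \<in> \<Lambda>; j < d; 0 \<le> \<tau>; \<tau> \<le> 1;
     \<nu>l = \<nu> \<inter> {x. x j \<le> \<tau>}; \<nu>r = \<nu> \<inter> {x. x j > \<tau>};
     real (card (points_in n X \<nu>l)) \<ge> \<alpha> * real (card (points_in n X \<nu>));
     real (card (points_in n X \<nu>r)) \<ge> \<alpha> * real (card (points_in n X \<nu>))\<rbrakk>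
   \<Longrightarrow> (\<Lambda> - {\<nu>}) \<union> {\<nu>l, \<nu>r} \<in> recursive_partitions d \<alpha> n X"

definition valid_partitions ::
    "nat \<Rightarrow> real \<Rightarrow> nat \<Rightarrow> nat \<Rightarrow> (nat \<Rightarrow> nat \<Rightarrow> real) \<Rightarrow> (nat \<Rightarrow> real) set set set" where
  "valid_partitions d \<alpha> k n X =
     {\<Lambda> \<in> recursive_partitions d \<alpha> n X. \<forall>\<nu>\<in>\<Lambda>. k \<le> card (points_in n X \<nu>)}"

definition leaf :: "(nat \<Rightarrow> real) set set \<Rightarrow> (nat \<Rightarrow> real) \<Rightarrow> (nat \<Rightarrow> real) set" where
  "leaf \<Lambda> x = (THE \<nu>. \<nu> \<in> \<Lambda> \<and> x \<in> \<nu>)"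

definition valid_tree ::
    "nat \<Rightarrow> (nat \<Rightarrow> nat \<Rightarrow> real) \<Rightarrow> (nat \<Rightarrow> real) \<Rightarrow> (nat \<Rightarrow> real) set set \<Rightarrow> (nat \<Rightarrow> real) \<Rightarrow> real" where
  "valid_tree n X Y \<Lambda> x =
     (\<Sum>i\<in>points_in n X (leaf \<Lambda> x). Y i) / real (card (points_in n X (leaf \<Lambda> x)))"

(* For (X, Y) with law D, uniform_measure D A is the conditional law of (X, Y) given the event A,
   so this is E[Y | X in L(x)] for the fixed set L(x) (and 0 if that event is null). *)

definition optimal_tree ::
    "((nat \<Rightarrow> real) \<times> real) measure \<Rightarrow> (nat \<Rightarrow> real) set set \<Rightarrow> (nat \<Rightarrow> real) \<Rightarrow> real" where
  "optimal_tree D \<Lambda> x = (\<integral>z. snd z \<partial>uniform_measure D {z \<in> space D. fst z \<in> leaf \<Lambda> x})"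

(* The supremum is taken in ereal: there may be no valid partition at all (when n < k), and then
   it is -\<infinity>. *)

definition sup_deviation ::
    "nat \<Rightarrow> real \<Rightarrow> nat \<Rightarrow> nat \<Rightarrow> ((nat \<Rightarrow> real) \<times> real) measure \<Rightarrow>
     (nat \<Rightarrow> nat \<Rightarrow> real) \<Rightarrow> (nat \<Rightarrow> real) \<Rightarrow> ereal" where
  "sup_deviation d \<alpha> k n D X Y =
     (SUP (x, \<Lambda>) \<in> cube d \<times> valid_partitions d \<alpha> k n X.
        ereal \<bar>valid_tree n X Y \<Lambda> x - optimal_tree D \<Lambda> x\<bar>)"

end

theory Submission
  imports Defs "HOL-Real_Asymp.Real_Asymp"
begin

text \<open>
  A split leaves each child with at most a fraction \<open>1 - \<alpha>\<close> of the points of its parent.  A leaf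
  with at least \<open>k\<close> of the \<open>n\<close> points therefore arises after at most
  \<open>s = ln (n / k) / ln (1 / (1 - \<alpha>))\<close> splits, and it is a box in which at most \<open>s\<close> coordinates are
  restricted (\<open>node_is_box\<close>).  The partition as a whole no longer matters: it is enough to control
  the average of the labels over every such box.

  Infinitely many boxes are reduced to finitely many by rounding their faces to a grid whose mesh
  is relative to the side length (\<open>box_net_approximates\<close>).  The box is then trapped between an inner
  and an outer grid box whose volumes differ by a relative error of at most \<open>1 / sqrt k\<close>, which is
  the order of the random fluctuation of an average of \<open>k\<close> labels and so costs nothing.
  Because the grid is relative, a long side needs few grid points, and a lower bound \<open>1 / W\<close> on the
  volume enters the number of grid boxes only through a single factor \<open>W\<close>
  (\<open>card_grid_codes\<close>).  With \<open>W\<close> of order \<open>n / k\<close> the logarithm of that number is, up to terms of lower order,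
  \<open>s (ln (d k) + 3 ln (ln n))\<close>: each restricted coordinate costs \<open>ln d\<close> for its index,
  \<open>ln (ln n)\<close> for its scale, and \<open>2 ln (s sqrt k)\<close> for its two faces.  A leaf is never smaller than the
  volume bound, because a box of volume \<open>1 / W\<close> is unlikely to contain \<open>k\<close> points.

  For a fixed box, Bernstein's inequality bounds the deviation of the label sum by
  \<open>4 M sqrt (U N)\<close>, where \<open>N\<close> is the expected number of points in the box, with failure probability
  of order \<open>exp (- 4 U)\<close>; the number of points in the box and in the gap between an outer and an
  inner box are controlled in the same way (\<open>prob_good_pair\<close>).  If the net has at most \<open>exp (3 U)\<close>
  elements, all of this holds simultaneously up to probability \<open>5 exp (- U)\<close>.  On that event a leaf
  with \<open>K\<close> points satisfies \<open>N \<le> 4 K\<close>, so the label sum contributes at most \<open>8 M sqrt (U / k)\<close>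
  to the deviation, and the gap between inner and outer box contributes a lower order term that the
  remaining \<open>M sqrt (U / k)\<close> absorbs (\<open>good_pair_deviation\<close>).  The two limit statements are the two
  choices of \<open>U\<close> for which the bound becomes \<open>9 M sqrt (U / k)\<close>; for both one checks that the net
  has size at most \<open>exp (3 U)\<close>, that \<open>U\<close> tends to infinity and that \<open>U / k\<close> tends to zero.

  The event in question quantifies over a continuum of thresholds, so its measurability needs an
  argument.  Rounding all thresholds up to a fine dyadic grid does not change which sample points
  lie in which node, and the conditional expectation converges, so countably many partitions
  suffice (\<open>dyadic_paths_suffice\<close>).
\<close>

section \<open>Concentration of sums over an i.i.d. sample\<close>

lemma exp_le_quadratic:
  fixes x :: real
  assumes "\<bar>x\<bar> \<le> 1"
  shows "exp x \<le> 1 + x + x\<^sup>2"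
proof (cases "0 \<le> x")
  case True
  then show ?thesis using exp_bound[of x] assms by simp
next
  case False
  define y where "y = - x"
  have y: "0 \<le> y" "y \<le> 1" using False assms by (auto simp: y_def)
  have low: "1 + y + y\<^sup>2 / 2 \<le> exp y" using y by (rule_tac exp_lower_Taylor_quadratic) auto
  have pos: "0 < 1 + y + y\<^sup>2 / 2" using y by (intro add_pos_nonneg) auto
  \<comment> \<open>The reciprocal of the Taylor lower bound for exp y is at most 1 - y + y^2, as the product shows.\<close>
  have "1 \<le> 1 + y\<^sup>2 / 2 + y ^ 3 / 2 + y ^ 4 / 2" using y by simp
  also have "\<dots> = (1 - y + y\<^sup>2) * (1 + y + y\<^sup>2 / 2)"
    by (simp add: field_simps power2_eq_square power3_eq_cube power4_eq_xxxx)
  finally have "1 / (1 + y + y\<^sup>2 / 2) \<le> 1 - y + y\<^sup>2" using pos by (simp add: field_simps)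
  moreover have "exp x \<le> 1 / (1 + y + y\<^sup>2 / 2)"
    using low pos by (simp add: y_def exp_minus field_simps)
  ultimately show ?thesis by (simp add: y_def)
qed

locale iid =
  fixes P :: "'a measure" and D :: "'b measure" and n :: nat and Z :: "nat \<Rightarrow> 'a \<Rightarrow> 'b"
  assumes iid_sample: "iid_sample P D n Z" and sample_nonempty: "1 \<le> n"
begin

sublocale P: prob_space P
  using iid_sample by (simp add: iid_sample_def)

lemma measurable_Z [measurable]: "i < n \<Longrightarrow> Z i \<in> measurable P D"
  using iid_sample by (auto simp: iid_sample_def P.indep_vars_def)

lemma distr_Z: "i < n \<Longrightarrow> distr P D (Z i) = D"
  using iid_sample by (auto simp: iid_sample_def)

sublocale D: prob_space D
  using P.prob_space_distr[OF measurable_Z[of 0]] distr_Z[of 0] sample_nonempty by simp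

text \<open>
  Bernstein's inequality in the range where \<open>c\<close> times the summand stays below \<open>1\<close>: there
  \<open>exp_le_quadratic\<close> bounds the moment generating function of a centred summand by \<open>exp (c\<^sup>2 v)\<close>.
  The parameter \<open>c\<close> is left free because the applications use \<open>1\<close>, \<open>1 / 4\<close> and a value that
  depends on the exponent.
\<close>

lemma sum_tail:
  assumes g [measurable]: "g \<in> borel_measurable D" and c: "0 < c"
    and bound: "\<And>z. z \<in> space D \<Longrightarrow> c * \<bar>g z\<bar> \<le> 1"
    and centred: "(\<integral>z. g z \<partial>D) = 0" and var: "(\<integral>z. (g z)\<^sup>2 \<partial>D) \<le> v"
  shows "measure P {\<omega> \<in> space P. t \<le> (\<Sum>i<n. g (Z i \<omega>))} \<le> exp (real n * c\<^sup>2 * v - c * t)"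
proof -
  have g_bd: "\<bar>g z\<bar> \<le> 1 / c" if "z \<in> space D" for z
    using bound[OF that] c by (simp add: field_simps)
  have int_g: "integrable D g"
    by (rule D.integrable_const_bound[where B = "1 / c"]) (use g_bd in auto)
  have int_g2: "integrable D (\<lambda>z. (g z)\<^sup>2)"
  proof (rule D.integrable_const_bound[where B = "(1 / c)\<^sup>2"])
    have "(g z)\<^sup>2 \<le> (1 / c)\<^sup>2" if "z \<in> space D" for z
      using power_mono[OF g_bd[OF that], of 2] by simp
    then show "AE z in D. norm ((g z)\<^sup>2) \<le> (1 / c)\<^sup>2" by (intro AE_I2) simp
  qed auto
  have int_e: "integrable D (\<lambda>z. exp (c * g z))"
  proof (rule D.integrable_const_bound[where B = "exp 1"])
    show "AE z in D. norm (exp (c * g z)) \<le> exp 1"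
    proof (rule AE_I2)
      fix z assume "z \<in> space D"
      have "c * g z \<le> c * \<bar>g z\<bar>" using c by simp
      also have "\<dots> \<le> 1" using bound \<open>z \<in> space D\<close> by simp
      finally show "norm (exp (c * g z)) \<le> exp 1" by simp
    qed
  qed auto
  have "(\<integral>z. exp (c * g z) \<partial>D) \<le> (\<integral>z. 1 + c * g z + c\<^sup>2 * (g z)\<^sup>2 \<partial>D)"
  proof (rule integral_mono[OF int_e])
    fix z assume "z \<in> space D"
    then have "\<bar>c * g z\<bar> \<le> 1" using bound c by (simp add: abs_mult)
    from exp_le_quadratic[OF this] show "exp (c * g z) \<le> 1 + c * g z + c\<^sup>2 * (g z)\<^sup>2"
      by (simp add: power_mult_distrib)
  qed (use int_g int_g2 in auto)
  also have "\<dots> = 1 + c\<^sup>2 * (\<integral>z. (g z)\<^sup>2 \<partial>D)"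
    using int_g int_g2 centred by (simp add: D.prob_space)
  also have "\<dots> \<le> 1 + c\<^sup>2 * v" using var by (simp add: mult_left_mono)
  also have "\<dots> \<le> exp (c\<^sup>2 * v)" by simp
  finally have mgf: "(\<integral>z. exp (c * g z) \<partial>D) \<le> exp (c\<^sup>2 * v)" .
  have indep: "P.indep_vars (\<lambda>_. borel) (\<lambda>i \<omega>. exp (c * g (Z i \<omega>))) {..<n}"
    using iid_sample unfolding iid_sample_def
    by (intro P.indep_vars_compose2[where Y = "\<lambda>_ z. exp (c * g z)" and M' = "\<lambda>_. D"]) auto
  have int_Z: "integrable P (\<lambda>\<omega>. exp (c * g (Z i \<omega>)))"
    and E_Z: "(\<integral>\<omega>. exp (c * g (Z i \<omega>)) \<partial>P) = (\<integral>z. exp (c * g z) \<partial>D)" if "i < n" for i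
  proof -
    have "integrable (distr P D (Z i)) (\<lambda>z. exp (c * g z))"
      using int_e that by (simp add: distr_Z)
    then show "integrable P (\<lambda>\<omega>. exp (c * g (Z i \<omega>)))"
      by (subst (asm) integrable_distr_eq) (use that in auto)
    have "(\<integral>z. exp (c * g z) \<partial>D) = (\<integral>z. exp (c * g z) \<partial>distr P D (Z i))"
      using that by (simp add: distr_Z)
    also have "\<dots> = (\<integral>\<omega>. exp (c * g (Z i \<omega>)) \<partial>P)"
      by (rule integral_distr) (use that in auto)
    finally show "(\<integral>\<omega>. exp (c * g (Z i \<omega>)) \<partial>P) = (\<integral>z. exp (c * g z) \<partial>D)" by simp
  qed
  have prod_eq: "exp (c * (\<Sum>i<n. g (Z i \<omega>))) = (\<Prod>i<n. exp (c * g (Z i \<omega>)))" for \<omega>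
    by (simp add: sum_distrib_left exp_sum)
  have int_prod: "integrable P (\<lambda>\<omega>. exp (c * (\<Sum>i<n. g (Z i \<omega>))))"
    unfolding prod_eq by (rule P.indep_vars_integrable) (use indep int_Z in auto)
  have "(\<integral>\<omega>. exp (c * (\<Sum>i<n. g (Z i \<omega>))) \<partial>P) = (\<Prod>i<n. \<integral>\<omega>. exp (c * g (Z i \<omega>)) \<partial>P)"
    unfolding prod_eq by (rule P.indep_vars_lebesgue_integral) (use indep int_Z in auto)
  also have "\<dots> = (\<integral>z. exp (c * g z) \<partial>D) ^ n" by (simp add: E_Z)
  also have "\<dots> \<le> exp (c\<^sup>2 * v) ^ n"
    by (intro power_mono mgf Bochner_Integration.integral_nonneg) auto
  also have "\<dots> = exp (real n * c\<^sup>2 * v)" by (simp add: exp_of_nat_mult mult.assoc)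
  finally have E: "(\<integral>\<omega>. exp (c * (\<Sum>i<n. g (Z i \<omega>))) \<partial>P) \<le> exp (real n * c\<^sup>2 * v)" .
  have "integrable P (\<lambda>\<omega>. indicator (space P) \<omega> *\<^sub>R exp (c * (\<Sum>i<n. g (Z i \<omega>))))"
    using int_prod by (intro integrable_mult_indicator) auto
  then have "measure P {\<omega> \<in> space P. t \<le> (\<Sum>i<n. g (Z i \<omega>))}
      \<le> exp (- c * t) * (\<integral>\<omega>\<in>space P. exp (c * (\<Sum>i<n. g (Z i \<omega>))) \<partial>P)"
    by (intro P.Chernoff_ineq_ge[OF c]) (auto simp: set_integrable_def)
  also have "(\<integral>\<omega>\<in>space P. exp (c * (\<Sum>i<n. g (Z i \<omega>))) \<partial>P) = (\<integral>\<omega>. exp (c * (\<Sum>i<n. g (Z i \<omega>))) \<partial>P)"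
    by (rule set_integral_space[OF int_prod])
  also have "exp (- c * t) * \<dots> \<le> exp (- c * t) * exp (real n * c\<^sup>2 * v)"
    by (intro mult_left_mono E) auto
  also have "\<dots> = exp (real n * c\<^sup>2 * v - c * t)" by (simp add: exp_diff exp_minus field_simps)
  finally show ?thesis .
qed

text \<open>
  Multiplicative bounds for the number of sample points in a set.  The upper bound allows for an
  additive term \<open>r\<close>, so it stays useful for sets of tiny probability, such as the gap between two
  nearby boxes.
\<close>

lemma
  assumes A [measurable]: "A \<in> sets D"
  shows count_upper_tail:
      "measure P {\<omega> \<in> space P. 2 * (real n * measure D A) + r \<le> (\<Sum>i<n. indicator A (Z i \<omega>))} \<le> exp (- r)"
    and count_lower_tail:
      "measure P {\<omega> \<in> space P. (\<Sum>i<n. indicator A (Z i \<omega>)) \<le> real n * measure D A / 2}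
         \<le> exp (- (real n * measure D A / 16))"
proof -
  define p where "p = measure D A"
  have p: "0 \<le> p" "p \<le> 1" by (auto simp: p_def)
  have [simp]: "(\<integral>z. indicator A z \<partial>D) = p"
    by (simp add: p_def A)
  have var: "(\<integral>z. (indicator A z - p)\<^sup>2 \<partial>D) \<le> p"
  proof -
    have "(\<integral>z. (indicator A z - p)\<^sup>2 \<partial>D) = (\<integral>z. (1 - 2 * p) * indicator A z + p\<^sup>2 \<partial>D)"
      by (intro Bochner_Integration.integral_cong)
         (auto simp: indicator_def power2_eq_square algebra_simps)
    also have "\<dots> = (1 - 2 * p) * p + p\<^sup>2" by (simp add: D.prob_space D.emeasure_eq_measure p_def)
    also have "\<dots> = p - p\<^sup>2" by (simp add: algebra_simps power2_eq_square)
    finally show ?thesis by simp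
  qed
  have int: "integrable D (\<lambda>z. indicator A z :: real)" by (simp add: D.emeasure_eq_measure)
  have cent: "(\<integral>z. indicator A z - p \<partial>D) = 0" "(\<integral>z. p - indicator A z \<partial>D) = 0"
    using int by (simp_all add: D.prob_space p_def)
  have abs_le: "\<bar>indicator A z - p\<bar> \<le> 1" for z using p by (auto simp: indicator_def)
  have "measure P {\<omega> \<in> space P. real n * p + r \<le> (\<Sum>i<n. indicator A (Z i \<omega>) - p)}
      \<le> exp (real n * 1\<^sup>2 * p - 1 * (real n * p + r))"
    by (rule sum_tail) (use var cent abs_le in simp_all)
  then show "measure P {\<omega> \<in> space P. 2 * (real n * measure D A) + r \<le> (\<Sum>i<n. indicator A (Z i \<omega>))} \<le> exp (- r)"
    unfolding p_def[symmetric] by (simp add: sum_subtractf algebra_simps)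
  have "measure P {\<omega> \<in> space P. real n * p / 2 \<le> (\<Sum>i<n. p - indicator A (Z i \<omega>))}
      \<le> exp (real n * (1 / 4)\<^sup>2 * p - 1 / 4 * (real n * p / 2))"
    by (rule sum_tail)
       (use var cent abs_le order_trans[OF abs_le, of 4] in \<open>simp_all add: power2_commute[of p] abs_minus_commute[of p]\<close>)
  moreover have "(real n * p / 2 \<le> (\<Sum>i<n. p - indicator A (Z i \<omega>)))
      = ((\<Sum>i<n. indicator A (Z i \<omega>)) \<le> real n * p / 2)" for \<omega>
    by (auto simp: sum_subtractf mult.commute)
  moreover have "real n * (1 / 4)\<^sup>2 * p - 1 / 4 * (real n * p / 2) = - (real n * p / 16)"
    by (simp add: power2_eq_square)
  ultimately show "measure P {\<omega> \<in> space P. (\<Sum>i<n. indicator A (Z i \<omega>)) \<le> real n * measure D A / 2}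
         \<le> exp (- (real n * measure D A / 16))"
    unfolding p_def[symmetric] by simp
qed

text \<open>
  The variance of the summand is at most \<open>M\<^sup>2\<close> times the probability of \<open>A\<close>, so the fluctuation scales with
  the square root of the expected number \<open>N\<close> of points in \<open>A\<close>, not with that of the sample size.
  The assumption \<open>16 U \<le> N\<close> places the optimal \<open>c = 2 sqrt (U / N) / M\<close> in the range of \<open>sum_tail\<close>.
\<close>

lemma restricted_sum_tail:
  assumes A [measurable]: "A \<in> sets D" and h [measurable]: "h \<in> borel_measurable D"
    and M: "0 < M" and h_bound: "\<And>z. z \<in> space D \<Longrightarrow> \<bar>h z\<bar> \<le> M"
    and U: "0 < U" "16 * U \<le> real n * measure D A"
  defines "m \<equiv> (\<integral>z. indicator A z * h z \<partial>D) / measure D A"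
  shows "measure P {\<omega> \<in> space P.
      4 * M * sqrt (U * (real n * measure D A)) \<le> \<bar>\<Sum>i<n. indicator A (Z i \<omega>) * (h (Z i \<omega>) - m)\<bar>}
    \<le> 2 * exp (- 4 * U)"
proof -
  define p where "p = measure D A"
  define N where "N = real n * p"
  define t where "t = 4 * M * sqrt (U * N)"
  \<comment> \<open>Minimises the exponent n c^2 v - c t for v = M^2 p.\<close>
  define c where "c = 2 * sqrt (U / N) / M"
  have N: "0 < N" "16 * U \<le> N" using U by (auto simp: N_def p_def)
  then have p: "0 < p" by (auto simp: N_def zero_less_mult_iff)
  have c: "0 < c" using N U M by (simp add: c_def)
  have int_h: "integrable D (\<lambda>z. indicator A z * h z)"
    by (rule D.integrable_const_bound[where B = M]) (use h_bound M in \<open>auto simp: indicator_def\<close>)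
  have int_h2: "integrable D (\<lambda>z. indicator A z * (h z)\<^sup>2)"
  proof (rule D.integrable_const_bound[where B = "M\<^sup>2"])
    have "(h z)\<^sup>2 \<le> M\<^sup>2" if "z \<in> space D" for z
      using power_mono[OF h_bound[OF that], of 2] by simp
    then show "AE z in D. norm (indicator A z * (h z)\<^sup>2) \<le> M\<^sup>2"
      by (intro AE_I2) (simp add: indicator_def)
  qed auto
  have int_1: "integrable D (\<lambda>z. indicator A z :: real)" by (simp add: D.emeasure_eq_measure)
  have E1: "(\<integral>z. indicator A z \<partial>D) = p" by (simp add: p_def)
  have Eh: "(\<integral>z. indicator A z * h z \<partial>D) = m * p" using p by (simp add: m_def p_def)
  have abs_m: "\<bar>m\<bar> \<le> M"
  proof -
    have "\<bar>\<integral>z. indicator A z * h z \<partial>D\<bar> \<le> (\<integral>z. \<bar>indicator A z * h z\<bar> \<partial>D)"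
      by (rule integral_abs_bound)
    also have "\<dots> \<le> (\<integral>z. M * indicator A z \<partial>D)"
      by (rule integral_mono) (use int_h int_1 h_bound in \<open>auto simp: indicator_def\<close>)
    also have "\<dots> = M * p" using int_1 E1 by simp
    finally have "\<bar>m\<bar> * p \<le> M * p" unfolding Eh using p by (simp add: abs_mult)
    then show ?thesis using p by simp
  qed
  define g where "g z = indicator A z * (h z - m)" for z
  have g_meas [measurable]: "g \<in> borel_measurable D" by (simp add: g_def[abs_def])
  have g_bound: "c * \<bar>g z\<bar> \<le> 1" if "z \<in> space D" for z
  proof -
    have "\<bar>g z\<bar> \<le> 2 * M" using h_bound[OF that] abs_m M by (auto simp: g_def indicator_def)
    then have "c * \<bar>g z\<bar> \<le> c * (2 * M)" using c by (intro mult_left_mono) auto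
    also have "\<dots> = 4 * sqrt (U / N)" using M by (simp add: c_def)
    also have "\<dots> = sqrt (16 * (U / N))" by (simp only: real_sqrt_mult) simp
    also have "\<dots> \<le> 1" using N by (simp add: field_simps)
    finally show ?thesis .
  qed
  have centred: "(\<integral>z. g z \<partial>D) = 0"
  proof -
    have "(\<integral>z. g z \<partial>D) = (\<integral>z. indicator A z * h z - m * indicator A z \<partial>D)"
      by (simp add: g_def algebra_simps)
    also have "\<dots> = 0" using int_h int_1 E1 Eh by simp
    finally show ?thesis .
  qed
  have var: "(\<integral>z. (g z)\<^sup>2 \<partial>D) \<le> M\<^sup>2 * p"
  proof -
    have "(\<integral>z. (g z)\<^sup>2 \<partial>D)
        = (\<integral>z. indicator A z * (h z)\<^sup>2 - 2 * m * (indicator A z * h z) + m\<^sup>2 * indicator A z \<partial>D)"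
      by (intro Bochner_Integration.integral_cong)
         (auto simp: g_def indicator_def power2_eq_square algebra_simps)
    also have "\<dots> = (\<integral>z. indicator A z * (h z)\<^sup>2 \<partial>D) - 2 * m * (m * p) + m\<^sup>2 * p"
      using int_h int_h2 int_1 E1 Eh by simp
    also have "\<dots> = (\<integral>z. indicator A z * (h z)\<^sup>2 \<partial>D) - m\<^sup>2 * p"
      by (simp add: power2_eq_square algebra_simps)
    also have "\<dots> \<le> (\<integral>z. indicator A z * (h z)\<^sup>2 \<partial>D)" using p by simp
    also have "\<dots> \<le> (\<integral>z. M\<^sup>2 * indicator A z \<partial>D)"
      by (rule integral_mono)
         (use int_h2 int_1 power_mono[OF h_bound, of _ 2] in \<open>auto simp: indicator_def\<close>)
    also have "\<dots> = M\<^sup>2 * p" using int_1 E1 by simp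
    finally show ?thesis .
  qed
  have expo: "real n * c\<^sup>2 * (M\<^sup>2 * p) - c * t = - 4 * U"
  proof -
    have "c\<^sup>2 * M\<^sup>2 = 4 * (U / N)" using U N M by (simp add: c_def power_mult_distrib power_divide)
    moreover have "real n * c\<^sup>2 * (M\<^sup>2 * p) = (c\<^sup>2 * M\<^sup>2) * N" by (simp add: N_def)
    ultimately have "real n * c\<^sup>2 * (M\<^sup>2 * p) = 4 * (U / N) * N" by simp
    also have "\<dots> = 4 * U" using N by simp
    finally have 1: "real n * c\<^sup>2 * (M\<^sup>2 * p) = 4 * U" .
    have "c * t = 8 * (sqrt (U / N) * sqrt (U * N))" using M by (simp add: c_def t_def)
    also have "sqrt (U / N) * sqrt (U * N) = sqrt (U\<^sup>2)"
      using N by (simp add: real_sqrt_mult[symmetric] power2_eq_square)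
    also have "\<dots> = U" using U by simp
    finally show ?thesis using 1 by simp
  qed
  have up: "measure P {\<omega> \<in> space P. t \<le> (\<Sum>i<n. g (Z i \<omega>))} \<le> exp (- 4 * U)"
    using sum_tail[OF g_meas c g_bound centred var, of t] unfolding expo by simp
  have down: "measure P {\<omega> \<in> space P. t \<le> (\<Sum>i<n. - g (Z i \<omega>))} \<le> exp (- 4 * U)"
    using sum_tail[of "\<lambda>z. - g z" c "M\<^sup>2 * p" t] c g_bound centred var unfolding expo by simp
  have "{\<omega> \<in> space P. t \<le> \<bar>\<Sum>i<n. g (Z i \<omega>)\<bar>}
      = {\<omega> \<in> space P. t \<le> (\<Sum>i<n. g (Z i \<omega>))} \<union> {\<omega> \<in> space P. t \<le> (\<Sum>i<n. - g (Z i \<omega>))}"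
    by (auto simp: sum_negf)
  then have "measure P {\<omega> \<in> space P. t \<le> \<bar>\<Sum>i<n. g (Z i \<omega>)\<bar>}
      \<le> measure P {\<omega> \<in> space P. t \<le> (\<Sum>i<n. g (Z i \<omega>))}
        + measure P {\<omega> \<in> space P. t \<le> (\<Sum>i<n. - g (Z i \<omega>))}"
    by (simp only:) (intro measure_Un_le; measurable)
  also have "\<dots> \<le> 2 * exp (- 4 * U)" using up down by simp
  finally show ?thesis by (simp add: t_def g_def N_def p_def)
qed

end

section \<open>Boxes, their volumes and a finite net of boxes\<close>

text \<open>
  Only the coordinates in \<open>S\<close> are restricted.  A node of a partition is half-open, and its faces at
  the boundary of the cube are closed; it is sandwiched between the open and the closed box with
  the same faces.
\<close>

definition closed_box :: "nat \<Rightarrow> nat set \<Rightarrow> (nat \<Rightarrow> real) \<Rightarrow> (nat \<Rightarrow> real) \<Rightarrow> (nat \<Rightarrow> real) set" where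
  "closed_box d S lo hi = {x \<in> cube d. \<forall>j\<in>S. lo j \<le> x j \<and> x j \<le> hi j}"

definition open_box :: "nat \<Rightarrow> nat set \<Rightarrow> (nat \<Rightarrow> real) \<Rightarrow> (nat \<Rightarrow> real) \<Rightarrow> (nat \<Rightarrow> real) set" where
  "open_box d S lo hi = {x \<in> cube d. \<forall>j\<in>S. lo j < x j \<and> x j < hi j}"

abbreviation vol :: "nat \<Rightarrow> (nat \<Rightarrow> real) set \<Rightarrow> real" where
  "vol d \<equiv> measure (cube_lebesgue d)"

lemma space_cube_lebesgue: "space (cube_lebesgue d) = cube d"
  by (simp add: cube_lebesgue_def space_PiM cube_def space_restrict_space)

lemma prob_space_unit_interval: "prob_space (restrict_space lborel {0..1::real})"
  by (rule prob_spaceI) (simp add: emeasure_restrict_space space_restrict_space)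

lemma prob_space_cube_lebesgue: "prob_space (cube_lebesgue d)"
  unfolding cube_lebesgue_def by (intro prob_space_PiM prob_space_unit_interval)

lemma measurable_coordinate [measurable]:
  assumes "j < d"
  shows "(\<lambda>x. x j) \<in> borel_measurable (cube_lebesgue d)"
proof -
  have "(\<lambda>x. x j) \<in> measurable (cube_lebesgue d) (restrict_space lborel {0..1})"
    unfolding cube_lebesgue_def using assms by (intro measurable_component_singleton) auto
  then have "(\<lambda>x. x j) \<in> measurable (cube_lebesgue d) lborel"
    by (auto simp: measurable_restrict_space2_iff)
  then show ?thesis by simp
qed

lemma sets_boxes [measurable]:
  assumes "S \<subseteq> {..<d}"
  shows "closed_box d S lo hi \<in> sets (cube_lebesgue d)"
    and "open_box d S lo hi \<in> sets (cube_lebesgue d)"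
proof -
  have fin: "finite S" and lt: "\<And>j. j \<in> S \<Longrightarrow> j < d" using assms finite_subset by auto
  have "{x \<in> space (cube_lebesgue d). \<forall>j\<in>S. lo j \<le> x j \<and> x j \<le> hi j} \<in> sets (cube_lebesgue d)"
    using fin by (intro sets.sets_Collect_finite_All) (auto dest!: lt)
  then show "closed_box d S lo hi \<in> sets (cube_lebesgue d)"
    by (simp add: closed_box_def space_cube_lebesgue)
  have "{x \<in> space (cube_lebesgue d). \<forall>j\<in>S. lo j < x j \<and> x j < hi j} \<in> sets (cube_lebesgue d)"
    using fin by (intro sets.sets_Collect_finite_All) (auto dest!: lt)
  then show "open_box d S lo hi \<in> sets (cube_lebesgue d)"
    by (simp add: open_box_def space_cube_lebesgue)
qed

lemma vol_PiE:
  assumes "\<And>j. j < d \<Longrightarrow> A j \<in> sets borel" and "\<And>j. j < d \<Longrightarrow> A j \<subseteq> {0..1}"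
  shows "vol d (PiE {..<d} A) = (\<Prod>j<d. measure lborel (A j))"
proof -
  interpret product_prob_space "\<lambda>_. restrict_space lborel {0..1::real}" "{..<d}"
    by (intro product_prob_spaceI prob_space_unit_interval)
  interpret finite_product_prob_space "\<lambda>_. restrict_space lborel {0..1::real}" "{..<d}"
    by standard simp
  have "vol d (PiE {..<d} A) = (\<Prod>j<d. measure (restrict_space lborel {0..1}) (A j))"
    unfolding cube_lebesgue_def
    by (rule prob_times) (use assms in \<open>auto simp: sets_restrict_space_iff\<close>)
  also have "\<dots> = (\<Prod>j<d. measure lborel (A j))"
    by (intro prod.cong refl measure_restrict_space) (use assms in auto)
  finally show ?thesis .
qed

lemma
  assumes S: "S \<subseteq> {..<d}" and lohi: "\<And>j. j \<in> S \<Longrightarrow> 0 \<le> lo j \<and> lo j \<le> hi j \<and> hi j \<le> 1"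
  shows vol_closed_box: "vol d (closed_box d S lo hi) = (\<Prod>j\<in>S. hi j - lo j)"
    and vol_open_box: "vol d (open_box d S lo hi) = (\<Prod>j\<in>S. hi j - lo j)"
proof -
  have restrict: "(\<Prod>j<d. if j \<in> S then hi j - lo j else 1) = (\<Prod>j\<in>S. hi j - lo j)"
    using S by (subst prod.mono_neutral_right[of "{..<d}" S]) (auto intro!: prod.cong)
  have PiE_eq: "{x \<in> PiE {..<d} (\<lambda>_. {0..1}). \<forall>j\<in>S. x j \<in> I j}
      = PiE {..<d} (\<lambda>j. if j \<in> S then I j else {0..1})" (is "?L = ?R")
    if I: "\<And>j. j \<in> S \<Longrightarrow> I j \<subseteq> {0..1}" for I :: "nat \<Rightarrow> real set"
  proof (intro equalityI subsetI)
    fix x assume "x \<in> ?L"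
    then show "x \<in> ?R" by (simp add: PiE_iff)
  next
    fix x assume x: "x \<in> ?R"
    then have "x j \<in> (if j \<in> S then I j else {0..1})" if "j < d" for j
      using that by (auto simp: PiE_iff)
    then have "x j \<in> I j" if "j \<in> S" for j using S that by (metis lessThan_iff subsetD)
    moreover have "x j \<in> {0..1}" if "j < d" for j
    proof (cases "j \<in> S")
      case True
      then have "x j \<in> I j" using PiE_mem[OF x, of j] that by simp
      then show ?thesis using I[OF True] by blast
    next
      case False
      then show ?thesis using PiE_mem[OF x, of j] that by simp
    qed
    ultimately show "x \<in> ?L" using x by (simp add: PiE_iff)
  qed
  have C: "closed_box d S lo hi = PiE {..<d} (\<lambda>j. if j \<in> S then {lo j..hi j} else {0..1})"
    by (subst PiE_eq[symmetric]) (use lohi in \<open>auto simp: closed_box_def cube_def\<close>)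
  have O: "open_box d S lo hi = PiE {..<d} (\<lambda>j. if j \<in> S then {lo j<..<hi j} else {0..1})"
    by (subst PiE_eq[symmetric])
       (use lohi in \<open>auto simp: open_box_def cube_def greaterThanLessThan_subseteq_atLeastAtMost_iff\<close>)
  have "vol d (closed_box d S lo hi)
      = (\<Prod>j<d. measure lborel (if j \<in> S then {lo j..hi j} else {0..1}))"
    unfolding C by (rule vol_PiE) (use lohi in auto)
  also have "\<dots> = (\<Prod>j<d. if j \<in> S then hi j - lo j else 1)"
    using lohi by (intro prod.cong) auto
  finally show "vol d (closed_box d S lo hi) = (\<Prod>j\<in>S. hi j - lo j)" using restrict by simp
  have "vol d (open_box d S lo hi)
      = (\<Prod>j<d. measure lborel (if j \<in> S then {lo j<..<hi j} else {0..1}))"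
    unfolding O by (rule vol_PiE) (use lohi in \<open>auto simp: greaterThanLessThan_subseteq_atLeastAtMost_iff\<close>)
  also have "\<dots> = (\<Prod>j<d. if j \<in> S then hi j - lo j else 1)"
    using lohi by (intro prod.cong) auto
  finally show "vol d (open_box d S lo hi) = (\<Prod>j\<in>S. hi j - lo j)" using restrict by simp
qed

text \<open>
  Moving all faces outwards at the same speed, and stopping each of them at the boundary of the
  cube, increases the volume continuously up to \<open>1\<close>.  This reduces boxes that are too small for
  the net to boxes of the critical volume.
\<close>

lemma box_enlarge_to_volume:
  fixes w :: real
  assumes "finite S" and lohi: "\<And>j. j \<in> S \<Longrightarrow> 0 \<le> lo j \<and> lo j \<le> hi j \<and> hi j \<le> 1"
    and "(\<Prod>j\<in>S. hi j - lo j) \<le> w" and "w \<le> 1"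
  shows "\<exists>lo' hi'. (\<forall>j\<in>S. 0 \<le> lo' j \<and> lo' j \<le> lo j \<and> hi j \<le> hi' j \<and> hi' j \<le> 1)
    \<and> (\<Prod>j\<in>S. hi' j - lo' j) = w"
proof -
  \<comment> \<open>Volume of the box after moving the faces by u.\<close>
  define \<phi> where "\<phi> u = (\<Prod>j\<in>S. min 1 (hi j + u) - max 0 (lo j - u))" for u :: real
  have "\<phi> 0 = (\<Prod>j\<in>S. hi j - lo j)" unfolding \<phi>_def using lohi by (intro prod.cong) auto
  moreover have "\<phi> 1 = (\<Prod>j\<in>S. 1)" unfolding \<phi>_def using lohi by (intro prod.cong) force+
  moreover have "continuous_on {0..1} \<phi>" unfolding \<phi>_def by (intro continuous_intros)
  ultimately obtain u where u: "0 \<le> u" "\<phi> u = w"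
    using IVT'[of \<phi> 0 w 1] assms by auto
  show ?thesis
    by (intro exI[of _ "\<lambda>j. max 0 (lo j - u)"] exI[of _ "\<lambda>j. min 1 (hi j + u)"])
       (use u lohi in \<open>auto simp: \<phi>_def\<close>)
qed

text \<open>
  In coordinate \<open>j\<close> the grid has \<open>q * 2 ^ a j\<close> cells, where \<open>2 ^ a j\<close> is the order of the inverse
  side length, and \<open>g j = (m, r)\<close> describes the interval that starts at grid point \<open>m\<close> and consists of \<open>r\<close>
  cells.  The inner box omits the first and the last of these cells.
\<close>

definition outer_box where
  "outer_box d q S a g = closed_box d S
     (\<lambda>j. real (fst (g j)) / (real q * 2 ^ a j))
     (\<lambda>j. (real (fst (g j)) + real (snd (g j))) / (real q * 2 ^ a j))"

definition inner_box where
  "inner_box d q S a g = open_box d S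
     (\<lambda>j. (real (fst (g j)) + 1) / (real q * 2 ^ a j))
     (\<lambda>j. (real (fst (g j)) + real (snd (g j)) - 1) / (real q * 2 ^ a j))"

text \<open>
  The product of the scales \<open>2 ^ a j\<close> is of the order of the inverse volume, whence the bound \<open>W\<close>.
  A side is at most \<open>q\<close> meshes long, and rounding adds at most one cell at each end, hence \<open>r \<le> q + 2\<close>.
\<close>

definition grid_codes :: "nat \<Rightarrow> nat \<Rightarrow> nat \<Rightarrow> real \<Rightarrow> (nat set \<times> (nat \<Rightarrow> nat) \<times> (nat \<Rightarrow> nat \<times> nat)) set" where
  "grid_codes d s q W =
    (SIGMA S:{S. S \<subseteq> {..<d} \<and> card S \<le> s}.
     SIGMA a:{a \<in> PiE S (\<lambda>_. UNIV). (\<Prod>j\<in>S. 2 ^ a j) \<le> W}.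
       PiE S (\<lambda>j. {..q * 2 ^ a j} \<times> {..q + 2}))"

definition box_net :: "nat \<Rightarrow> nat \<Rightarrow> nat \<Rightarrow> real \<Rightarrow> ((nat \<Rightarrow> real) set \<times> (nat \<Rightarrow> real) set) set" where
  "box_net d s q W = (\<lambda>(S, a, g). (outer_box d q S a g, inner_box d q S a g)) ` grid_codes d s q W"

text \<open>
  A set of at most \<open>s\<close> elements is listed by a word of length exactly \<open>s\<close> in which the extra letter
  \<open>d\<close> serves as padding.
\<close>

lemma card_small_subsets: "card {S. S \<subseteq> {..<d} \<and> card S \<le> s} \<le> (d + 1) ^ s"
proof -
  have "{S. S \<subseteq> {..<d} \<and> card S \<le> s}
      \<subseteq> (\<lambda>xs. set xs - {d}) ` {xs. set xs \<subseteq> {..d} \<and> length xs = s}"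
  proof clarify
    fix S :: "nat set" assume S: "S \<subseteq> {..<d}" "card S \<le> s"
    define xs where "xs = sorted_list_of_set S @ replicate (s - card S) d"
    have "finite S" using S finite_subset by auto
    then have "set xs \<subseteq> {..d} \<and> length xs = s" "S = set xs - {d}"
      using S by (auto simp: xs_def)
    then show "S \<in> (\<lambda>xs. set xs - {d}) ` {xs. set xs \<subseteq> {..d} \<and> length xs = s}" by blast
  qed
  then have "card {S. S \<subseteq> {..<d} \<and> card S \<le> s} \<le> card {xs. set xs \<subseteq> {..d} \<and> length xs = s}"
    by (rule surj_card_le[rotated]) (simp add: finite_lists_length_eq)
  also have "\<dots> = (d + 1) ^ s" by (simp add: card_lists_length_eq)
  finally show ?thesis .
qed

lemma scale_vectors_subset:
  fixes S :: "nat set"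
  assumes "finite S"
  shows "{a \<in> PiE S (\<lambda>_. UNIV). (\<Prod>j\<in>S. (2::real) ^ a j) \<le> W} \<subseteq> PiE S (\<lambda>_. {..nat \<lfloor>log 2 W\<rfloor>})"
proof clarify
  fix a :: "nat \<Rightarrow> nat"
  assume a: "a \<in> PiE S (\<lambda>_. UNIV)" and W: "(\<Prod>j\<in>S. (2::real) ^ a j) \<le> W"
  have "a j \<le> nat \<lfloor>log 2 W\<rfloor>" if "j \<in> S" for j
  proof -
    have "(2::real) ^ a j \<le> (\<Prod>j\<in>S. 2 ^ a j)"
      using prod_mono2[OF assms, of "{j}" "\<lambda>j. (2::real) ^ a j"] that by auto
    also have "\<dots> \<le> W" by fact
    finally have le: "(2::real) ^ a j \<le> W" .
    then have "real (a j) \<le> log 2 W" by (rule le_log_of_power) simp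
    then show ?thesis by (simp add: le_nat_floor)
  qed
  then show "a \<in> PiE S (\<lambda>_. {..nat \<lfloor>log 2 W\<rfloor>})" using a by (auto simp: PiE_iff)
qed

text \<open>
  The first two factors count index sets and scales, the others positions.  The number of lower faces,
  \<open>q * 2 ^ a j\<close> in coordinate \<open>j\<close>, depends on the scale, but the product over \<open>S\<close> of its
  second factor is bounded by \<open>W\<close>; this is why \<open>W\<close> is not raised to the power \<open>s\<close>.
\<close>

lemma
  assumes q: "1 \<le> q" and W: "1 \<le> W"
  shows finite_grid_codes: "finite (grid_codes d s q W)"
    and card_grid_codes: "real (card (grid_codes d s q W))
      \<le> (real d + 1) ^ s * (real (nat \<lfloor>log 2 W\<rfloor>) + 1) ^ s * ((2 * real q * (real q + 3)) ^ s * W)"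
proof -
  define A where "A = nat \<lfloor>log 2 W\<rfloor>"
  define \<S> where "\<S> = {S. S \<subseteq> {..<d} \<and> card S \<le> s}"
  define \<A> where "\<A> S = {a \<in> PiE S (\<lambda>_. UNIV). (\<Prod>j\<in>S. 2 ^ a j) \<le> W}" for S :: "nat set"
  define \<G> where "\<G> S a = PiE S (\<lambda>j. {..q * 2 ^ a j} \<times> {..q + 2})" for S :: "nat set" and a :: "nat \<Rightarrow> nat"
  have codes: "grid_codes d s q W = (SIGMA S:\<S>. SIGMA a:\<A> S. \<G> S a)"
    by (simp add: grid_codes_def \<S>_def \<A>_def \<G>_def)
  have finS: "finite \<S>" by (simp add: \<S>_def)
  have S: "finite S" "card S \<le> s" if "S \<in> \<S>" for S
    using that finite_subset by (auto simp: \<S>_def)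
  have subA: "\<A> S \<subseteq> PiE S (\<lambda>_. {..A})" if "S \<in> \<S>" for S
    unfolding \<A>_def A_def by (rule scale_vectors_subset) (rule S[OF that])
  have finA: "finite (\<A> S)" if "S \<in> \<S>" for S
    by (rule finite_subset[OF subA[OF that]]) (use S[OF that] in \<open>auto intro: finite_PiE\<close>)
  have finG: "finite (\<G> S a)" if "S \<in> \<S>" for S a
    using S[OF that] by (auto simp: \<G>_def intro: finite_PiE)
  show "finite (grid_codes d s q W)"
    unfolding codes by (intro finite_SigmaI finS finA finG)
  have cardA: "real (card (\<A> S)) \<le> (real A + 1) ^ s" if "S \<in> \<S>" for S
  proof -
    have "card (\<A> S) \<le> card (PiE S (\<lambda>_. {..A}))"
      by (rule card_mono[OF _ subA[OF that]]) (use S[OF that] in \<open>auto intro: finite_PiE\<close>)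
    also have "\<dots> = (A + 1) ^ card S" using S[OF that] by (simp add: card_PiE)
    also have "\<dots> \<le> (A + 1) ^ s" using S[OF that] by (intro power_increasing) auto
    finally have "real (card (\<A> S)) \<le> real ((A + 1) ^ s)" by (rule of_nat_mono)
    then show ?thesis by (simp add: add.commute)
  qed
  define B where "B = (2 * real q * (real q + 3)) ^ s * W"
  have B: "0 \<le> B" using W by (simp add: B_def)
  have cardG: "real (card (\<G> S a)) \<le> B" if "S \<in> \<S>" "a \<in> \<A> S" for S a
  proof -
    have "real (card (\<G> S a)) = (\<Prod>j\<in>S. (real q * 2 ^ a j + 1) * (real q + 3))"
      using S[OF that(1)] by (simp add: \<G>_def card_PiE card_cartesian_product algebra_simps)
    also have "\<dots> \<le> (\<Prod>j\<in>S. (2 * real q * (real q + 3)) * 2 ^ a j)"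
    proof (intro prod_mono conjI)
      fix j
      have "1 \<le> real q * 2 ^ a j" using q mult_mono[of 1 "real q" 1 "2 ^ a j"] by simp
      then have "(real q * 2 ^ a j + 1) * (real q + 3) \<le> (2 * (real q * 2 ^ a j)) * (real q + 3)"
        by (intro mult_right_mono) auto
      then show "(real q * 2 ^ a j + 1) * (real q + 3) \<le> (2 * real q * (real q + 3)) * 2 ^ a j"
        by (simp only: mult_ac)
    qed auto
    also have "\<dots> = (2 * real q * (real q + 3)) ^ card S * (\<Prod>j\<in>S. 2 ^ a j)"
      by (simp add: prod.distrib)
    also have "\<dots> \<le> B" unfolding B_def
    proof (intro mult_mono power_increasing)
      show "1 \<le> 2 * real q * (real q + 3)"
        using q mult_mono[of 1 "2 * real q" 1 "real q + 3"] by simp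
    qed (use S[OF that(1)] that(2) in \<open>auto simp: \<A>_def intro: prod_nonneg\<close>)
    finally show ?thesis .
  qed
  have "real (card (grid_codes d s q W)) = (\<Sum>S\<in>\<S>. \<Sum>a\<in>\<A> S. real (card (\<G> S a)))"
    unfolding codes using finS finA finG by (simp add: card_SigmaI finite_SigmaI)
  also have "\<dots> \<le> (\<Sum>S\<in>\<S>. (real A + 1) ^ s * B)"
  proof (rule sum_mono)
    fix S assume S': "S \<in> \<S>"
    have "(\<Sum>a\<in>\<A> S. real (card (\<G> S a))) \<le> real (card (\<A> S)) * B"
      by (rule sum_bounded_above) (rule cardG[OF S'])
    also have "\<dots> \<le> (real A + 1) ^ s * B" by (rule mult_right_mono[OF cardA[OF S'] B])
    finally show "(\<Sum>a\<in>\<A> S. real (card (\<G> S a))) \<le> (real A + 1) ^ s * B" .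
  qed
  also have "\<dots> = real (card \<S>) * ((real A + 1) ^ s * B)" by simp
  also have "\<dots> \<le> (real d + 1) ^ s * ((real A + 1) ^ s * B)"
  proof (rule mult_right_mono)
    have "real (card \<S>) \<le> real ((d + 1) ^ s)"
      unfolding \<S>_def by (rule of_nat_mono[OF card_small_subsets])
    then show "real (card \<S>) \<le> (real d + 1) ^ s" by (simp add: add.commute)
  qed (use B in auto)
  finally show "real (card (grid_codes d s q W))
      \<le> (real d + 1) ^ s * (real (nat \<lfloor>log 2 W\<rfloor>) + 1) ^ s * ((2 * real q * (real q + 3)) ^ s * W)"
    by (simp add: A_def B_def mult_ac)
qed

lemma one_minus_sum_le_prod:
  fixes x :: "'i \<Rightarrow> real"
  assumes "finite S" and "\<And>j. j \<in> S \<Longrightarrow> 0 \<le> x j \<and> x j \<le> 1"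
  shows "1 - (\<Sum>j\<in>S. x j) \<le> (\<Prod>j\<in>S. 1 - x j)"
  using assms
proof (induction rule: finite_induct)
  case (insert i S)
  have p: "(\<Prod>j\<in>S. 1 - x j) \<le> 1" using insert by (intro prod_le_1) auto
  have "1 - (x i + (\<Sum>j\<in>S. x j)) \<le> (\<Prod>j\<in>S. 1 - x j) - x i" using insert by auto
  also have "\<dots> \<le> (\<Prod>j\<in>S. 1 - x j) - x i * (\<Prod>j\<in>S. 1 - x j)"
    using mult_left_mono[OF p, of "x i"] insert by simp
  finally show ?case using insert by (simp add: algebra_simps)
qed simp

text \<open>
  The scale is the last exponent before the powers of \<open>1 / 2\<close> fall below \<open>l\<close>.
\<close>

lemma dyadic_scale:
  fixes l :: real
  assumes "0 < l" "l \<le> 1"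
  obtains a :: nat where "l \<le> 1 / 2 ^ a" "1 / 2 ^ a < 2 * l"
proof -
  obtain N where N: "(1 / 2) ^ N < l" using real_arch_pow_inv[of l "1 / 2"] assms by auto
  define m where "m = (LEAST N. (1 / 2) ^ N < l)"
  have m: "(1 / 2) ^ m < l" unfolding m_def by (rule LeastI[of _ N]) (rule N)
  with assms have "m \<noteq> 0" by (intro notI) simp
  then obtain a where a: "m = Suc a" using not0_implies_Suc by blast
  have "\<not> (1 / 2) ^ a < l" unfolding a using not_less_Least[of a "\<lambda>N. (1 / 2) ^ N < l"]
    a m_def by simp
  with m a show ?thesis by (intro that[of a]) (auto simp: power_one_over)
qed

text \<open>
  Faces are rounded outwards to the grid.  A side has \<open>r > q / 2\<close> cells, so dropping two of them
  loses a fraction of at most \<open>4 / q\<close> of its length, and at most \<open>s\<close> sides are affected.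
\<close>

lemma box_net_approximates:
  assumes S: "S \<subseteq> {..<d}" "card S \<le> s" and q: "4 \<le> q" and W: "1 \<le> W"
    and lohi: "\<And>j. j \<in> S \<Longrightarrow> 0 \<le> lo j \<and> lo j < hi j \<and> hi j \<le> 1"
    and volume: "1 / W \<le> (\<Prod>j\<in>S. hi j - lo j)"
  shows "\<exists>Ro Ri. (Ro, Ri) \<in> box_net d s q W \<and> closed_box d S lo hi \<subseteq> Ro
    \<and> Ri \<subseteq> open_box d S lo hi \<and> (1 - 4 * real s / real q) * vol d Ro \<le> vol d Ri"
proof -
  have finS: "finite S" using S finite_subset by auto
  have "\<exists>a. \<forall>j\<in>S. hi j - lo j \<le> 1 / 2 ^ a j \<and> 1 / 2 ^ a j < 2 * (hi j - lo j)"
  proof (rule bchoice, rule ballI)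
    fix j assume j: "j \<in> S"
    have "0 < hi j - lo j" "hi j - lo j \<le> 1" using lohi[OF j] by auto
    from dyadic_scale[OF this]
    show "\<exists>a. hi j - lo j \<le> 1 / 2 ^ a \<and> 1 / 2 ^ a < 2 * (hi j - lo j)" by metis
  qed
  then obtain a0 where a0: "\<And>j. j \<in> S \<Longrightarrow> hi j - lo j \<le> 1 / 2 ^ a0 j"
    "\<And>j. j \<in> S \<Longrightarrow> 1 / 2 ^ a0 j < 2 * (hi j - lo j)" by metis
  define a where "a = restrict a0 S"
  define Q where "Q j = real q * 2 ^ a j" for j
  define m where "m j = nat \<lfloor>lo j * Q j\<rfloor>" for j
  define r where "r j = nat (\<lceil>hi j * Q j\<rceil> - \<lfloor>lo j * Q j\<rfloor>)" for j
  define g where "g = restrict (\<lambda>j. (m j, r j)) S"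
  have Q: "0 < Q j" for j using q by (simp add: Q_def)
  have len: "(hi j - lo j) * Q j \<le> real q" "real q < 2 * ((hi j - lo j) * Q j)" if "j \<in> S" for j
  proof -
    have "(hi j - lo j) * Q j \<le> (1 / 2 ^ a j) * Q j"
      using a0(1)[OF that] Q[of j] that by (intro mult_right_mono) (auto simp: a_def)
    then show "(hi j - lo j) * Q j \<le> real q" by (simp add: Q_def)
    have "(1 / 2 ^ a j) * Q j < (2 * (hi j - lo j)) * Q j"
      using a0(2)[OF that] Q[of j] that by (intro mult_strict_right_mono) (auto simp: a_def)
    then show "real q < 2 * ((hi j - lo j) * Q j)" by (simp only: mult.assoc) (simp add: Q_def)
  qed
  have grid: "real (m j) = \<lfloor>lo j * Q j\<rfloor>" "real (m j) + real (r j) = \<lceil>hi j * Q j\<rceil>"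
    "real (m j) \<le> lo j * Q j" "lo j * Q j \<le> real (m j) + 1"
    "hi j * Q j \<le> real (m j) + real (r j)" "real (m j) + real (r j) - 1 \<le> hi j * Q j"
    "real (m j) + real (r j) \<le> Q j"
    "real (r j) \<le> real q + 2" "real q < 2 * real (r j)" if j: "j \<in> S" for j
  proof -
    have lo0: "0 \<le> lo j * Q j" using lohi[OF j] Q[of j] by simp
    have lohi': "lo j * Q j \<le> hi j * Q j" using lohi[OF j] Q[of j] by (intro mult_right_mono) auto
    have hi1: "hi j * Q j \<le> Q j" using lohi[OF j] Q[of j] mult_right_mono[of "hi j" 1 "Q j"] by simp
    show m: "real (m j) = \<lfloor>lo j * Q j\<rfloor>" using lo0 by (simp add: m_def)
    have "\<lfloor>lo j * Q j\<rfloor> \<le> \<lceil>hi j * Q j\<rceil>" using lohi' by linarith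
    then have r: "real (r j) = \<lceil>hi j * Q j\<rceil> - \<lfloor>lo j * Q j\<rfloor>" by (simp add: r_def)
    show mr: "real (m j) + real (r j) = \<lceil>hi j * Q j\<rceil>" using m r by simp
    show "real (m j) \<le> lo j * Q j" "lo j * Q j \<le> real (m j) + 1" using m by linarith+
    show hi_le: "hi j * Q j \<le> real (m j) + real (r j)" using mr by linarith
    show hi_ge: "real (m j) + real (r j) - 1 \<le> hi j * Q j" using mr by linarith
    have "\<lceil>hi j * Q j\<rceil> \<le> int (q * 2 ^ a j)" using hi1 by (simp add: Q_def ceiling_le_iff)
    then have "real_of_int \<lceil>hi j * Q j\<rceil> \<le> real_of_int (int (q * 2 ^ a j))" by (rule of_int_le_iff[THEN iffD2])
    then show "real (m j) + real (r j) \<le> Q j" using mr by (simp add: Q_def)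
    have "real (r j) \<le> (hi j - lo j) * Q j + 2" "(hi j - lo j) * Q j \<le> real (r j)"
      using r by (simp_all add: left_diff_distrib) linarith+
    then show "real (r j) \<le> real q + 2" "real q < 2 * real (r j)" using len[OF j] by linarith+
  qed
  have r2: "2 < real (r j)" if "j \<in> S" for j using grid(9)[OF that] q by linarith
  have code: "(S, a, g) \<in> grid_codes d s q W"
  proof -
    have "(\<Prod>j\<in>S. 2 ^ a j) \<le> (\<Prod>j\<in>S. 1 / (hi j - lo j))"
    proof (intro prod_mono conjI)
      fix j assume j: "j \<in> S"
      show "2 ^ a j \<le> 1 / (hi j - lo j)"
        using a0(1)[OF j] lohi[OF j] j by (simp add: a_def field_simps)
    qed auto
    also have "\<dots> = 1 / (\<Prod>j\<in>S. hi j - lo j)" by (simp add: prod_dividef)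
    also have "\<dots> \<le> W" 
    proof -
      have "0 < (\<Prod>j\<in>S. hi j - lo j)" using lohi by (intro prod_pos) auto
      then show ?thesis using volume W by (simp add: field_simps)
    qed
    finally have prodW: "(\<Prod>j\<in>S. 2 ^ a j) \<le> W" .
    have "m j \<le> q * 2 ^ a j" "r j \<le> q + 2" if "j \<in> S" for j
    proof -
      have "real (m j) \<le> Q j" using grid(7)[OF that] by linarith
      then have "real (m j) \<le> real (q * 2 ^ a j)" by (simp add: Q_def)
      then show "m j \<le> q * 2 ^ a j" by (simp only: of_nat_le_iff)
      show "r j \<le> q + 2" using grid(8)[OF that] by linarith
    qed
    then show ?thesis using S prodW by (auto simp: grid_codes_def a_def g_def)
  qed
  have outer: "outer_box d q S a g = closed_box d S (\<lambda>j. m j / Q j) (\<lambda>j. (real (m j) + real (r j)) / Q j)"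
    by (auto simp: outer_box_def closed_box_def g_def Q_def)
  have inner: "inner_box d q S a g = open_box d S (\<lambda>j. (real (m j) + 1) / Q j) (\<lambda>j. (real (m j) + real (r j) - 1) / Q j)"
    by (auto simp: inner_box_def open_box_def g_def Q_def)
  have vol_o: "vol d (outer_box d q S a g) = (\<Prod>j\<in>S. real (r j) / Q j)"
    unfolding outer
  proof (subst vol_closed_box[OF S(1)])
    fix j assume "j \<in> S"
    then show "0 \<le> real (m j) / Q j \<and> real (m j) / Q j \<le> (real (m j) + real (r j)) / Q j
        \<and> (real (m j) + real (r j)) / Q j \<le> 1"
      using Q[of j] grid(7)[of j] by (simp add: divide_right_mono)
  qed (simp add: diff_divide_distrib[symmetric])
  have vol_i: "vol d (inner_box d q S a g) = (\<Prod>j\<in>S. (real (r j) - 2) / Q j)"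
    unfolding inner
  proof (subst vol_open_box[OF S(1)])
    fix j assume j: "j \<in> S"
    then show "0 \<le> (real (m j) + 1) / Q j
        \<and> (real (m j) + 1) / Q j \<le> (real (m j) + real (r j) - 1) / Q j
        \<and> (real (m j) + real (r j) - 1) / Q j \<le> 1"
      using Q[of j] grid(7)[OF j] r2[OF j] by (simp add: divide_right_mono)
  qed (simp add: diff_divide_distrib[symmetric] algebra_simps)
  show ?thesis
  proof (intro exI conjI)
    show "(outer_box d q S a g, inner_box d q S a g) \<in> box_net d s q W"
      unfolding box_net_def using code by force
    show "closed_box d S lo hi \<subseteq> outer_box d q S a g"
      unfolding outer closed_box_def
    proof clarsimp
      fix x j assume j: "j \<in> S" and x: "\<forall>j\<in>S. lo j \<le> x j \<and> x j \<le> hi j"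
      have "lo j * Q j \<le> x j * Q j" "x j * Q j \<le> hi j * Q j"
        using x j Q[of j] by (auto intro!: mult_right_mono)
      then have "real (m j) \<le> x j * Q j" "x j * Q j \<le> real (m j) + real (r j)"
        using grid(3,5)[OF j] by linarith+
      then show "real (m j) / Q j \<le> x j \<and> x j \<le> (real (m j) + real (r j)) / Q j"
        using Q[of j] by (auto simp: pos_divide_le_eq pos_le_divide_eq)
    qed
    show "inner_box d q S a g \<subseteq> open_box d S lo hi"
      unfolding inner open_box_def
    proof clarsimp
      fix x j assume j: "j \<in> S"
        and x: "\<forall>j\<in>S. (real (m j) + 1) / Q j < x j \<and> x j < (real (m j) + real (r j) - 1) / Q j"
      then have "real (m j) + 1 < x j * Q j" "x j * Q j < real (m j) + real (r j) - 1"
        using Q[of j] by (auto simp: field_simps)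
      then have "lo j * Q j < x j * Q j" "x j * Q j < hi j * Q j"
        using grid[OF j] by linarith+
      then show "lo j < x j \<and> x j < hi j" using Q[of j] by simp
    qed
    have "(\<Sum>j\<in>S. 2 / real (r j)) \<le> (\<Sum>j\<in>S. 4 / real q)"
      by (intro sum_mono) (use grid(9) r2 q in \<open>force simp: field_simps\<close>)
    also have "\<dots> = 4 * real (card S) / real q" by simp
    also have "\<dots> \<le> 4 * real s / real q" using S q by (intro divide_right_mono) auto
    finally have "1 - 4 * real s / real q \<le> 1 - (\<Sum>j\<in>S. 2 / real (r j))" by simp
    also have "\<dots> \<le> (\<Prod>j\<in>S. 1 - 2 / real (r j))"
    proof (rule one_minus_sum_le_prod[OF finS])
      fix j assume "j \<in> S"
      then show "0 \<le> 2 / real (r j) \<and> 2 / real (r j) \<le> 1" using r2[of j] by simp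
    qed
    finally have "(1 - 4 * real s / real q) * vol d (outer_box d q S a g)
        \<le> (\<Prod>j\<in>S. 1 - 2 / real (r j)) * vol d (outer_box d q S a g)"
      by (intro mult_right_mono) auto
    also have "\<dots> = (\<Prod>j\<in>S. (1 - 2 / real (r j)) * (real (r j) / Q j))"
      by (simp only: vol_o prod.distrib)
    also have "\<dots> = vol d (inner_box d q S a g)"
      unfolding vol_i
    proof (intro prod.cong refl)
      fix j assume "j \<in> S"
      then show "(1 - 2 / real (r j)) * (real (r j) / Q j) = (real (r j) - 2) / Q j"
        using r2[of j] by (simp add: left_diff_distrib diff_divide_distrib)
    qed
    finally show "(1 - 4 * real s / real q) * vol d (outer_box d q S a g) \<le> vol d (inner_box d q S a g)" .
  qed
qed

lemma box_net_sets:
  assumes "(Ro, Ri) \<in> box_net d s q W"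
  shows "Ro \<in> sets (cube_lebesgue d)" "Ri \<in> sets (cube_lebesgue d)"
  using assms by (auto simp: box_net_def grid_codes_def outer_box_def inner_box_def intro!: sets_boxes)

section \<open>Leaves of valid partitions\<close>

text \<open>
  The node reached by a list of splits \<open>(j, \<tau>, low)\<close>, most recent split first; \<open>low\<close> tells which
  of the two children is entered.
\<close>

definition node :: "nat \<Rightarrow> (nat \<times> real \<times> bool) list \<Rightarrow> (nat \<Rightarrow> real) set" where
  "node d c = {x \<in> cube d. \<forall>(j, \<tau>, low)\<in>set c. (x j \<le> \<tau>) = low}"

lemma node_Nil [simp]: "node d [] = cube d"
  and node_Cons_low [simp]: "node d ((j, \<tau>, True) # c) = node d c \<inter> {x. x j \<le> \<tau>}"
  and node_Cons_high [simp]: "node d ((j, \<tau>, False) # c) = node d c \<inter> {x. x j > \<tau>}"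
  by (auto simp: node_def)

lemma node_Cons: "node d ((j, \<tau>, low) # c) = {x \<in> node d c. (x j \<le> \<tau>) = low}"
  by (auto simp: node_def)

text \<open>
  The conditions for a single node to be a leaf of some valid partition: the siblings along the
  path must also be large enough, both relative to their parent and in absolute terms, since each
  of them is a leaf of that partition or a union of such leaves.
\<close>

fun valid_split_path :: "nat \<Rightarrow> real \<Rightarrow> nat \<Rightarrow> nat \<Rightarrow> (nat \<Rightarrow> nat \<Rightarrow> real) \<Rightarrow> (nat \<times> real \<times> bool) list \<Rightarrow> bool" where
  "valid_split_path d \<alpha> k n X [] \<longleftrightarrow> k \<le> card (points_in n X (node d []))"
| "valid_split_path d \<alpha> k n X ((j, \<tau>, low) # c) \<longleftrightarrow>
     valid_split_path d \<alpha> k n X c \<and> j < d \<and> 0 \<le> \<tau> \<and> \<tau> \<le> 1 \<and>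
     (\<forall>b. \<alpha> * real (card (points_in n X (node d c))) \<le> real (card (points_in n X (node d ((j, \<tau>, b) # c))))
        \<and> k \<le> card (points_in n X (node d ((j, \<tau>, b) # c))))"

lemma finite_points_in [simp]: "finite (points_in n X A)"
  by (simp add: points_in_def)

lemma card_points_in_mono: "A \<subseteq> B \<Longrightarrow> card (points_in n X A) \<le> card (points_in n X B)"
  by (rule card_mono) (auto simp: points_in_def)

lemma valid_split_path_card: "valid_split_path d \<alpha> k n X c \<Longrightarrow> k \<le> card (points_in n X (node d c))"
  by (cases "(d, \<alpha>, k, n, X, c)" rule: valid_split_path.cases) auto

text \<open>
  The bound \<open>k\<close> is assumed for the final nodes only, but it passes to every earlier partition since
  a parent contains its children.
\<close>

lemma recursive_partition_node:
  assumes "\<Lambda> \<in> recursive_partitions d \<alpha> n X" and "\<And>\<nu>. \<nu> \<in> \<Lambda> \<Longrightarrow> k \<le> card (points_in n X \<nu>)" and "\<nu> \<in> \<Lambda>"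
  shows "\<exists>c. valid_split_path d \<alpha> k n X c \<and> \<nu> = node d c"
  using assms
proof (induction arbitrary: \<nu> rule: recursive_partitions.induct)
  case root
  then show ?case by (intro exI[of _ "[]"]) auto
next
  case (split \<Lambda> \<mu> j \<tau> \<nu>l \<nu>r)
  have k_l: "k \<le> card (points_in n X \<nu>l)" and k_r: "k \<le> card (points_in n X \<nu>r)"
    using split.prems(1) by auto
  have "k \<le> card (points_in n X \<mu>)"
    using k_l card_points_in_mono[of \<nu>l \<mu> n X] split.hyps by auto
  then have "k \<le> card (points_in n X \<mu>')" if "\<mu>' \<in> \<Lambda>" for \<mu>'
    using split.prems(1)[of \<mu>'] that by (cases "\<mu>' = \<mu>") auto
  note IH = split.IH[OF this]
  obtain c where c: "valid_split_path d \<alpha> k n X c" "\<mu> = node d c" using IH[OF _ split.hyps(2)] by auto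
  have both: "valid_split_path d \<alpha> k n X ((j, \<tau>, b) # c)" for b
    using c split.hyps k_l k_r by (auto split: bool.split intro: bool.exhaust simp: all_bool_eq)
  from split.prems(2) consider "\<nu> \<in> \<Lambda>" | "\<nu> = node d ((j, \<tau>, True) # c)" | "\<nu> = node d ((j, \<tau>, False) # c)"
    using c split.hyps by auto
  then show ?case using IH both by cases blast+
qed

text \<open>
  The path itself, with all siblings left unsplit, is a valid partition.
\<close>

lemma node_in_valid_partition:
  assumes "valid_split_path d \<alpha> k n X c"
  shows "\<exists>\<Lambda>\<in>valid_partitions d \<alpha> k n X. node d c \<in> \<Lambda>"
  using assms
proof (induction c)
  case Nil
  then show ?case
    by (intro bexI[of _ "{cube d}"]) (auto simp: valid_partitions_def intro: recursive_partitions.root)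
next
  case (Cons a c)
  obtain j \<tau> low where a: "a = (j, \<tau>, low)" by (cases a)
  from Cons a obtain \<Lambda> where \<Lambda>: "\<Lambda> \<in> valid_partitions d \<alpha> k n X" "node d c \<in> \<Lambda>" by auto
  let ?l = "node d ((j, \<tau>, True) # c)" and ?r = "node d ((j, \<tau>, False) # c)"
  have v: "j < d" "0 \<le> \<tau>" "\<tau> \<le> 1"
    "\<And>b. \<alpha> * real (card (points_in n X (node d c))) \<le> real (card (points_in n X (node d ((j, \<tau>, b) # c))))"
    "\<And>b. k \<le> card (points_in n X (node d ((j, \<tau>, b) # c)))"
    using Cons.prems unfolding a by (auto simp del: node_Cons_low node_Cons_high)
  have "(\<Lambda> - {node d c}) \<union> {?l, ?r} \<in> recursive_partitions d \<alpha> n X"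
    using \<Lambda> v(1-3) v(4)[of True] v(4)[of False]
    by (intro recursive_partitions.split[of _ d \<alpha> n X "node d c" j \<tau>]) (auto simp: valid_partitions_def)
  then have valid: "(\<Lambda> - {node d c}) \<union> {?l, ?r} \<in> valid_partitions d \<alpha> k n X"
    using \<Lambda> v(5) unfolding valid_partitions_def by blast
  have "node d (a # c) \<in> {?l, ?r}" unfolding a by (cases low) auto
  then show ?case by (intro bexI[OF _ valid] UnI2)
qed

lemma recursive_partition_partitions:
  assumes "\<Lambda> \<in> recursive_partitions d \<alpha> n X"
  shows "\<Union>\<Lambda> = cube d \<and> (\<forall>\<nu>\<in>\<Lambda>. \<forall>\<nu>'\<in>\<Lambda>. \<nu> \<noteq> \<nu>' \<longrightarrow> \<nu> \<inter> \<nu>' = {})"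
  using assms
proof induction
  case (split \<Lambda> \<nu> j \<tau> \<nu>l \<nu>r)
  have sub: "\<nu>l \<union> \<nu>r = \<nu>" "\<nu>l \<inter> \<nu>r = {}" using split.hyps by auto
  have dis: "\<nu> \<inter> \<nu>' = {}" if "\<nu>' \<in> \<Lambda> - {\<nu>}" for \<nu>' using that split by blast
  have dis': "\<nu>l \<inter> \<nu>' = {}" "\<nu>r \<inter> \<nu>' = {}" if "\<nu>' \<in> \<Lambda> - {\<nu>}" for \<nu>' using dis[OF that] sub by auto
  have "\<Union>((\<Lambda> - {\<nu>}) \<union> {\<nu>l, \<nu>r}) = \<Union>\<Lambda>" using sub split.hyps(2) by blast
  moreover have "\<forall>\<mu>\<in>(\<Lambda> - {\<nu>}) \<union> {\<nu>l, \<nu>r}. \<forall>\<mu>'\<in>(\<Lambda> - {\<nu>}) \<union> {\<nu>l, \<nu>r}. \<mu> \<noteq> \<mu>' \<longrightarrow> \<mu> \<inter> \<mu>' = {}"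
    using sub(2) dis' split.IH by (metis DiffD1 Int_commute Un_iff empty_iff insert_iff)
  ultimately show ?case using split.IH by simp
qed auto

lemma
  assumes "\<Lambda> \<in> recursive_partitions d \<alpha> n X"
  shows leaf_eq: "\<nu> \<in> \<Lambda> \<Longrightarrow> x \<in> \<nu> \<Longrightarrow> leaf \<Lambda> x = \<nu>"
    and leaf_in: "x \<in> cube d \<Longrightarrow> leaf \<Lambda> x \<in> \<Lambda>"
proof -
  note p = recursive_partition_partitions[OF assms]
  show eq: "leaf \<Lambda> x = \<nu>" if "\<nu> \<in> \<Lambda>" "x \<in> \<nu>" for \<nu>
    unfolding leaf_def by (rule the_equality) (use p that in blast)+
  show "leaf \<Lambda> x \<in> \<Lambda>" if "x \<in> cube d"
  proof -
    from that p obtain \<nu> where "\<nu> \<in> \<Lambda>" "x \<in> \<nu>" by blast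
    with eq[OF this] show ?thesis by simp
  qed
qed

definition node_deviation ::
    "nat \<Rightarrow> ((nat \<Rightarrow> real) \<times> real) measure \<Rightarrow> (nat \<Rightarrow> nat \<Rightarrow> real) \<Rightarrow> (nat \<Rightarrow> real) \<Rightarrow> (nat \<Rightarrow> real) set \<Rightarrow> real" where
  "node_deviation n D X Y \<nu> =
     \<bar>(\<Sum>i\<in>points_in n X \<nu>. Y i) / real (card (points_in n X \<nu>))
       - (\<integral>z. snd z \<partial>uniform_measure D {z \<in> space D. fst z \<in> \<nu>})\<bar>"

text \<open>
  The supremum over points and partitions is a supremum over single nodes.  As \<open>k \<ge> 1\<close>, a node on
  a valid path contains a sample point, which lies in no other leaf and so witnesses the node.
\<close>

lemma sup_deviation_le_iff:
  assumes k: "1 \<le> k"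
  shows "sup_deviation d \<alpha> k n D X Y \<le> ereal B
    \<longleftrightarrow> (\<forall>c. valid_split_path d \<alpha> k n X c \<longrightarrow> node_deviation n D X Y (node d c) \<le> B)" (is "?L = ?R")
proof -
  have "?L \<longleftrightarrow> (\<forall>x\<in>cube d. \<forall>\<Lambda>\<in>valid_partitions d \<alpha> k n X. node_deviation n D X Y (leaf \<Lambda> x) \<le> B)"
    by (auto simp: sup_deviation_def SUP_le_iff node_deviation_def valid_tree_def optimal_tree_def)
  also have "\<dots> \<longleftrightarrow> ?R"
  proof (intro iffI allI impI ballI)
    fix c assume L: "\<forall>x\<in>cube d. \<forall>\<Lambda>\<in>valid_partitions d \<alpha> k n X. node_deviation n D X Y (leaf \<Lambda> x) \<le> B"
      and c: "valid_split_path d \<alpha> k n X c"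
    obtain \<Lambda> where \<Lambda>: "\<Lambda> \<in> valid_partitions d \<alpha> k n X" "node d c \<in> \<Lambda>"
      using node_in_valid_partition[OF c] by auto
    have "points_in n X (node d c) \<noteq> {}" using valid_split_path_card[OF c] k by auto
    then obtain x where x: "x \<in> node d c" by (auto simp: points_in_def)
    then have "x \<in> cube d" by (auto simp: node_def)
    moreover have "leaf \<Lambda> x = node d c"
      using \<Lambda> x by (intro leaf_eq) (auto simp: valid_partitions_def)
    ultimately show "node_deviation n D X Y (node d c) \<le> B" using L \<Lambda> by metis
  next
    fix x \<Lambda> assume R: ?R and x: "x \<in> cube d" and \<Lambda>: "\<Lambda> \<in> valid_partitions d \<alpha> k n X"
    then have "leaf \<Lambda> x \<in> \<Lambda>" by (auto simp: valid_partitions_def intro: leaf_in)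
    then show "node_deviation n D X Y (leaf \<Lambda> x) \<le> B"
      using R \<Lambda> recursive_partition_node[of \<Lambda> d \<alpha> n X k "leaf \<Lambda> x"] by (auto simp: valid_partitions_def)
  qed
  finally show ?thesis .
qed

text \<open>
  A split in a fresh coordinate enlarges \<open>S\<close> and removes at least a fraction \<open>\<alpha>\<close> of the points, namely
  those in the sibling; a split in an old coordinate only moves a face.
\<close>

lemma node_is_box:
  assumes "0 \<le> \<alpha>" "\<alpha> \<le> 1" and "valid_split_path d \<alpha> k n X c"
  shows "\<exists>S lo hi. S \<subseteq> {..<d} \<and> (\<forall>j\<in>S. 0 \<le> lo j \<and> hi j \<le> 1)
    \<and> open_box d S lo hi \<subseteq> node d c \<and> node d c \<subseteq> closed_box d S lo hi
    \<and> real (card (points_in n X (node d c))) \<le> (1 - \<alpha>) ^ card S * real n"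
  using assms(3)
proof (induction c)
  case Nil
  have "card (points_in n X (cube d)) \<le> card {..<n}" by (rule card_mono) (auto simp: points_in_def)
  then have "open_box d {} (\<lambda>_. 0) (\<lambda>_. 1) \<subseteq> node d [] \<and> node d [] \<subseteq> closed_box d {} (\<lambda>_. 0) (\<lambda>_. 1)
      \<and> real (card (points_in n X (node d []))) \<le> (1 - \<alpha>) ^ card ({} :: nat set) * real n"
    by (simp add: open_box_def closed_box_def)
  then show ?case by blast
next
  case (Cons a c)
  obtain j \<tau> low where a: "a = (j, \<tau>, low)" by (cases a)
  let ?N = "\<lambda>c. real (card (points_in n X (node d c)))"
  from Cons a have jd: "j < d" and \<tau>: "0 \<le> \<tau>" "\<tau> \<le> 1" and balance: "\<alpha> * ?N c \<le> ?N ((j, \<tau>, \<not> low) # c)"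
    by (auto simp del: node_Cons_low node_Cons_high)
  obtain S lo hi where S: "S \<subseteq> {..<d}" and lohi: "\<And>i. i \<in> S \<Longrightarrow> 0 \<le> lo i \<and> hi i \<le> 1"
    and inner: "open_box d S lo hi \<subseteq> node d c" and outer: "node d c \<subseteq> closed_box d S lo hi"
    and count: "?N c \<le> (1 - \<alpha>) ^ card S * real n"
    using Cons unfolding a valid_split_path.simps by blast
  have finS: "finite S" using S finite_subset by auto
  define lo0 hi0 where "lo0 = (if j \<in> S then lo j else 0)" and "hi0 = (if j \<in> S then hi j else 1)"
  define lo' hi' where "lo' = lo(j := if low then lo0 else max lo0 \<tau>)"
    and "hi' = hi(j := if low then min hi0 \<tau> else hi0)"
  have lohi': "0 \<le> lo' i \<and> hi' i \<le> 1" if "i \<in> insert j S" for i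
    using lohi \<tau> that by (auto simp: lo'_def hi'_def lo0_def hi0_def)
  have inner': "open_box d (insert j S) lo' hi' \<subseteq> node d (a # c)"
  proof
    fix x assume x: "x \<in> open_box d (insert j S) lo' hi'"
    have "lo i < x i \<and> x i < hi i" if "i \<in> S" for i
      using x that by (cases "i = j") (auto simp: open_box_def lo'_def hi'_def lo0_def hi0_def split: if_splits)
    then have "x \<in> open_box d S lo hi" using x by (auto simp: open_box_def)
    moreover have "(x j \<le> \<tau>) = low"
      using x by (auto simp: open_box_def lo'_def hi'_def split: if_splits)
    ultimately show "x \<in> node d (a # c)" using inner by (auto simp: a node_Cons)
  qed
  have outer': "node d (a # c) \<subseteq> closed_box d (insert j S) lo' hi'"
  proof
    fix x assume x: "x \<in> node d (a # c)"
    then have "x \<in> closed_box d S lo hi" and xj: "(x j \<le> \<tau>) = low" using outer by (auto simp: a node_Cons)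
    then have cube: "x \<in> cube d" and box: "\<And>i. i \<in> S \<Longrightarrow> lo i \<le> x i \<and> x i \<le> hi i"
      by (auto simp: closed_box_def)
    have "0 \<le> x j" "x j \<le> 1" using cube jd by (auto simp: cube_def PiE_iff)
    then have "lo' i \<le> x i \<and> x i \<le> hi' i" if "i \<in> insert j S" for i
      using box[of i] xj that by (cases "i = j") (auto simp: lo'_def hi'_def lo0_def hi0_def split: if_splits)
    then show "x \<in> closed_box d (insert j S) lo' hi'" using cube by (auto simp: closed_box_def)
  qed
  have split: "?N c = ?N (a # c) + ?N ((j, \<tau>, \<not> low) # c)"
  proof -
    have "points_in n X (node d c) = points_in n X (node d (a # c)) \<union> points_in n X (node d ((j, \<tau>, \<not> low) # c))"
      by (auto simp: points_in_def a node_Cons)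
    moreover have "points_in n X (node d (a # c)) \<inter> points_in n X (node d ((j, \<tau>, \<not> low) # c)) = {}"
      by (auto simp: points_in_def a node_Cons)
    ultimately show ?thesis by (simp add: card_Un_disjoint)
  qed
  have "?N (a # c) \<le> (1 - \<alpha>) ^ card (insert j S) * real n"
  proof (cases "j \<in> S")
    case True
    have "?N (a # c) \<le> ?N c" using split by linarith
    then show ?thesis using count True by (simp add: insert_absorb)
  next
    case False
    have "?N (a # c) \<le> (1 - \<alpha>) * ?N c" using split balance by (simp add: algebra_simps)
    also have "\<dots> \<le> (1 - \<alpha>) * ((1 - \<alpha>) ^ card S * real n)" using assms count by (intro mult_left_mono) auto
    finally show ?thesis using False finS by (simp add: mult_ac)
  qed
  moreover have "insert j S \<subseteq> {..<d}" using S jd by simp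
  moreover have "\<forall>i\<in>insert j S. 0 \<le> lo' i \<and> hi' i \<le> 1" using lohi' by blast
  ultimately show ?case using inner' outer'
    by (intro exI[of _ "insert j S"] exI[of _ lo'] exI[of _ hi'] conjI) assumption+
qed

section \<open>Simultaneous concentration over the net\<close>

text \<open>
  If \<open>A\<close> is a null set, both sides vanish: the right-hand side by division by zero, the left-hand
  side because the density of the uniform measure is almost everywhere zero.
\<close>

lemma integral_uniform_measure:
  fixes h :: "'b \<Rightarrow> real"
  assumes "finite_measure M" and A [measurable]: "A \<in> sets M" and h [measurable]: "h \<in> borel_measurable M"
  shows "(\<integral>x. h x \<partial>uniform_measure M A) = (\<integral>x. indicator A x * h x \<partial>M) / measure M A"
proof -
  interpret finite_measure M by fact
  show ?thesis
  proof (cases "measure M A = 0")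
    case True
    then have null: "A \<in> null_sets M" by (auto simp: emeasure_eq_measure intro!: null_setsI)
    have "AE x in M. indicator A x / emeasure M A = ennreal 0"
      using AE_not_in[OF null] by eventually_elim auto
    then have "uniform_measure M A = density M (\<lambda>_. ennreal 0)"
      unfolding uniform_measure_def by (intro density_cong) auto
    then have "(\<integral>x. h x \<partial>uniform_measure M A) = (\<integral>x. h x \<partial>density M (\<lambda>_. ennreal 0))" by simp
    also have "\<dots> = 0" by (subst integral_density) auto
    finally show ?thesis using True by simp
  next
    case False
    then have pos: "0 < measure M A" using measure_nonneg[of M A] by linarith
    have "uniform_measure M A = density M (\<lambda>x. ennreal (indicator A x / measure M A))"
      unfolding uniform_measure_def
      by (intro arg_cong[where f = "density M"] ext)
         (use pos in \<open>simp add: emeasure_eq_measure divide_ennreal[symmetric] ennreal_indicator\<close>)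
    then have "(\<integral>x. h x \<partial>uniform_measure M A)
        = (\<integral>x. h x \<partial>density M (\<lambda>x. ennreal (indicator A x / measure M A)))" by simp
    also have "\<dots> = (\<integral>x. (indicator A x / measure M A) *\<^sub>R h x \<partial>M)"
      by (subst integral_density) (use pos in auto)
    also have "\<dots> = (\<integral>x. indicator A x * h x / measure M A \<partial>M)"
      by (intro Bochner_Integration.integral_cong) auto
    finally show ?thesis by simp
  qed
qed

locale tree_sample = iid P D n "\<lambda>i \<omega>. (X i \<omega>, Y i \<omega>)"
  for P :: "'a measure" and D :: "((nat \<Rightarrow> real) \<times> real) measure" and n :: nat
    and X :: "nat \<Rightarrow> 'a \<Rightarrow> nat \<Rightarrow> real" and Y :: "nat \<Rightarrow> 'a \<Rightarrow> real" +
  fixes d :: nat and M \<zeta> :: real and f :: "(nat \<Rightarrow> real) \<Rightarrow> real"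
  assumes M_pos: "0 < M" and \<zeta>_ge_1: "1 \<le> \<zeta>"
    and sets_D: "sets D = sets (example_space d M)"
    and density: "\<And>i. i < n \<Longrightarrow> distributed P (cube_lebesgue d) (X i) (\<lambda>x. ennreal (f x))"
    and density_bounds: "\<And>x. x \<in> cube d \<Longrightarrow> 1 / \<zeta> \<le> f x \<and> f x \<le> \<zeta>"
begin

definition event :: "(nat \<Rightarrow> real) set \<Rightarrow> ((nat \<Rightarrow> real) \<times> real) set" where
  "event A = {z \<in> space D. fst z \<in> A}"

abbreviation \<mu> :: "(nat \<Rightarrow> real) set \<Rightarrow> real" where
  "\<mu> A \<equiv> measure D (event A)"

text \<open>
  The conditional expectation of the label given that the features lie in \<open>A\<close>.
\<close>

definition cell_mean :: "(nat \<Rightarrow> real) set \<Rightarrow> real" where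
  "cell_mean A = (\<integral>z. indicator (event A) z * snd z \<partial>D) / \<mu> A"

lemma space_D: "space D = cube d \<times> {- M..M}"
  using sets_eq_imp_space_eq[OF sets_D]
  by (simp add: example_space_def space_pair_measure space_cube_lebesgue space_restrict_space)

lemma measurable_fst_D [measurable]: "fst \<in> measurable D (cube_lebesgue d)"
  unfolding measurable_cong_sets[OF sets_D refl] example_space_def by (rule measurable_fst)

lemma measurable_snd_D [measurable]: "snd \<in> borel_measurable D"
proof -
  have "snd \<in> measurable D (restrict_space borel {- M..M})"
    unfolding measurable_cong_sets[OF sets_D refl] example_space_def by (rule measurable_snd)
  then show ?thesis by (auto simp: measurable_restrict_space2_iff)
qed

lemma measurable_X [measurable]: "i < n \<Longrightarrow> X i \<in> measurable P (cube_lebesgue d)"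
  using measurable_compose[OF measurable_Z measurable_fst_D] by simp

lemma measurable_Y [measurable]: "i < n \<Longrightarrow> Y i \<in> borel_measurable P"
  using measurable_compose[OF measurable_Z measurable_snd_D] by simp

lemma sets_event [measurable]:
  assumes [measurable]: "A \<in> sets (cube_lebesgue d)"
  shows "event A \<in> sets D"
  unfolding event_def by measurable

lemma abs_snd_le: "z \<in> space D \<Longrightarrow> \<bar>snd z\<bar> \<le> M"
  by (auto simp: space_D)

lemma
  assumes "\<omega> \<in> space P" "i < n"
  shows abs_Y_le: "\<bar>Y i \<omega>\<bar> \<le> M"
    and sample_in_event: "(X i \<omega>, Y i \<omega>) \<in> event A \<longleftrightarrow> X i \<omega> \<in> A"
proof -
  have "(X i \<omega>, Y i \<omega>) \<in> space D" using measurable_space[OF measurable_Z[OF assms(2)] assms(1)] .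
  then show "\<bar>Y i \<omega>\<bar> \<le> M" "(X i \<omega>, Y i \<omega>) \<in> event A \<longleftrightarrow> X i \<omega> \<in> A"
    by (auto simp: space_D event_def)
qed

text \<open>
  These bounds are the only use of the density: volumes, which multiply over coordinates, may
  replace probabilities up to the factor \<open>\<zeta>\<close>.
\<close>

lemma
  assumes A [measurable]: "A \<in> sets (cube_lebesgue d)"
  shows \<mu>_le_vol: "\<mu> A \<le> \<zeta> * vol d A" and vol_le_\<mu>: "vol d A \<le> \<zeta> * \<mu> A"
proof -
  interpret cube: prob_space "cube_lebesgue d" by (rule prob_space_cube_lebesgue)
  have n0: "0 < n" using sample_nonempty by simp
  have "emeasure D (event A) = emeasure (distr P D (\<lambda>\<omega>. (X 0 \<omega>, Y 0 \<omega>))) (event A)"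
    using distr_Z[OF n0] by simp
  also have "\<dots> = emeasure P (X 0 -` A \<inter> space P)"
    by (subst emeasure_distr) (use n0 in \<open>auto intro!: arg_cong[where f = "emeasure P"] simp: sample_in_event\<close>)
  also have "\<dots> = (\<integral>\<^sup>+x. ennreal (f x) * indicator A x \<partial>cube_lebesgue d)"
    by (rule distributed_emeasure[OF density[OF n0] A])
  finally have eq: "emeasure D (event A) = (\<integral>\<^sup>+x. ennreal (f x) * indicator A x \<partial>cube_lebesgue d)" .
  have "emeasure D (event A) \<le> (\<integral>\<^sup>+x. ennreal \<zeta> * indicator A x \<partial>cube_lebesgue d)"
    unfolding eq using density_bounds
    by (intro nn_integral_mono mult_right_mono ennreal_leI) (auto simp: space_cube_lebesgue)
  also have "\<dots> = ennreal (\<zeta> * vol d A)"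
    using \<zeta>_ge_1 by (simp add: nn_integral_cmult cube.emeasure_eq_measure ennreal_mult)
  finally show "\<mu> A \<le> \<zeta> * vol d A"
    using \<zeta>_ge_1 by (simp add: D.emeasure_eq_measure)
  have "ennreal (1 / \<zeta> * vol d A) = (\<integral>\<^sup>+x. ennreal (1 / \<zeta>) * indicator A x \<partial>cube_lebesgue d)"
    using \<zeta>_ge_1
    by (simp add: nn_integral_cmult cube.emeasure_eq_measure ennreal_mult[symmetric])
  also have "\<dots> \<le> emeasure D (event A)"
    unfolding eq using density_bounds
    by (intro nn_integral_mono mult_right_mono ennreal_leI) (auto simp: space_cube_lebesgue)
  finally have "1 / \<zeta> * vol d A \<le> \<mu> A" by (simp add: D.emeasure_eq_measure)
  then show "vol d A \<le> \<zeta> * \<mu> A" using \<zeta>_ge_1 by (simp add: field_simps)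
qed

lemma \<mu>_mono:
  assumes "A \<subseteq> B" "B \<in> sets (cube_lebesgue d)"
  shows "\<mu> A \<le> \<mu> B"
  using assms by (intro D.finite_measure_mono sets_event) (auto simp: event_def)

lemma \<mu>_Diff:
  assumes "A \<subseteq> B" "A \<in> sets (cube_lebesgue d)" "B \<in> sets (cube_lebesgue d)"
  shows "\<mu> (B - A) = \<mu> B - \<mu> A"
proof -
  have "event (B - A) = event B - event A" by (auto simp: event_def)
  then show ?thesis using assms by (simp add: D.finite_measure_Diff sets_event event_def subset_eq)
qed

lemma optimal_eq_cell_mean:
  assumes "A \<in> sets (cube_lebesgue d)"
  shows "(\<integral>z. snd z \<partial>uniform_measure D {z \<in> space D. fst z \<in> A}) = cell_mean A"
  unfolding cell_mean_def event_def[symmetric]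
  by (rule integral_uniform_measure) (use assms D.finite_measure_axioms in \<open>auto intro: sets_event\<close>)

lemma integrable_cell [simp]:
  assumes [measurable]: "A \<in> sets (cube_lebesgue d)"
  shows "integrable D (\<lambda>z. indicator (event A) z * snd z)"
  by (rule D.integrable_const_bound[where B = M])
     (use abs_snd_le M_pos in \<open>auto simp: indicator_def\<close>)

lemma abs_cell_integral_le:
  assumes [measurable]: "A \<in> sets (cube_lebesgue d)"
  shows "\<bar>\<integral>z. indicator (event A) z * snd z \<partial>D\<bar> \<le> M * \<mu> A"
proof -
  have int: "integrable D (\<lambda>z. indicator (event A) z :: real)" by (simp add: D.emeasure_eq_measure)
  have "\<bar>\<integral>z. indicator (event A) z * snd z \<partial>D\<bar> \<le> (\<integral>z. \<bar>indicator (event A) z * snd z\<bar> \<partial>D)"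
    by (rule integral_abs_bound)
  also have "\<dots> \<le> (\<integral>z. M * indicator (event A) z \<partial>D)"
    by (rule integral_mono[OF integrable_abs[OF integrable_cell[OF assms]]])
       (use int abs_snd_le in \<open>auto simp: indicator_def\<close>)
  also have "\<dots> = M * \<mu> A" using int by simp
  finally show ?thesis .
qed

lemma abs_cell_mean_le:
  assumes "A \<in> sets (cube_lebesgue d)"
  shows "\<bar>cell_mean A\<bar> \<le> M"
proof (cases "\<mu> A = 0")
  case False
  then have "0 < \<mu> A" using measure_nonneg[of D "event A"] by linarith
  then show ?thesis using abs_cell_integral_le[OF assms] by (simp add: cell_mean_def field_simps)
qed (use M_pos in \<open>simp add: cell_mean_def\<close>)

text \<open>
  The label integrals over \<open>A\<close> and \<open>B\<close> differ by at most \<open>M\<close> times the probability of \<open>B - A\<close>;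
  normalising costs the same once more.
\<close>

lemma cell_mean_close:
  assumes "A \<subseteq> B" and A: "A \<in> sets (cube_lebesgue d)" and B: "B \<in> sets (cube_lebesgue d)"
    and pos: "0 < \<mu> A"
  shows "\<bar>cell_mean B - cell_mean A\<bar> * \<mu> B \<le> 2 * M * \<mu> (B - A)"
proof -
  have posB: "0 < \<mu> B" using \<mu>_mono[OF assms(1) B] pos by linarith
  have BA: "B - A \<in> sets (cube_lebesgue d)" using A B by auto
  have "(\<integral>z. indicator (event B) z * snd z \<partial>D)
      = (\<integral>z. indicator (event A) z * snd z + indicator (event (B - A)) z * snd z \<partial>D)"
    using assms(1) by (intro Bochner_Integration.integral_cong) (auto simp: indicator_def event_def)
  also have "\<dots> = cell_mean A * \<mu> A + (\<integral>z. indicator (event (B - A)) z * snd z \<partial>D)"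
    using A BA pos by (simp add: cell_mean_def)
  finally have "cell_mean B * \<mu> B = cell_mean A * \<mu> A + (\<integral>z. indicator (event (B - A)) z * snd z \<partial>D)"
    using posB by (simp add: cell_mean_def)
  moreover have "cell_mean A * \<mu> B = cell_mean A * \<mu> A + cell_mean A * \<mu> (B - A)"
    using \<mu>_Diff[OF assms(1) A B] by (simp add: distrib_left[symmetric])
  ultimately have "(cell_mean B - cell_mean A) * \<mu> B
      = (\<integral>z. indicator (event (B - A)) z * snd z \<partial>D) - cell_mean A * \<mu> (B - A)"
    by (simp add: left_diff_distrib)
  moreover have "\<bar>cell_mean A * \<mu> (B - A)\<bar> \<le> M * \<mu> (B - A)"
    using abs_cell_mean_le[OF A] by (simp add: abs_mult mult_right_mono)
  ultimately have "\<bar>(cell_mean B - cell_mean A) * \<mu> B\<bar> \<le> 2 * M * \<mu> (B - A)"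
    using abs_cell_integral_le[OF BA] by linarith
  then show ?thesis using posB by (simp add: abs_mult)
qed

definition count :: "(nat \<Rightarrow> real) set \<Rightarrow> 'a \<Rightarrow> real" where
  "count A \<omega> = (\<Sum>i<n. indicator A (X i \<omega>))"

lemma count_eq_card: "count A \<omega> = real (card (points_in n (\<lambda>i. X i \<omega>) A))"
  by (simp add: count_def points_in_def indicator_def Int_def sum.If_cases lessThan_def
      flip: sum.inter_filter)

lemma sum_points_in: "(\<Sum>i\<in>points_in n (\<lambda>i. X i \<omega>) A. g i) = (\<Sum>i<n. indicator A (X i \<omega>) * g i)"
  for g :: "nat \<Rightarrow> real"
proof -
  have "(\<Sum>i<n. indicator A (X i \<omega>) * g i) = (\<Sum>i<n. if X i \<omega> \<in> A then g i else 0)"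
    by (intro sum.cong) (auto simp: indicator_def)
  also have "\<dots> = (\<Sum>i\<in>{i \<in> {..<n}. X i \<omega> \<in> A}. g i)" by (rule sum.inter_filter[symmetric]) simp
  finally show ?thesis by (simp add: points_in_def)
qed

text \<open>
  What a pair of outer and inner box must satisfy for the transfer to a leaf between them.  The
  first part is demanded only when the outer box is expected to contain many points, as the
  exponential inequalities give nothing otherwise; the upper bound on the count is needed for all
  outer boxes because it excludes leaves of too small volume.
\<close>

definition good_pair :: "real \<Rightarrow> 'a \<Rightarrow> (nat \<Rightarrow> real) set \<Rightarrow> (nat \<Rightarrow> real) set \<Rightarrow> bool" where
  "good_pair U \<omega> Ro Ri \<longleftrightarrow>
     (64 * U \<le> real n * \<mu> Ro \<longrightarrow>
        \<bar>\<Sum>i<n. indicator Ro (X i \<omega>) * (Y i \<omega> - cell_mean Ro)\<bar> < 4 * M * sqrt (U * (real n * \<mu> Ro)) \<and>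
        real n * \<mu> Ro / 2 < count Ro \<omega>) \<and>
     count Ro \<omega> < 2 * (real n * \<mu> Ro) + 4 * U \<and>
     count (Ro - Ri) \<omega> < 2 * (real n * \<mu> (Ro - Ri)) + 4 * U"

lemma measurable_count [measurable]:
  assumes [measurable]: "A \<in> sets (cube_lebesgue d)"
  shows "count A \<in> borel_measurable P"
proof -
  have "(\<lambda>\<omega>. \<Sum>i<n. indicator A (X i \<omega>) :: real) \<in> borel_measurable P"
    by (intro borel_measurable_sum) (use assms in \<open>auto intro!: measurable_compose[OF measurable_X]\<close>)
  then show ?thesis by (simp add: count_def[abs_def])
qed

lemma measurable_restricted_sum [measurable]:
  assumes [measurable]: "A \<in> sets (cube_lebesgue d)"
  shows "(\<lambda>\<omega>. \<Sum>i<n. indicator A (X i \<omega>) * (Y i \<omega> - c)) \<in> borel_measurable P"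
proof (intro borel_measurable_sum)
  fix i assume "i \<in> {..<n}"
  then have [measurable]: "X i \<in> measurable P (cube_lebesgue d)" "Y i \<in> borel_measurable P" by auto
  show "(\<lambda>\<omega>. indicator A (X i \<omega>) * (Y i \<omega> - c)) \<in> borel_measurable P" by measurable
qed

lemma
  assumes U: "0 < U" and Ro: "Ro \<in> sets (cube_lebesgue d)" and Ri: "Ri \<in> sets (cube_lebesgue d)"
  shows sets_good_pair: "{\<omega> \<in> space P. \<not> good_pair U \<omega> Ro Ri} \<in> sets P"
    and prob_good_pair: "measure P {\<omega> \<in> space P. \<not> good_pair U \<omega> Ro Ri} \<le> 5 * exp (- 4 * U)"
proof -
  note [measurable] = Ro Ri
  show meas: "{\<omega> \<in> space P. \<not> good_pair U \<omega> Ro Ri} \<in> sets P"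
    unfolding good_pair_def by measurable
  let ?N = "real n * \<mu> Ro"
  define E1 where "E1 = (if 64 * U \<le> ?N then {\<omega> \<in> space P. 4 * M * sqrt (U * ?N) \<le>
    \<bar>\<Sum>i<n. indicator Ro (X i \<omega>) * (Y i \<omega> - cell_mean Ro)\<bar>} else {})"
  define E2 where "E2 = (if 64 * U \<le> ?N then {\<omega> \<in> space P. count Ro \<omega> \<le> ?N / 2} else {})"
  define E3 where "E3 A = {\<omega> \<in> space P. 2 * (real n * \<mu> A) + 4 * U \<le> count A \<omega>}" for A
  have count_event: "(\<Sum>i<n. indicator (event A) (X i \<omega>, Y i \<omega>)) = count A \<omega>" if "\<omega> \<in> space P" for A \<omega>
    using that by (auto simp: count_def indicator_def sample_in_event intro!: sum.cong)
  have sum_event: "(\<Sum>i<n. indicator (event Ro) (X i \<omega>, Y i \<omega>) * (Y i \<omega> - c))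
      = (\<Sum>i<n. indicator Ro (X i \<omega>) * (Y i \<omega> - c))" if "\<omega> \<in> space P" for \<omega> c
    using that by (auto simp: indicator_def sample_in_event intro!: sum.cong)
  have "{\<omega> \<in> space P. 4 * M * sqrt (U * ?N) \<le>
      \<bar>\<Sum>i<n. indicator Ro (X i \<omega>) * (Y i \<omega> - cell_mean Ro)\<bar>} \<in> sets P" by measurable
  then have "E1 \<in> sets P"
    by (cases "64 * U \<le> ?N") (simp_all only: E1_def if_True if_False sets.empty_sets)
  moreover have "{\<omega> \<in> space P. count Ro \<omega> \<le> ?N / 2} \<in> sets P" by measurable
  then have "E2 \<in> sets P"
    by (cases "64 * U \<le> ?N") (simp_all only: E2_def if_True if_False sets.empty_sets)
  moreover have "E3 Ro \<in> sets P" unfolding E3_def by measurable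
  moreover have "E3 (Ro - Ri) \<in> sets P" unfolding E3_def by measurable
  ultimately have meas': "E1 \<in> sets P" "E2 \<in> sets P" "E3 Ro \<in> sets P" "E3 (Ro - Ri) \<in> sets P"
    by auto
  have E1: "measure P E1 \<le> 2 * exp (- 4 * U)"
  proof (cases "64 * U \<le> ?N")
    case True
    have "measure P {\<omega> \<in> space P. 4 * M * sqrt (U * ?N) \<le>
        \<bar>\<Sum>i<n. indicator (event Ro) (X i \<omega>, Y i \<omega>) * (snd (X i \<omega>, Y i \<omega>) - cell_mean Ro)\<bar>}
        \<le> 2 * exp (- 4 * U)"
      unfolding cell_mean_def
      by (rule restricted_sum_tail) (use True U M_pos abs_snd_le in auto)
    moreover have "E1 = {\<omega> \<in> space P. 4 * M * sqrt (U * ?N) \<le>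
        \<bar>\<Sum>i<n. indicator (event Ro) (X i \<omega>, Y i \<omega>) * (snd (X i \<omega>, Y i \<omega>) - cell_mean Ro)\<bar>}"
      unfolding E1_def if_P[OF True]
      by (intro Collect_cong conj_cong refl) (simp only: sum_event snd_conv)
    ultimately show ?thesis by simp
  qed (simp add: E1_def)
  have E2: "measure P E2 \<le> exp (- 4 * U)"
  proof (cases "64 * U \<le> ?N")
    case True
    have "E2 = {\<omega> \<in> space P. (\<Sum>i<n. indicator (event Ro) (X i \<omega>, Y i \<omega>)) \<le> ?N / 2}"
      using True by (auto simp: E2_def count_event)
    then have "measure P E2 \<le> exp (- (?N / 16))" using count_lower_tail[of "event Ro"] by simp
    also have "\<dots> \<le> exp (- 4 * U)" using True by simp
    finally show ?thesis .
  qed (simp add: E2_def)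
  have E3: "measure P (E3 A) \<le> exp (- 4 * U)" if [measurable]: "A \<in> sets (cube_lebesgue d)" for A
  proof -
    have "E3 A = {\<omega> \<in> space P. 2 * (real n * \<mu> A) + 4 * U \<le> (\<Sum>i<n. indicator (event A) (X i \<omega>, Y i \<omega>))}"
      by (auto simp: E3_def count_event)
    then show ?thesis using count_upper_tail[of "event A" "4 * U"] by simp
  qed
  have "{\<omega> \<in> space P. \<not> good_pair U \<omega> Ro Ri} \<subseteq> ((E1 \<union> E2) \<union> E3 Ro) \<union> E3 (Ro - Ri)"
    by (auto simp: good_pair_def E1_def E2_def E3_def not_less)
  then have "measure P {\<omega> \<in> space P. \<not> good_pair U \<omega> Ro Ri}
      \<le> measure P (((E1 \<union> E2) \<union> E3 Ro) \<union> E3 (Ro - Ri))"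
    using meas' by (intro P.finite_measure_mono) auto
  also have "\<dots> \<le> ((measure P E1 + measure P E2) + measure P (E3 Ro)) + measure P (E3 (Ro - Ri))"
    using meas' by (intro order_trans[OF measure_Un_le] add_mono order_refl sets.Un)
  also have "\<dots> \<le> 5 * exp (- 4 * U)" using E1 E2 E3[OF Ro] E3[of "Ro - Ri"] Ro Ri by auto
  finally show "measure P {\<omega> \<in> space P. \<not> good_pair U \<omega> Ro Ri} \<le> 5 * exp (- 4 * U)" .
qed

lemma prob_all_good_pairs:
  assumes U: "0 < U" and fin: "finite \<N>" and pairs: "\<And>Ro Ri. (Ro, Ri) \<in> \<N> \<Longrightarrow>
      Ro \<in> sets (cube_lebesgue d) \<and> Ri \<in> sets (cube_lebesgue d)"
  shows "1 - real (card \<N>) * (5 * exp (- 4 * U))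
      \<le> measure P {\<omega> \<in> space P. \<forall>(Ro, Ri)\<in>\<N>. good_pair U \<omega> Ro Ri}" (is "_ \<le> measure P ?G")
proof -
  define bad where "bad = (\<lambda>(Ro, Ri). {\<omega> \<in> space P. \<not> good_pair U \<omega> Ro Ri})"
  have bad: "bad p \<in> sets P" "measure P (bad p) \<le> 5 * exp (- 4 * U)" if "p \<in> \<N>" for p
    using that pairs U sets_good_pair prob_good_pair by (auto simp: bad_def split: prod.splits)
  have G: "?G = space P - (\<Union>p\<in>\<N>. bad p)" by (auto simp: bad_def)
  have meas: "(\<Union>p\<in>\<N>. bad p) \<in> sets P" using fin bad by (intro sets.finite_UN) auto
  have "measure P (\<Union>p\<in>\<N>. bad p) \<le> (\<Sum>p\<in>\<N>. measure P (bad p))"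
    using fin bad by (intro P.finite_measure_subadditive_finite) auto
  also have "\<dots> \<le> real (card \<N>) * (5 * exp (- 4 * U))"
    by (rule sum_bounded_above) (rule bad)
  finally show "1 - real (card \<N>) * (5 * exp (- 4 * U)) \<le> measure P ?G"
    unfolding G using meas by (simp add: P.prob_compl)
qed

end

section \<open>From the net to the leaves\<close>

lemma valid_split_path_thresholds:
  "valid_split_path d \<alpha> k n X c \<Longrightarrow> (j, \<tau>, low) \<in> set c \<Longrightarrow> j < d \<and> 0 \<le> \<tau> \<and> \<tau> \<le> 1"
proof (induction c)
  case (Cons a c)
  then show ?case by (cases a) auto
qed simp

lemma sets_node:
  assumes "\<And>j \<tau> low. (j, \<tau>, low) \<in> set c \<Longrightarrow> j < d"
  shows "node d c \<in> sets (cube_lebesgue d)"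
  using assms
proof (induction c)
  case Nil
  then show ?case using sets.top[of "cube_lebesgue d"] by (simp add: space_cube_lebesgue)
next
  case (Cons a c)
  obtain j \<tau> low where a: "a = (j, \<tau>, low)" by (cases a)
  have c [measurable]: "node d c \<in> sets (cube_lebesgue d)" using Cons by auto
  have j: "j < d" using Cons.prems[of j \<tau> low] a by simp
  note [measurable] = measurable_coordinate[OF j]
  have "{x \<in> space (cube_lebesgue d). x \<in> node d c \<and> (x j \<le> \<tau>) = low} \<in> sets (cube_lebesgue d)"
    by measurable
  moreover have "{x \<in> space (cube_lebesgue d). x \<in> node d c \<and> (x j \<le> \<tau>) = low} = node d (a # c)"
    by (auto simp: a node_Cons space_cube_lebesgue node_def)
  ultimately show ?case by simp
qed

text \<open>
  The three summands are the fluctuation of the label sum over the outer box, the labels in the gap,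
  and the shift of the conditional mean.  With \<open>r = sqrt (U / k)\<close> they are at most \<open>8 M r K\<close> for the
  first, and \<open>M r K\<close> times \<open>18 / 36 + 8 / 22\<close> for the two others: \<open>U \<ge> 36\<^sup>2\<close> gives \<open>\<delta> \<le> r / 36\<close>, and
  \<open>k \<ge> 512 U\<close> gives \<open>r \<le> 1 / 22\<close>.
\<close>

lemma deviation_budget:
  fixes U k K N M \<delta> :: real
  assumes M: "0 < M" and U: "1296 \<le> U" and k: "0 < k" "512 * U \<le> k" and K: "k \<le> K"
    and N: "0 \<le> N" "N \<le> 4 * K" and \<delta>: "\<delta> = 1 / sqrt k"
  shows "4 * M * sqrt (U * N) + 2 * M * (2 * \<delta> * N + 4 * U) + 2 * M * \<delta> * K
    \<le> 9 * M * sqrt (U / k) * K"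
proof -
  define r where "r = sqrt (U / k)"
  have r0: "0 \<le> r" using U k by (simp add: r_def)
  have U_eq: "U = r\<^sup>2 * k" using U k by (simp add: r_def)
  have "36 \<le> sqrt U" using U real_sqrt_le_mono[of "36\<^sup>2" U] by simp
  then have "36 * \<delta> \<le> r"
    using k unfolding r_def \<delta> real_sqrt_divide by (simp add: divide_right_mono)
  then have rate: "\<delta> * K \<le> r * K / 36" using K k by (simp add: mult_right_mono)
  have "r \<le> 1 / 22"
  proof -
    have "U / k \<le> (1 / 22)\<^sup>2" using k U by (simp add: field_simps power2_eq_square)
    then show ?thesis unfolding r_def by (intro real_le_lsqrt) auto
  qed
  then have "r * (r * k) \<le> (1 / 22) * (r * K)"
    using r0 K k by (intro mult_mono mult_left_mono) auto
  then have U_le: "U \<le> r * K / 22" by (simp add: U_eq power2_eq_square mult_ac)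
  have "U * N \<le> (r\<^sup>2 * K) * (4 * K)"
    using N K k U by (intro mult_mono) (auto simp: U_eq intro: mult_left_mono)
  also have "\<dots> = (2 * (r * K))\<^sup>2" by (simp add: power2_eq_square)
  finally have "sqrt (U * N) \<le> 2 * (r * K)"
    using r0 K k by (intro real_le_lsqrt) auto
  moreover have "\<delta> * N \<le> 4 * (\<delta> * K)"
    using mult_left_mono[OF N(2), of \<delta>] k by (simp add: \<delta>)
  moreover have "0 \<le> r * K" using r0 K k by simp
  moreover have "4 * a + (4 * b + 8 * e) + 2 * c \<le> 9 * x"
    if "a \<le> 2 * x" "b \<le> 4 * c" "0 \<le> x" "c \<le> x / 36" "e \<le> x / 22" for a b c e x :: real
    using that by linarith
  ultimately have "4 * sqrt (U * N) + (4 * (\<delta> * N) + 8 * U) + 2 * (\<delta> * K) \<le> 9 * (r * K)"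
    using rate U_le by blast
  from mult_left_mono[OF this, of M] M show ?thesis by (simp add: r_def algebra_simps)
qed

context tree_sample
begin

text \<open>
  The label sum over the leaf is the label sum over the outer box minus the labels in the gap,
  after centring at the conditional mean of the outer box.  The randomness enters only through the
  pair of boxes, so the leaf may depend on the sample.
\<close>

lemma good_pair_deviation:
  assumes \<omega>: "\<omega> \<in> space P" and good: "good_pair U \<omega> Ro Ri"
    and sets: "Ro \<in> sets (cube_lebesgue d)" "\<nu> \<in> sets (cube_lebesgue d)" "Ri \<in> sets (cube_lebesgue d)"
    and sandwich: "Ri \<subseteq> \<nu>" "\<nu> \<subseteq> Ro"
    and k: "1 \<le> k" "k \<le> card (points_in n (\<lambda>i. X i \<omega>) \<nu>)"
    and U: "1296 \<le> U" "512 * U \<le> real k"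
    and mass: "64 * U \<le> real n * \<mu> Ro" and gap: "\<mu> (Ro - Ri) \<le> 1 / sqrt (real k) * \<mu> Ro"
  shows "node_deviation n D (\<lambda>i. X i \<omega>) (\<lambda>i. Y i \<omega>) \<nu> \<le> 9 * M * sqrt (U / real k)"
proof -
  define \<delta> where "\<delta> = 1 / sqrt (real k)"
  define N where "N = real n * \<mu> Ro"
  define K where "K = count \<nu> \<omega>"
  define m where "m = cell_mean Ro"
  have kK: "real k \<le> K" using k by (simp add: K_def count_eq_card)
  have K0: "0 < K" using kK k by linarith
  have \<delta>: "0 \<le> \<delta>" "\<delta> \<le> 1 / 32"
  proof -
    have "32 \<le> sqrt (real k)" using U real_sqrt_le_mono[of "32\<^sup>2" "real k"] by simp
    then show "0 \<le> \<delta>" "\<delta> \<le> 1 / 32"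
      unfolding \<delta>_def using frac_le[of 1 1 32 "sqrt (real k)"] by auto
  qed
  have N: "64 * U \<le> N" "0 < N" using mass U by (auto simp: N_def)
  have \<mu>Ro: "0 < \<mu> Ro" using N by (auto simp: N_def zero_less_mult_iff)
  have concentration: "\<bar>\<Sum>i<n. indicator Ro (X i \<omega>) * (Y i \<omega> - m)\<bar> < 4 * M * sqrt (U * N)"
    and lower: "N / 2 < count Ro \<omega>"
    and diff: "count (Ro - Ri) \<omega> < 2 * (real n * \<mu> (Ro - Ri)) + 4 * U"
    using good mass by (auto simp: good_pair_def N_def m_def)
  have "real n * \<mu> (Ro - Ri) \<le> real n * (\<delta> * \<mu> Ro)" using gap by (intro mult_left_mono) (auto simp: \<delta>_def)
  then have diff': "count (Ro - Ri) \<omega> \<le> 2 * \<delta> * N + 4 * U" using diff by (simp add: N_def mult_ac)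
  have count_Un: "count B \<omega> \<le> count A \<omega> + count (B - A) \<omega>" for A B
    unfolding count_def sum.distrib[symmetric] by (intro sum_mono) (auto simp: indicator_def)
  have count_mono: "count A \<omega> \<le> count B \<omega>" if "A \<subseteq> B" for A B
    unfolding count_def using that by (intro sum_mono) (auto simp: indicator_def)
  have NK: "N \<le> 4 * K"
  proof -
    have "count Ro \<omega> \<le> K + count (Ro - Ri) \<omega>"
      using count_Un[of Ro Ri] count_mono[OF sandwich(1)] by (simp add: K_def)
    moreover have "2 * \<delta> * N \<le> N / 16" using \<delta> N mult_right_mono[of \<delta> "1 / 32" N] by simp
    ultimately show ?thesis using lower diff' N by linarith
  qed
  have outside: "\<bar>\<Sum>i<n. indicator (Ro - \<nu>) (X i \<omega>) * (Y i \<omega> - m)\<bar> \<le> 2 * M * (2 * \<delta> * N + 4 * U)"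
  proof -
    have "\<bar>\<Sum>i<n. indicator (Ro - \<nu>) (X i \<omega>) * (Y i \<omega> - m)\<bar>
        \<le> (\<Sum>i<n. \<bar>indicator (Ro - \<nu>) (X i \<omega>) * (Y i \<omega> - m)\<bar>)" by (rule sum_abs)
    also have "\<dots> \<le> (\<Sum>i<n. 2 * M * indicator (Ro - Ri) (X i \<omega>))"
    proof (rule sum_mono)
      fix i assume "i \<in> {..<n}"
      then have "\<bar>Y i \<omega> - m\<bar> \<le> 2 * M"
        using abs_Y_le[OF \<omega>, of i] abs_cell_mean_le[OF sets(1)] by (auto simp: m_def)
      then show "\<bar>indicator (Ro - \<nu>) (X i \<omega>) * (Y i \<omega> - m)\<bar> \<le> 2 * M * indicator (Ro - Ri) (X i \<omega>)"
        using sandwich M_pos by (auto simp: indicator_def)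
    qed
    also have "\<dots> = 2 * M * count (Ro - Ri) \<omega>" by (simp add: count_def sum_distrib_left)
    also have "\<dots> \<le> 2 * M * (2 * \<delta> * N + 4 * U)" using diff' M_pos by (intro mult_left_mono) auto
    finally show ?thesis .
  qed
  have gap\<nu>: "\<mu> (Ro - \<nu>) \<le> \<delta> * \<mu> Ro"
  proof -
    have "Ro - \<nu> \<subseteq> Ro - Ri" using sandwich by blast
    then have "\<mu> (Ro - \<nu>) \<le> \<mu> (Ro - Ri)" using sets by (intro \<mu>_mono) auto
    then show ?thesis using gap by (simp add: \<delta>_def)
  qed
  have mean: "\<bar>m - cell_mean \<nu>\<bar> \<le> 2 * M * \<delta>"
  proof -
    have "\<mu> \<nu> = \<mu> Ro - \<mu> (Ro - \<nu>)" using \<mu>_Diff[OF sandwich(2) sets(2,1)] by simp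
    also have "\<dots> \<ge> (1 - \<delta>) * \<mu> Ro" using gap\<nu> by (simp add: algebra_simps)
    finally have "0 < \<mu> \<nu>" using \<delta> \<mu>Ro mult_pos_pos[of "1 - \<delta>" "\<mu> Ro"] by linarith
    from cell_mean_close[OF sandwich(2) sets(2,1) this]
    have "\<bar>m - cell_mean \<nu>\<bar> * \<mu> Ro \<le> 2 * M * \<mu> (Ro - \<nu>)" by (simp add: m_def)
    also have "\<dots> \<le> 2 * M * (\<delta> * \<mu> Ro)" using gap\<nu> M_pos by (intro mult_left_mono) auto
    finally have "\<bar>m - cell_mean \<nu>\<bar> * \<mu> Ro \<le> (2 * M * \<delta>) * \<mu> Ro" by simp
    then show ?thesis using \<mu>Ro by simp
  qed
  have "(\<Sum>i<n. indicator \<nu> (X i \<omega>) * Y i \<omega>) - cell_mean \<nu> * K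
      = (\<Sum>i<n. indicator Ro (X i \<omega>) * (Y i \<omega> - m)) - (\<Sum>i<n. indicator (Ro - \<nu>) (X i \<omega>) * (Y i \<omega> - m))
        + (m - cell_mean \<nu>) * K"
  proof -
    have "(\<Sum>i<n. indicator Ro (X i \<omega>) * (Y i \<omega> - m)) - (\<Sum>i<n. indicator (Ro - \<nu>) (X i \<omega>) * (Y i \<omega> - m))
        = (\<Sum>i<n. indicator \<nu> (X i \<omega>) * Y i \<omega> - m * indicator \<nu> (X i \<omega>))"
      unfolding sum_subtractf[symmetric] using sandwich by (intro sum.cong) (auto simp: indicator_def)
    also have "\<dots> = (\<Sum>i<n. indicator \<nu> (X i \<omega>) * Y i \<omega>) - m * K"
      by (simp add: sum_subtractf K_def count_def sum_distrib_left)
    finally show ?thesis by (simp add: algebra_simps)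
  qed
  moreover have "\<bar>(m - cell_mean \<nu>) * K\<bar> \<le> 2 * M * \<delta> * K"
    using mean K0 by (simp add: abs_mult mult_right_mono)
  ultimately have "\<bar>(\<Sum>i<n. indicator \<nu> (X i \<omega>) * Y i \<omega>) - cell_mean \<nu> * K\<bar>
      \<le> 4 * M * sqrt (U * N) + 2 * M * (2 * \<delta> * N + 4 * U) + 2 * M * \<delta> * K"
    using concentration outside by linarith
  also have "\<dots> \<le> 9 * M * sqrt (U / real k) * K"
    by (rule deviation_budget) (use M_pos U k kK N NK in \<open>auto simp: \<delta>_def\<close>)
  finally have *: "\<bar>(\<Sum>i<n. indicator \<nu> (X i \<omega>) * Y i \<omega>) - cell_mean \<nu> * K\<bar> \<le> 9 * M * sqrt (U / real k) * K" .
  have "node_deviation n D (\<lambda>i. X i \<omega>) (\<lambda>i. Y i \<omega>) \<nu> = \<bar>(\<Sum>i<n. indicator \<nu> (X i \<omega>) * Y i \<omega>) / K - cell_mean \<nu>\<bar>"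
    by (simp only: node_deviation_def optimal_eq_cell_mean[OF sets(2)] sum_points_in K_def count_eq_card)
  also have "\<dots> = \<bar>(\<Sum>i<n. indicator \<nu> (X i \<omega>) * Y i \<omega>) - cell_mean \<nu> * K\<bar> / K"
  proof -
    have "A / K - c = (A - c * K) / K" for A c using K0 by (simp add: field_simps)
    then show ?thesis using K0 by simp
  qed
  also have "\<dots> \<le> 9 * M * sqrt (U / real k)" using * K0 by (simp add: pos_divide_le_eq)
  finally show ?thesis .
qed

text \<open>
  If the closed box around the leaf has volume at least \<open>1 / W\<close>, the net approximates it and
  \<open>good_pair_deviation\<close> applies.  Otherwise the box, enlarged to volume \<open>1 / W\<close>, lies in an outer
  box of volume at most \<open>2 / W\<close>, hence of probability at most \<open>k / (4 n)\<close>, and the upper bound on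
  its count leaves room for fewer than \<open>k\<close> points.
\<close>

lemma good_net_deviation:
  assumes \<omega>: "\<omega> \<in> space P"
    and good: "\<And>Ro Ri. (Ro, Ri) \<in> box_net d s q (8 * \<zeta> * real n / real k) \<Longrightarrow> good_pair U \<omega> Ro Ri"
    and \<alpha>: "0 \<le> \<alpha>" "\<alpha> \<le> 1" and path: "valid_split_path d \<alpha> k n (\<lambda>i. X i \<omega>) c" and k: "1 \<le> k"
    and depth: "\<And>t. real k \<le> (1 - \<alpha>) ^ t * real n \<Longrightarrow> t \<le> s"
    and q: "4 \<le> q" "4 * \<zeta>\<^sup>2 * real s / real q \<le> 1 / sqrt (real k)"
    and U: "1296 \<le> U" "512 * \<zeta>\<^sup>2 * U \<le> real k"
  shows "node_deviation n D (\<lambda>i. X i \<omega>) (\<lambda>i. Y i \<omega>) (node d c) \<le> 9 * M * sqrt (U / real k)"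
proof -
  define W where "W = 8 * \<zeta> * real n / real k"
  define \<nu> where "\<nu> = node d c"
  define K where "K = card (points_in n (\<lambda>i. X i \<omega>) \<nu>)"
  have \<zeta>2: "1 \<le> \<zeta>\<^sup>2" "\<zeta> \<le> \<zeta>\<^sup>2" using \<zeta>_ge_1 by (auto simp: power2_eq_square mult_le_cancel_left1 intro: mult_ge1_I)
  have kK: "k \<le> K" unfolding K_def \<nu>_def by (rule valid_split_path_card[OF path])
  obtain S lo hi where S: "S \<subseteq> {..<d}" and lohi: "\<And>j. j \<in> S \<Longrightarrow> 0 \<le> lo j \<and> hi j \<le> 1"
    and inner: "open_box d S lo hi \<subseteq> \<nu>" and outer: "\<nu> \<subseteq> closed_box d S lo hi"
    and K_le: "real K \<le> (1 - \<alpha>) ^ card S * real n"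
    using node_is_box[OF \<alpha> path] unfolding \<nu>_def K_def by blast
  have finS: "finite S" using S finite_subset by auto
  have cardS: "card S \<le> s" using kK K_le by (intro depth) linarith
  have "(1 - \<alpha>) ^ card S * real n \<le> 1 * real n" using \<alpha> by (intro mult_right_mono power_le_one) auto
  then have kn: "real k \<le> real n" using kK K_le by linarith
  have W: "1 \<le> W" 
  proof -
    have "real k * 1 \<le> real n * (8 * \<zeta>)" using kn \<zeta>_ge_1 by (intro mult_mono) auto
    then show ?thesis using k by (simp add: W_def field_simps)
  qed
  have "points_in n (\<lambda>i. X i \<omega>) \<nu> \<noteq> {}" using kK k by (auto simp: K_def)
  then obtain x where "x \<in> \<nu>" by (auto simp: points_in_def)
  then have "x \<in> closed_box d S lo hi" using outer by auto
  then have lohi': "0 \<le> lo j \<and> lo j \<le> hi j \<and> hi j \<le> 1" if "j \<in> S" for j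
    using lohi[OF that] that by (force simp: closed_box_def)
  have \<nu>_sets: "\<nu> \<in> sets (cube_lebesgue d)"
    unfolding \<nu>_def by (rule sets_node) (use valid_split_path_thresholds[OF path] in blast)
  have k1: "1 \<le> sqrt (real k)" using k by simp
  have U': "512 * U \<le> real k"
  proof -
    have "512 * U \<le> 512 * \<zeta>\<^sup>2 * U" using mult_left_mono[OF \<zeta>2(1), of "512 * U"] U by (simp add: mult_ac)
    then show ?thesis using U by linarith
  qed
  have "32 \<le> sqrt (real k)" using U U' real_sqrt_le_mono[of "32\<^sup>2" "real k"] by simp
  then have \<delta>: "1 / sqrt (real k) \<le> 1 / 32"
    using frac_le[of 1 1 32 "sqrt (real k)"] by simp
  have "4 * real s / real q \<le> 4 * \<zeta>\<^sup>2 * real s / real q"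
    using mult_right_mono[OF \<zeta>2(1), of "4 * real s / real q"] by (simp add: mult_ac)
  then have half: "4 * real s / real q \<le> 1 / 2" using q \<delta> by linarith
  show ?thesis
  proof (cases "1 / W \<le> (\<Prod>j\<in>S. hi j - lo j)")
    case True
    have strict: "0 \<le> lo j \<and> lo j < hi j \<and> hi j \<le> 1" if "j \<in> S" for j
    proof -
      have "hi j - lo j \<noteq> 0"
      proof
        assume "hi j - lo j = 0"
        then have "(\<Prod>j\<in>S. hi j - lo j) = 0" using finS that by (intro prod_zero) auto
        then show False using True W by (auto simp: field_simps)
      qed
      then show ?thesis using lohi'[OF that] by auto
    qed
    obtain Ro Ri where net: "(Ro, Ri) \<in> box_net d s q W" and Ro: "closed_box d S lo hi \<subseteq> Ro"
      and Ri: "Ri \<subseteq> open_box d S lo hi"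
      and vols: "(1 - 4 * real s / real q) * vol d Ro \<le> vol d Ri"
      using box_net_approximates[OF S cardS q(1) W strict True] by blast
    note sets = box_net_sets[OF net]
    interpret cube: prob_space "cube_lebesgue d" by (rule prob_space_cube_lebesgue)
    have RiRo: "Ri \<subseteq> Ro" using Ri inner outer Ro by blast
    have vol_Ro: "1 / W \<le> vol d Ro"
    proof -
      have "1 / W \<le> vol d (closed_box d S lo hi)" using True by (simp add: vol_closed_box[OF S lohi'])
      also have "\<dots> \<le> vol d Ro" by (rule cube.finite_measure_mono[OF Ro sets(1)])
      finally show ?thesis .
    qed
    have mass: "64 * U \<le> real n * \<mu> Ro"
    proof -
      have "real k / (8 * \<zeta>) = real n * (1 / W)" using kn k \<zeta>_ge_1 by (simp add: W_def)
      also have "\<dots> \<le> real n * (\<zeta> * \<mu> Ro)"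
        using vol_Ro vol_le_\<mu>[OF sets(1)] by (intro mult_left_mono) auto
      finally have "real k \<le> 8 * \<zeta>\<^sup>2 * (real n * \<mu> Ro)"
        using \<zeta>_ge_1 by (simp add: field_simps power2_eq_square)
      then have "\<zeta>\<^sup>2 * (64 * U) \<le> \<zeta>\<^sup>2 * (real n * \<mu> Ro)" using U by simp
      moreover have "0 < \<zeta>\<^sup>2" using \<zeta>2 by linarith
      ultimately show ?thesis by (simp only: mult_le_cancel_left_pos)
    qed
    have gap: "\<mu> (Ro - Ri) \<le> 1 / sqrt (real k) * \<mu> Ro"
    proof -
      have "vol d (Ro - Ri) = vol d Ro - vol d Ri" using sets RiRo by (simp add: cube.finite_measure_Diff)
      also have "\<dots> \<le> 4 * real s / real q * vol d Ro" using vols by (simp add: algebra_simps)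
      finally have v: "vol d (Ro - Ri) \<le> 4 * real s / real q * vol d Ro" .
      have "\<mu> (Ro - Ri) \<le> \<zeta> * vol d (Ro - Ri)" using sets by (intro \<mu>_le_vol) auto
      also have "\<dots> \<le> \<zeta> * (4 * real s / real q * (\<zeta> * \<mu> Ro))"
        using \<zeta>_ge_1 vol_le_\<mu>[OF sets(1)]
        by (intro mult_left_mono order_trans[OF v]) auto
      also have "\<dots> = 4 * \<zeta>\<^sup>2 * real s / real q * \<mu> Ro" by (simp add: power2_eq_square)
      also have "\<dots> \<le> 1 / sqrt (real k) * \<mu> Ro" using q by (intro mult_right_mono) auto
      finally show ?thesis .
    qed
    show ?thesis unfolding \<nu>_def[symmetric]
      by (rule good_pair_deviation[OF \<omega> good[folded W_def, OF net] sets(1) \<nu>_sets sets(2) _ _ k _ U(1) U' mass gap])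
         (use Ri Ro inner outer kK in \<open>auto simp: K_def\<close>)
  next
    case False
    have small: "(\<Prod>j\<in>S. hi j - lo j) \<le> 1 / W" "1 / W \<le> 1" using W False by auto
    have "\<exists>lo' hi'. (\<forall>j\<in>S. 0 \<le> lo' j \<and> lo' j \<le> lo j \<and> hi j \<le> hi' j \<and> hi' j \<le> 1)
        \<and> (\<Prod>j\<in>S. hi' j - lo' j) = 1 / W"
      by (rule box_enlarge_to_volume[OF finS lohi' small])
    then obtain lo' hi' where enlarge: "\<And>j. j \<in> S \<Longrightarrow> 0 \<le> lo' j \<and> lo' j \<le> lo j \<and> hi j \<le> hi' j \<and> hi' j \<le> 1"
      and vol': "(\<Prod>j\<in>S. hi' j - lo' j) = 1 / W"
      by blast
    have strict: "0 \<le> lo' j \<and> lo' j < hi' j \<and> hi' j \<le> 1" if "j \<in> S" for j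
    proof -
      have "hi' j - lo' j \<noteq> 0"
      proof
        assume "hi' j - lo' j = 0"
        then have "(\<Prod>j\<in>S. hi' j - lo' j) = 0" using finS that by (intro prod_zero) auto
        then show False using vol' W by auto
      qed
      then show ?thesis using lohi'[OF that] enlarge[OF that] by linarith
    qed
    have volume: "1 / W \<le> (\<Prod>j\<in>S. hi' j - lo' j)" using vol' by simp
    \<comment> \<open>The enlarged box is approximated; its outer box still contains the leaf.\<close>
    obtain Ro Ri where net: "(Ro, Ri) \<in> box_net d s q W" and Ro: "closed_box d S lo' hi' \<subseteq> Ro"
      and Ri: "Ri \<subseteq> open_box d S lo' hi'"
      and vols: "(1 - 4 * real s / real q) * vol d Ro \<le> vol d Ri"
      using box_net_approximates[OF S cardS q(1) W strict volume] by blast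
    note sets = box_net_sets[OF net]
    interpret cube: prob_space "cube_lebesgue d" by (rule prob_space_cube_lebesgue)
    have "vol d Ri \<le> vol d (open_box d S lo' hi')"
      by (rule cube.finite_measure_mono[OF Ri sets_boxes(2)[OF S]])
    also have "\<dots> = 1 / W" using vol_open_box[OF S] strict vol' by (metis order_less_imp_le)
    finally have "(1 - 4 * real s / real q) * vol d Ro \<le> 1 / W" using vols by linarith
    moreover have "1 / 2 * vol d Ro \<le> (1 - 4 * real s / real q) * vol d Ro"
      using half by (intro mult_right_mono) auto
    ultimately have "vol d Ro \<le> 2 / W" by simp
    then have "\<mu> Ro \<le> \<zeta> * (2 / W)"
      using \<mu>_le_vol[OF sets(1)] \<zeta>_ge_1 by (meson dual_order.trans mult_left_mono order_trans zero_le_one)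
    then have "real n * \<mu> Ro \<le> real n * (\<zeta> * (2 / W))" by (intro mult_left_mono) auto
    also have "\<dots> = real k / 4" using kn k \<zeta>_ge_1 by (simp add: W_def)
    finally have "count Ro \<omega> < real k / 2 + 4 * U"
      using good[folded W_def, OF net] by (simp add: good_pair_def)
    moreover have "\<nu> \<subseteq> Ro"
    proof -
      have "closed_box d S lo hi \<subseteq> closed_box d S lo' hi'"
        using enlarge unfolding closed_box_def by (auto intro: order_trans)
      then show ?thesis using outer Ro by blast
    qed
    then have "real K \<le> count Ro \<omega>" unfolding K_def count_eq_card by (intro of_nat_mono card_points_in_mono)
    ultimately have False using kK U U' by linarith
    then show ?thesis ..
  qed
qed

end

section \<open>Measurability of the deviation event\<close>

text \<open>
  Rounding is upwards because the left child \<open>x j \<le> \<tau>\<close> is closed: for every fixed \<open>x\<close>, membership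
  in either child is unchanged once \<open>m\<close> is large.  Moreover \<open>0\<close> is rounded to itself, so that
  a degenerate node with threshold \<open>0\<close> stays degenerate.
\<close>

definition dyadic_up :: "nat \<Rightarrow> real \<Rightarrow> real" where
  "dyadic_up m \<tau> = of_int \<lceil>\<tau> * 2 ^ m\<rceil> / 2 ^ m"

lemma dyadic_up_ge: "\<tau> \<le> dyadic_up m \<tau>"
  and dyadic_up_le: "dyadic_up m \<tau> \<le> \<tau> + (1 / 2) ^ m"
proof -
  have "\<tau> * 2 ^ m \<le> of_int \<lceil>\<tau> * 2 ^ m\<rceil>" "of_int \<lceil>\<tau> * 2 ^ m\<rceil> \<le> \<tau> * 2 ^ m + 1" by linarith+
  then show "\<tau> \<le> dyadic_up m \<tau>" "dyadic_up m \<tau> \<le> \<tau> + (1 / 2) ^ m"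
    by (simp_all add: dyadic_up_def field_simps power_one_over)
qed

lemma dyadic_up_unit: "0 \<le> \<tau> \<Longrightarrow> \<tau> \<le> 1 \<Longrightarrow> 0 \<le> dyadic_up m \<tau> \<and> dyadic_up m \<tau> \<le> 1"
proof -
  assume \<tau>: "0 \<le> \<tau>" "\<tau> \<le> 1"
  then have "\<tau> * 2 ^ m \<le> real_of_int (2 ^ m)" by simp
  then have "\<lceil>\<tau> * 2 ^ m\<rceil> \<le> 2 ^ m" by (simp only: ceiling_le_iff)
  then have "real_of_int \<lceil>\<tau> * 2 ^ m\<rceil> \<le> real_of_int (2 ^ m)" by (rule of_int_le_iff[THEN iffD2])
  then show ?thesis using dyadic_up_ge[of \<tau> m] \<tau> by (simp add: dyadic_up_def)
qed

lemma dyadic_up_tendsto: "(\<lambda>m. dyadic_up m \<tau>) \<longlonglongrightarrow> \<tau>"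
proof (rule tendsto_sandwich)
  show "\<forall>\<^sub>F m in sequentially. \<tau> \<le> dyadic_up m \<tau>" by (simp add: dyadic_up_ge)
  show "\<forall>\<^sub>F m in sequentially. dyadic_up m \<tau> \<le> \<tau> + (1 / 2) ^ m" by (simp add: dyadic_up_le)
  show "(\<lambda>m. \<tau> + (1 / 2) ^ m) \<longlonglongrightarrow> \<tau>"
    using tendsto_add[OF tendsto_const LIMSEQ_realpow_zero[of "1 / 2"], of \<tau>] by simp
qed simp

lemma eventually_le_dyadic_up: "\<forall>\<^sub>F m in sequentially. (y \<le> dyadic_up m \<tau>) = (y \<le> \<tau>)"
proof (cases "y \<le> \<tau>")
  case True
  then show ?thesis using dyadic_up_ge order_trans by (intro always_eventually) blast
next
  case False
  then have "\<forall>\<^sub>F m in sequentially. dyadic_up m \<tau> < y"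
    using order_tendstoD(2)[OF dyadic_up_tendsto] by simp
  then show ?thesis by eventually_elim (use False in auto)
qed

definition dyadic_path :: "nat \<Rightarrow> (nat \<times> real \<times> bool) list \<Rightarrow> (nat \<times> real \<times> bool) list" where
  "dyadic_path m c = map (\<lambda>(j, \<tau>, low). (j, dyadic_up m \<tau>, low)) c"

lemma dyadic_path_simps [simp]:
  "dyadic_path m [] = []"
  "dyadic_path m ((j, \<tau>, low) # c) = (j, dyadic_up m \<tau>, low) # dyadic_path m c"
  by (simp_all add: dyadic_path_def)

lemma eventually_node_dyadic_path:
  "\<forall>\<^sub>F m in sequentially. x \<in> node d (dyadic_path m c) \<longleftrightarrow> x \<in> node d c"
proof (induction c)
  case (Cons a c)
  obtain j \<tau> low where a: "a = (j, \<tau>, low)" by (cases a)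
  show ?case unfolding a
    using Cons.IH eventually_le_dyadic_up[of "x j" \<tau>]
    by eventually_elim (simp add: node_Cons)
qed simp

lemma eventually_points_in_dyadic_path:
  "\<forall>\<^sub>F m in sequentially. points_in n X (node d (dyadic_path m c)) = points_in n X (node d c)"
proof -
  have "\<forall>\<^sub>F m in sequentially. \<forall>i\<in>{..<n}. X i \<in> node d (dyadic_path m c) \<longleftrightarrow> X i \<in> node d c"
    by (intro eventually_ball_finite ballI eventually_node_dyadic_path) auto
  then show ?thesis by eventually_elim (auto simp: points_in_def)
qed

lemma eventually_valid_dyadic_path:
  assumes "valid_split_path d \<alpha> k n X c"
  shows "\<forall>\<^sub>F m in sequentially. valid_split_path d \<alpha> k n X (dyadic_path m c)"
  using assms
proof (induction c)
  case (Cons a c)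
  obtain j \<tau> low where a: "a = (j, \<tau>, low)" by (cases a)
  have v: "valid_split_path d \<alpha> k n X c" "j < d" "0 \<le> \<tau>" "\<tau> \<le> 1"
    and card: "\<And>b. \<alpha> * real (card (points_in n X (node d c))) \<le> real (card (points_in n X (node d ((j, \<tau>, b) # c))))
        \<and> k \<le> card (points_in n X (node d ((j, \<tau>, b) # c)))"
    using Cons.prems unfolding a by (auto simp del: node_Cons_low node_Cons_high)
  show ?case unfolding a
    using Cons.IH[OF v(1)] eventually_points_in_dyadic_path[of n X d c]
      eventually_points_in_dyadic_path[of n X d "(j, \<tau>, True) # c"]
      eventually_points_in_dyadic_path[of n X d "(j, \<tau>, False) # c"]
  proof eventually_elim
    case (elim m)
    have pts: "points_in n X (node d ((j, dyadic_up m \<tau>, b) # dyadic_path m c))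
        = points_in n X (node d ((j, \<tau>, b) # c))" for b
      using elim(3,4) by (cases b) simp_all
    show ?case
      using elim(1) v dyadic_up_unit[OF v(3,4)] card
      by (simp only: dyadic_path_simps valid_split_path.simps pts elim(2)) simp
  qed
qed simp

text \<open>
  A countable set that contains all rounded paths.
\<close>

definition dyadic_paths :: "(nat \<times> real \<times> bool) list set" where
  "dyadic_paths = lists (UNIV \<times> \<rat> \<times> UNIV)"

lemma countable_dyadic_paths: "countable dyadic_paths"
  unfolding dyadic_paths_def by (intro countable_lists countable_SIGMA countable_rat) auto

lemma dyadic_path_in: "dyadic_path m c \<in> dyadic_paths"
  by (auto simp: dyadic_path_def dyadic_paths_def dyadic_up_def in_lists_conv_set)

context tree_sample
begin

text \<open>
  Around a point of the node there is a box of positive side lengths \<open>\<epsilon>\<close> inside the node.  The box extends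
  below the point, where the strict inequalities \<open>x j > \<tau>\<close> leave room, and, where the point is too
  close to the face \<open>x j = 0\<close>, up to \<open>\<epsilon>\<close>, which requires the upper thresholds to be positive.
\<close>

lemma \<mu>_node_pos:
  assumes x: "x \<in> node d c" and c: "\<And>j \<tau> low. (j, \<tau>, low) \<in> set c \<Longrightarrow> j < d \<and> 0 \<le> \<tau>"
    and pos: "\<And>j \<tau>. (j, \<tau>, True) \<in> set c \<Longrightarrow> \<tau> \<noteq> 0"
  shows "0 < \<mu> (node d c)"
proof -
  \<comment> \<open>The side length must not exceed an upper threshold, the distance of the point to a strict lower face, or the side of the cube.\<close>
  define E where "E = insert 1 ((\<lambda>(j, \<tau>, low). if low then \<tau> else x j - \<tau>) ` set c)"
  define \<epsilon> where "\<epsilon> = Min E"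
  have cube: "x \<in> cube d" and cut: "\<And>j \<tau> low. (j, \<tau>, low) \<in> set c \<Longrightarrow> (x j \<le> \<tau>) = low"
    using x by (auto simp: node_def)
  have E: "finite E" "E \<noteq> {}" by (auto simp: E_def)
  have "0 < e" if "e \<in> E" for e
  proof (cases "e = 1")
    case False
    with that have "e \<in> (\<lambda>(j, \<tau>, low). if low then \<tau> else x j - \<tau>) ` set c" by (simp add: E_def)
    then obtain p where p: "p \<in> set c" "e = (case p of (j, \<tau>, low) \<Rightarrow> if low then \<tau> else x j - \<tau>)"
      by blast
    obtain j \<tau> low where jtl: "p = (j, \<tau>, low)" by (cases p)
    have jl: "(j, \<tau>, low) \<in> set c" and e: "e = (if low then \<tau> else x j - \<tau>)"
      using p jtl by auto
    show ?thesis using c[OF jl] cut[OF jl] pos[of j \<tau>] jl e by (cases low) force+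
  qed simp
  then have \<epsilon>0: "0 < \<epsilon>" using E unfolding \<epsilon>_def by (subst Min_gr_iff) auto
  have \<epsilon>1: "\<epsilon> \<le> 1" unfolding \<epsilon>_def by (rule Min_le[OF E(1)]) (simp add: E_def)
  have \<epsilon>_le: "\<epsilon> \<le> (if low then \<tau> else x j - \<tau>)" if "(j, \<tau>, low) \<in> set c" for j \<tau> low
    unfolding \<epsilon>_def by (rule Min_le[OF E(1)]) (use that in \<open>force simp: E_def\<close>)
  define lo hi where "lo j = max 0 (x j - \<epsilon>)" and "hi j = max \<epsilon> (x j)" for j
  have x01: "0 \<le> x j" "x j \<le> 1" if "j < d" for j using cube that by (auto simp: cube_def PiE_iff)
  have lohi: "0 \<le> lo j \<and> lo j < hi j \<and> hi j \<le> 1" if "j < d" for j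
    using x01[OF that] \<epsilon>0 \<epsilon>1 by (auto simp: lo_def hi_def max_def)
  have sub: "open_box d {..<d} lo hi \<subseteq> node d c"
  proof
    fix y assume y: "y \<in> open_box d {..<d} lo hi"
    have "(y j \<le> \<tau>) = low" if jl: "(j, \<tau>, low) \<in> set c" for j \<tau> low
    proof -
      have "j < d" using c[OF jl] by simp
      then have "lo j < y j" "y j < hi j" using y by (auto simp: open_box_def)
      then show ?thesis using \<epsilon>_le[OF jl] cut[OF jl] by (cases low) (auto simp: lo_def hi_def)
    qed
    then show "y \<in> node d c" using y by (auto simp: node_def open_box_def)
  qed
  have "0 < (\<Prod>j<d. hi j - lo j)" using lohi by (intro prod_pos) auto
  also have "\<dots> = vol d (open_box d {..<d} lo hi)"
    using lohi by (intro vol_open_box[symmetric]) (auto intro: less_imp_le)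
  also have "\<dots> \<le> \<zeta> * \<mu> (open_box d {..<d} lo hi)" by (intro vol_le_\<mu> sets_boxes) auto
  also have "\<dots> \<le> \<zeta> * \<mu> (node d c)"
    using \<zeta>_ge_1 c by (intro mult_left_mono \<mu>_mono[OF sub] sets_node) auto
  finally show ?thesis using \<zeta>_ge_1 by (simp add: zero_less_mult_iff)
qed

lemma \<mu>_node_zero:
  assumes c: "\<And>j \<tau> low. (j, \<tau>, low) \<in> set c \<Longrightarrow> j < d" and zero: "(j, 0, True) \<in> set c"
  shows "\<mu> (node d c) = 0"
proof -
  have j: "{j} \<subseteq> {..<d}" using c[OF zero] by simp
  have sub: "node d c \<subseteq> closed_box d {j} (\<lambda>_. 0) (\<lambda>_. 0)"
    using zero j by (auto simp: node_def closed_box_def cube_def PiE_iff)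
  have "\<mu> (node d c) \<le> \<mu> (closed_box d {j} (\<lambda>_. 0) (\<lambda>_. 0))"
    by (rule \<mu>_mono[OF sub sets_boxes(1)[OF j]])
  also have "\<dots> \<le> \<zeta> * vol d (closed_box d {j} (\<lambda>_. 0) (\<lambda>_. 0))"
    by (rule \<mu>_le_vol[OF sets_boxes(1)[OF j]])
  also have "vol d (closed_box d {j} (\<lambda>_. 0) (\<lambda>_. 0)) = 0"
    using vol_closed_box[OF j, of "\<lambda>_. 0" "\<lambda>_. 0"] by simp
  finally show ?thesis using measure_nonneg[of D "event (node d c)"] by simp
qed

text \<open>
  By dominated convergence, provided that the limit node is not null.  It can be null only through
  a restriction \<open>x j \<le> 0\<close>; then all rounded nodes are null as well and every mean is \<open>0\<close>.
\<close>

lemma cell_mean_dyadic_path: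
  assumes x: "x \<in> node d c" and c: "\<And>j \<tau> low. (j, \<tau>, low) \<in> set c \<Longrightarrow> j < d \<and> 0 \<le> \<tau>"
  shows "(\<lambda>m. cell_mean (node d (dyadic_path m c))) \<longlonglongrightarrow> cell_mean (node d c)"
proof (cases "\<exists>j. (j, 0, True) \<in> set c")
  case True
  then obtain j where j: "(j, 0, True) \<in> set c" ..
  have "(j, 0, True) \<in> set (dyadic_path m c)" for m
    using j by (force simp: dyadic_path_def dyadic_up_def)
  then have "\<mu> (node d (dyadic_path m c)) = 0" for m
    by (rule \<mu>_node_zero[rotated]) (use c in \<open>auto simp: dyadic_path_def\<close>)
  moreover have "\<mu> (node d c) = 0" by (rule \<mu>_node_zero[OF _ j]) (use c in auto)
  ultimately show ?thesis by (simp add: cell_mean_def)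
next
  case False
  have sets_c [measurable]: "node d c \<in> sets (cube_lebesgue d)" by (rule sets_node) (use c in auto)
  have sets_m [measurable]: "node d (dyadic_path m c) \<in> sets (cube_lebesgue d)" for m
    by (rule sets_node) (use c in \<open>auto simp: dyadic_path_def\<close>)
  have ind: "(\<lambda>m. indicator (event (node d (dyadic_path m c))) z :: real) \<longlonglongrightarrow> indicator (event (node d c)) z" for z
  proof (rule tendsto_eventually)
    show "\<forall>\<^sub>F m in sequentially. indicator (event (node d (dyadic_path m c))) z = (indicator (event (node d c)) z :: real)"
      using eventually_node_dyadic_path[of "fst z" d c]
      by eventually_elim (simp add: indicator_def event_def)
  qed
  have "(\<lambda>m. \<integral>z. indicator (event (node d (dyadic_path m c))) z * snd z \<partial>D)
      \<longlonglongrightarrow> (\<integral>z. indicator (event (node d c)) z * snd z \<partial>D)"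
  proof (rule integral_dominated_convergence[where w = "\<lambda>_. M"])
    show "AE z in D. (\<lambda>m. indicator (event (node d (dyadic_path m c))) z * snd z)
        \<longlonglongrightarrow> indicator (event (node d c)) z * snd z"
      by (intro AE_I2 tendsto_mult_right ind)
    show "AE z in D. norm (indicator (event (node d (dyadic_path m c))) z * snd z) \<le> M" for m
      using abs_snd_le M_pos by (intro AE_I2) (auto simp: indicator_def)
  qed auto
  moreover have "(\<lambda>m. \<integral>z. indicator (event (node d (dyadic_path m c))) z \<partial>D)
      \<longlonglongrightarrow> (\<integral>z. (indicator (event (node d c)) z :: real) \<partial>D)"
  proof (rule integral_dominated_convergence[where w = "\<lambda>_. 1"])
    show "AE z in D. (\<lambda>m. indicator (event (node d (dyadic_path m c))) z :: real)
        \<longlonglongrightarrow> indicator (event (node d c)) z"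
      by (intro AE_I2 ind)
    show "AE z in D. norm (indicator (event (node d (dyadic_path m c))) z :: real) \<le> 1" for m
      by (intro AE_I2) (auto simp: indicator_def)
  qed auto
  then have "(\<lambda>m. \<mu> (node d (dyadic_path m c))) \<longlonglongrightarrow> \<mu> (node d c)"
    by (simp add: Int_absorb2 sets.sets_into_space)
  moreover have "0 < \<mu> (node d c)"
    by (rule \<mu>_node_pos[OF x]) (use c False in blast)+
  then have "\<mu> (node d c) \<noteq> 0" by simp
  ultimately show ?thesis unfolding cell_mean_def by (intro tendsto_divide)
qed

lemma dyadic_paths_suffice:
  assumes k: "1 \<le> k"
  shows "(\<forall>c. valid_split_path d \<alpha> k n X' c \<longrightarrow> node_deviation n D X' Y' (node d c) \<le> B)
    \<longleftrightarrow> (\<forall>c\<in>dyadic_paths. valid_split_path d \<alpha> k n X' c \<longrightarrow> node_deviation n D X' Y' (node d c) \<le> B)"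
proof (intro iffI allI impI ballI)
  fix c assume dyadic: "\<forall>c\<in>dyadic_paths. valid_split_path d \<alpha> k n X' c \<longrightarrow> node_deviation n D X' Y' (node d c) \<le> B"
    and c: "valid_split_path d \<alpha> k n X' c"
  have sets_c: "node d c \<in> sets (cube_lebesgue d)" by (rule sets_node) (use valid_split_path_thresholds[OF c] in blast)
  have sets_m: "node d (dyadic_path m c) \<in> sets (cube_lebesgue d)" for m
    by (rule sets_node) (use valid_split_path_thresholds[OF c] in \<open>auto simp: dyadic_path_def\<close>)
  have "points_in n X' (node d c) \<noteq> {}" using valid_split_path_card[OF c] k by auto
  then obtain x where "x \<in> node d c" by (auto simp: points_in_def)
  then have lim: "(\<lambda>m. cell_mean (node d (dyadic_path m c))) \<longlonglongrightarrow> cell_mean (node d c)"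
    by (rule cell_mean_dyadic_path) (use valid_split_path_thresholds[OF c] in blast)
  define avg where "avg = (\<Sum>i\<in>points_in n X' (node d c). Y' i) / real (card (points_in n X' (node d c)))"
  have "\<forall>\<^sub>F m in sequentially. \<bar>avg - cell_mean (node d (dyadic_path m c))\<bar> \<le> B"
    using eventually_valid_dyadic_path[OF c] eventually_points_in_dyadic_path[of n X' d c]
  proof eventually_elim
    case (elim m)
    have "node_deviation n D X' Y' (node d (dyadic_path m c)) \<le> B"
      using dyadic dyadic_path_in elim(1) by blast
    then show ?case
      by (simp only: node_deviation_def optimal_eq_cell_mean[OF sets_m] elim(2) avg_def)
  qed
  moreover have "(\<lambda>m. \<bar>avg - cell_mean (node d (dyadic_path m c))\<bar>) \<longlonglongrightarrow> \<bar>avg - cell_mean (node d c)\<bar>"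
    by (intro tendsto_intros lim)
  ultimately have "\<bar>avg - cell_mean (node d c)\<bar> \<le> B"
    by (intro tendsto_upperbound) auto
  then show "node_deviation n D X' Y' (node d c) \<le> B"
    by (simp only: node_deviation_def optimal_eq_cell_mean[OF sets_c] avg_def)
qed auto

lemma sets_valid_path:
  "{\<omega> \<in> space P. valid_split_path d \<alpha> k n (\<lambda>i. X i \<omega>) c} \<in> sets P"
proof (cases "\<forall>(j, \<tau>, low)\<in>set c. j < d")
  case False
  then have "{\<omega> \<in> space P. valid_split_path d \<alpha> k n (\<lambda>i. X i \<omega>) c} = {}"
    using valid_split_path_thresholds by blast
  then show ?thesis by (simp only: sets.empty_sets)
next
  case True
  from True show ?thesis
  proof (induction c)
    case Nil
    have [measurable]: "node d [] \<in> sets (cube_lebesgue d)" by (rule sets_node) auto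
    have "{\<omega> \<in> space P. real k \<le> count (node d []) \<omega>} \<in> sets P" by measurable
    then show ?case by (simp add: count_eq_card)
  next
    case (Cons a c)
    obtain j \<tau> low where a: "a = (j, \<tau>, low)" by (cases a)
    have j: "j < d" using Cons.prems a by auto
    have IH: "{\<omega> \<in> space P. valid_split_path d \<alpha> k n (\<lambda>i. X i \<omega>) c} \<in> sets P" using Cons by auto
    have [measurable]: "node d c \<in> sets (cube_lebesgue d)" by (rule sets_node) (use Cons.prems in auto)
    have [measurable]: "node d ((j, \<tau>, b) # c) \<in> sets (cube_lebesgue d)" for b
      by (rule sets_node) (use Cons.prems j in auto)
    have S: "{\<omega> \<in> space P. \<alpha> * count (node d c) \<omega> \<le> count (node d ((j, \<tau>, b) # c)) \<omega>
        \<and> real k \<le> count (node d ((j, \<tau>, b) # c)) \<omega>} \<in> sets P" (is "?S b \<in> _") for b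
      by measurable
    have "{\<omega> \<in> space P. valid_split_path d \<alpha> k n (\<lambda>i. X i \<omega>) (a # c)}
        = (if 0 \<le> \<tau> \<and> \<tau> \<le> 1 then {\<omega> \<in> space P. valid_split_path d \<alpha> k n (\<lambda>i. X i \<omega>) c} \<inter> ?S True \<inter> ?S False else {})"
      using j unfolding a by (auto simp: count_eq_card all_bool_eq simp del: node_Cons_low node_Cons_high)
    also have "\<dots> \<in> sets P"
    proof (cases "0 \<le> \<tau> \<and> \<tau> \<le> 1")
      case True
      show ?thesis unfolding if_P[OF True] by (intro sets.Int IH S)
    next
      case False
      show ?thesis unfolding if_not_P[OF False] by (rule sets.empty_sets)
    qed
    finally show ?case .
  qed
qed

lemma sets_sup_deviation_le:
  assumes k: "1 \<le> k"
  shows "{\<omega> \<in> space P. sup_deviation d \<alpha> k n D (\<lambda>i. X i \<omega>) (\<lambda>i. Y i \<omega>) \<le> ereal B} \<in> sets P"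
proof -
  have "{\<omega> \<in> space P. \<forall>c\<in>dyadic_paths. valid_split_path d \<alpha> k n (\<lambda>i. X i \<omega>) c \<longrightarrow>
      node_deviation n D (\<lambda>i. X i \<omega>) (\<lambda>i. Y i \<omega>) (node d c) \<le> B} \<in> sets P"
  proof (rule sets.sets_Collect_countable_All'[OF _ countable_dyadic_paths])
    fix c
    show "{\<omega> \<in> space P. valid_split_path d \<alpha> k n (\<lambda>i. X i \<omega>) c \<longrightarrow>
      node_deviation n D (\<lambda>i. X i \<omega>) (\<lambda>i. Y i \<omega>) (node d c) \<le> B} \<in> sets P"
    proof (cases "\<forall>(j, \<tau>, low)\<in>set c. j < d")
      case True
      have s [measurable]: "node d c \<in> sets (cube_lebesgue d)" by (rule sets_node) (use True in auto)
      have dev: "node_deviation n D (\<lambda>i. X i \<omega>) (\<lambda>i. Y i \<omega>) (node d c)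
          = \<bar>(\<Sum>i<n. indicator (node d c) (X i \<omega>) * (Y i \<omega> - 0)) / count (node d c) \<omega> - cell_mean (node d c)\<bar>" for \<omega>
        unfolding node_deviation_def sum_points_in count_eq_card[symmetric] optimal_eq_cell_mean[OF s] by simp
      have "{\<omega> \<in> space P. node_deviation n D (\<lambda>i. X i \<omega>) (\<lambda>i. Y i \<omega>) (node d c) \<le> B} \<in> sets P"
        unfolding dev by measurable
      then show ?thesis by (intro sets.sets_Collect_imp sets_valid_path)
    next
      case False
      then have "{\<omega> \<in> space P. valid_split_path d \<alpha> k n (\<lambda>i. X i \<omega>) c \<longrightarrow>
          node_deviation n D (\<lambda>i. X i \<omega>) (\<lambda>i. Y i \<omega>) (node d c) \<le> B} = space P"
        using valid_split_path_thresholds by blast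
      then show ?thesis by (simp only: sets.top)
    qed
  qed
  then show ?thesis by (simp add: sup_deviation_le_iff[OF k] dyadic_paths_suffice[OF k])
qed

text \<open>
  The bound for a single sample size: the exponent \<open>U\<close> has to dominate the entropy of the net and
  to be small compared with \<open>k\<close>.
\<close>

lemma sup_deviation_tail:
  assumes k: "1 \<le> k" "k \<le> n" and \<alpha>: "0 \<le> \<alpha>" "\<alpha> \<le> 1"
    and depth: "\<And>t. real k \<le> (1 - \<alpha>) ^ t * real n \<Longrightarrow> t \<le> s"
    and q: "4 \<le> q" "4 * \<zeta>\<^sup>2 * real s / real q \<le> 1 / sqrt (real k)"
    and U: "1296 \<le> U" "512 * \<zeta>\<^sup>2 * U \<le> real k"
  defines "W \<equiv> 8 * \<zeta> * real n / real k"
  assumes entropy: "(real d + 1) ^ s * (real (nat \<lfloor>log 2 W\<rfloor>) + 1) ^ s * ((2 * real q * (real q + 3)) ^ s * W)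
      \<le> exp (3 * U)"
  shows "1 - 5 * exp (- U)
    \<le> measure P {\<omega> \<in> space P. sup_deviation d \<alpha> k n D (\<lambda>i. X i \<omega>) (\<lambda>i. Y i \<omega>)
        \<le> ereal (9 * M * sqrt (U / real k))}" (is "_ \<le> measure P ?S")
proof -
  define \<N> where "\<N> = box_net d s q W"
  have W: "1 \<le> W"
  proof -
    have "real k * 1 \<le> real n * (8 * \<zeta>)" using k \<zeta>_ge_1 by (intro mult_mono) auto
    then show ?thesis using k by (simp add: W_def field_simps)
  qed
  have fin: "finite \<N>" unfolding \<N>_def box_net_def using q W by (intro finite_imageI finite_grid_codes) auto
  have "real (card \<N>) \<le> real (card (grid_codes d s q W))"
    unfolding \<N>_def box_net_def using q W by (intro of_nat_mono card_image_le finite_grid_codes) auto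
  also have "\<dots> \<le> exp (3 * U)" using card_grid_codes[of q W d s] q W entropy by linarith
  finally have "real (card \<N>) * (5 * exp (- 4 * U)) \<le> exp (3 * U) * (5 * exp (- 4 * U))"
    by (intro mult_right_mono) auto
  also have "\<dots> = 5 * exp (- U)" by (simp add: exp_add[symmetric])
  finally have small: "real (card \<N>) * (5 * exp (- 4 * U)) \<le> 5 * exp (- U)" .
  have U0: "0 < U" using U by simp
  have pairs: "Ro \<in> sets (cube_lebesgue d) \<and> Ri \<in> sets (cube_lebesgue d)" if "(Ro, Ri) \<in> \<N>" for Ro Ri
    using box_net_sets[of Ro Ri] that by (auto simp: \<N>_def)
  let ?G = "{\<omega> \<in> space P. \<forall>(Ro, Ri)\<in>\<N>. good_pair U \<omega> Ro Ri}"
  have "?G \<subseteq> ?S"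
  proof clarify
    fix \<omega> assume \<omega>: "\<omega> \<in> space P" and good: "\<forall>(Ro, Ri)\<in>\<N>. good_pair U \<omega> Ro Ri"
    have g: "good_pair U \<omega> Ro Ri" if "(Ro, Ri) \<in> box_net d s q (8 * \<zeta> * real n / real k)" for Ro Ri
      using good that by (auto simp: \<N>_def W_def)
    show "sup_deviation d \<alpha> k n D (\<lambda>i. X i \<omega>) (\<lambda>i. Y i \<omega>) \<le> ereal (9 * M * sqrt (U / real k))"
      unfolding sup_deviation_le_iff[OF k(1)]
      using good_net_deviation[OF \<omega> g \<alpha> _ k(1) depth q U] by blast
  qed
  then have "measure P ?G \<le> measure P ?S"
    by (intro P.finite_measure_mono sets_sup_deviation_le k)
  then show ?thesis using prob_all_good_pairs[OF U0 fin pairs] small by linarith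
qed

end

section \<open>Asymptotics of the entropy\<close>

text \<open>
  A split multiplies the number of points by at most \<open>1 - \<alpha> = exp (- depth_rate \<alpha>)\<close>.
\<close>

definition depth_rate :: "real \<Rightarrow> real" where
  "depth_rate \<alpha> = ln (1 / (1 - \<alpha>))"

text \<open>
  Collects the factors that depend neither on \<open>n\<close> nor on \<open>d\<close> nor on \<open>k\<close>: the second one stems from the number
  of scales, the third one from the resolution \<open>q\<close> (see \<open>entropy_le\<close>).
\<close>

definition entropy_const :: "real \<Rightarrow> real \<Rightarrow> real" where
  "entropy_const \<zeta> \<alpha> = ln (16 * (2 * ln (8 * \<zeta>) + 3) * (5 * \<zeta>\<^sup>2 * (1 / depth_rate \<alpha> + 1))\<^sup>2)"

text \<open>
  Bounds the logarithm of the size of the net.  The first summand is the maximal depth times the cost of a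
  restricted coordinate, the two others are the logarithm of the inverse volume bound \<open>W\<close>.
\<close>

definition log_entropy :: "real \<Rightarrow> real \<Rightarrow> real \<Rightarrow> real \<Rightarrow> real \<Rightarrow> real" where
  "log_entropy \<zeta> \<alpha> n d k = ln (n / k) / depth_rate \<alpha> * (entropy_const \<zeta> \<alpha> + ln d + ln k + 3 * ln (ln n))
     + ln (8 * \<zeta>) + ln (n / k)"

lemma depth_rate_pos: "0 < \<alpha> \<Longrightarrow> \<alpha> < 1 \<Longrightarrow> 0 < depth_rate \<alpha>"
  by (simp add: depth_rate_def ln_gt_zero field_simps)

lemma entropy_const_nonneg:
  assumes "1 \<le> \<zeta>" "0 < \<alpha>" "\<alpha> < 1"
  shows "0 \<le> entropy_const \<zeta> \<alpha>"
proof -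
  have a: "0 < depth_rate \<alpha>" using depth_rate_pos assms by simp
  have "1 \<le> \<zeta>\<^sup>2" using assms by (intro one_le_power) auto
  then have "1 * 1 \<le> 5 * \<zeta>\<^sup>2 * (1 / depth_rate \<alpha> + 1)" using a by (intro mult_mono) auto
  then have "1 \<le> 5 * \<zeta>\<^sup>2 * (1 / depth_rate \<alpha> + 1)" by simp
  then have "1 \<le> (5 * \<zeta>\<^sup>2 * (1 / depth_rate \<alpha> + 1))\<^sup>2" by (rule one_le_power)
  moreover have "1 \<le> 16 * (2 * ln (8 * \<zeta>) + 3)" using assms by (simp add: add_nonneg_pos)
  ultimately have "1 * 1 \<le> 16 * (2 * ln (8 * \<zeta>) + 3) * (5 * \<zeta>\<^sup>2 * (1 / depth_rate \<alpha> + 1))\<^sup>2"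
    by (intro mult_mono) auto
  then show ?thesis by (simp add: entropy_const_def)
qed

text \<open>
  With resolution \<open>q\<close> of order \<open>s sqrt k\<close>, the factor per coordinate in \<open>card_grid_codes\<close> is at
  most a constant times \<open>d k (ln n)\<^sup>3\<close>: the number of scales and the factor \<open>s\<close> in each of the two
  faces are of order \<open>ln n\<close>.
\<close>

lemma
  fixes \<zeta> \<alpha> :: real and n d k :: nat
  assumes \<zeta>: "1 \<le> \<zeta>" and \<alpha>: "0 < \<alpha>" "\<alpha> < 1" and k: "1 \<le> k" "k \<le> n" and d: "1 \<le> d" and n: "1 \<le> ln (real n)"
  defines "W \<equiv> 8 * \<zeta> * real n / real k"
    and "s \<equiv> nat \<lfloor>ln (real n / real k) / depth_rate \<alpha>\<rfloor>"
    and "q \<equiv> nat \<lceil>4 * \<zeta>\<^sup>2 * (real (nat \<lfloor>ln (real n / real k) / depth_rate \<alpha>\<rfloor>) + 1) * sqrt (real k)\<rceil>"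
  shows depth_le: "\<And>t. real k \<le> (1 - \<alpha>) ^ t * real n \<Longrightarrow> t \<le> s"
    and resolution_ge: "4 \<le> q" and resolution: "4 * \<zeta>\<^sup>2 * real s / real q \<le> 1 / sqrt (real k)"
    and entropy_le: "(real d + 1) ^ s * (real (nat \<lfloor>log 2 W\<rfloor>) + 1) ^ s * ((2 * real q * (real q + 3)) ^ s * W)
      \<le> exp (log_entropy \<zeta> \<alpha> n d k)"
proof -
  define a where "a = depth_rate \<alpha>"
  define l where "l = ln (real n / real k)"
  define L where "L = ln (real n)"
  have a: "0 < a" using depth_rate_pos \<alpha> by (simp add: a_def)
  have L: "1 \<le> L" using n by (simp add: L_def)
  have l: "0 \<le> l" "l \<le> L"
    using k by (auto simp: l_def L_def ln_div)
  have \<zeta>2: "1 \<le> \<zeta>\<^sup>2" using \<zeta> by simp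
  have k1: "1 \<le> sqrt (real k)" using k by simp
  have s_eq: "s = nat \<lfloor>l / a\<rfloor>" by (simp add: s_def l_def a_def)
  have s_le: "real s \<le> l / a" using l a by (simp add: s_eq)
  have q_eq: "q = nat \<lceil>4 * \<zeta>\<^sup>2 * (real s + 1) * sqrt (real k)\<rceil>" by (simp add: q_def s_def)
  define Q where "Q = 4 * \<zeta>\<^sup>2 * (real s + 1) * sqrt (real k)"
  have "1 * 1 \<le> \<zeta>\<^sup>2 * (real s + 1)" using \<zeta>2 by (intro mult_mono) auto
  then have base: "1 * 1 \<le> (\<zeta>\<^sup>2 * (real s + 1)) * sqrt (real k)" using k1 by (intro mult_mono) auto
  then have Q4: "4 \<le> Q" by (simp add: Q_def)
  have q_real: "Q \<le> real q" "real q \<le> Q + 1" using Q4 unfolding q_eq Q_def[symmetric] by linarith+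
  show q4: "4 \<le> q" using q_real Q4 by linarith
  have "4 * \<zeta>\<^sup>2 * real s * sqrt (real k) \<le> Q"
    unfolding Q_def using k1 \<zeta>2 by (intro mult_right_mono mult_left_mono) auto
  then have "4 * \<zeta>\<^sup>2 * real s * sqrt (real k) \<le> real q" using q_real by linarith
  then show "4 * \<zeta>\<^sup>2 * real s / real q \<le> 1 / sqrt (real k)"
    using q4 k1 by (simp add: divide_simps mult_ac)
  show "t \<le> s" if t: "real k \<le> (1 - \<alpha>) ^ t * real n" for t
  proof -
    have "ln (real k) \<le> ln ((1 - \<alpha>) ^ t * real n)" using t k by (intro ln_mono) auto
    also have "\<dots> = real t * ln (1 - \<alpha>) + ln (real n)"
      using \<alpha> k by (simp add: ln_mult ln_realpow)
    also have "ln (1 - \<alpha>) = - a" using \<alpha> by (simp add: a_def depth_rate_def ln_div)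
    finally have "real t * a \<le> l" using k by (simp add: l_def ln_div)
    then have "real t \<le> l / a" using a by (simp add: pos_le_divide_eq)
    then show ?thesis unfolding s_eq by (rule le_nat_floor)
  qed
  define CA where "CA = 2 * ln (8 * \<zeta>) + 3"
  define CQ where "CQ = 5 * \<zeta>\<^sup>2 * (1 / a + 1)"
  have CA: "1 \<le> CA" using \<zeta> by (simp add: CA_def add_nonneg_pos)
  have W_pos: "1 \<le> W"
  proof -
    have "real k * 1 \<le> real n * (8 * \<zeta>)" using k \<zeta> by (intro mult_mono) auto
    then show ?thesis using k by (simp add: W_def field_simps)
  qed
  have ln_W: "ln W = ln (8 * \<zeta>) + l"
    using \<zeta> k by (simp add: W_def l_def ln_mult ln_div)
  have scales: "real (nat \<lfloor>log 2 W\<rfloor>) + 1 \<le> CA * L"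
  proof -
    have lnW0: "0 \<le> ln W" using W_pos by simp
    have "log 2 W = ln W / ln 2" by (simp add: log_def)
    also have "\<dots> \<le> ln W / (1 / 2)" using ln2_ge_two_thirds lnW0 by (intro divide_left_mono) auto
    finally have "log 2 W \<le> 2 * ln W" by simp
    moreover have "real (nat \<lfloor>log 2 W\<rfloor>) \<le> log 2 W" using W_pos by (intro of_nat_floor) simp
    ultimately have "real (nat \<lfloor>log 2 W\<rfloor>) + 1 \<le> 2 * ln (8 * \<zeta>) * 1 + 2 * L + 1"
      using l unfolding ln_W distrib_left by linarith
    also have "\<dots> \<le> 2 * ln (8 * \<zeta>) * L + 2 * L + L" using L \<zeta> by (intro add_mono mult_left_mono) auto
    finally show ?thesis by (simp add: CA_def algebra_simps)
  qed
  have "real s + 1 \<le> (1 / a + 1) * L"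
  proof -
    have "l / a \<le> L / a" using l a by (intro divide_right_mono) auto
    then show ?thesis using s_le L by (simp add: algebra_simps)
  qed
  then have "(5 * \<zeta>\<^sup>2 * sqrt (real k)) * (real s + 1) \<le> (5 * \<zeta>\<^sup>2 * sqrt (real k)) * ((1 / a + 1) * L)"
    using \<zeta>2 by (intro mult_left_mono) auto
  moreover have "real q \<le> (5 * \<zeta>\<^sup>2 * sqrt (real k)) * (real s + 1)"
    using q_real(2) base unfolding Q_def by (simp add: algebra_simps)
  ultimately have "real q \<le> (5 * \<zeta>\<^sup>2 * sqrt (real k)) * ((1 / a + 1) * L)" by linarith
  then have q_le: "real q \<le> CQ * L * sqrt (real k)" by (simp add: CQ_def mult_ac)
  have "real q * (real q + 3) \<le> real q * (4 * real q)" using q4 by (intro mult_left_mono) auto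
  then have "2 * real q * (real q + 3) \<le> 8 * (real q)\<^sup>2" by (simp add: power2_eq_square)
  also have "\<dots> \<le> 8 * (CQ * L * sqrt (real k))\<^sup>2" using q_le by (intro mult_left_mono power_mono) auto
  also have "\<dots> = 8 * CQ\<^sup>2 * L\<^sup>2 * real k" by (simp add: power_mult_distrib)
  finally have quad: "2 * real q * (real q + 3) \<le> 8 * CQ\<^sup>2 * L\<^sup>2 * real k" .
  define B where "B = (real d + 1) * (real (nat \<lfloor>log 2 W\<rfloor>) + 1) * (2 * real q * (real q + 3))"
  define B' where "B' = (16 * CA * CQ\<^sup>2) * real d * real k * L ^ 3"
  have "B \<le> (2 * real d) * (CA * L) * (8 * CQ\<^sup>2 * L\<^sup>2 * real k)"
    unfolding B_def
    by (rule mult_mono[OF mult_mono[OF _ scales] quad]) (use d L CA in auto)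
  also have "\<dots> = B'" by (simp add: B'_def power2_eq_square power3_eq_cube)
  finally have BB': "B \<le> B'" .
  have "1 * 1 * 1 \<le> B" unfolding B_def using q4
    by (intro mult_mono) (auto intro: order_trans[of 1 "2 * real q * 1"] mult_left_mono)
  then have B1: "1 \<le> B" by simp
  have CQ0: "0 < CQ" unfolding CQ_def using a \<zeta> by (intro mult_pos_pos add_pos_pos) auto
  have lnB': "ln B' = entropy_const \<zeta> \<alpha> + ln d + ln k + 3 * ln L"
  proof -
    define G where "G = 16 * CA * CQ\<^sup>2"
    have G: "0 < G" using CA CQ0 by (simp add: G_def)
    have "entropy_const \<zeta> \<alpha> = ln G" by (simp only: entropy_const_def G_def CA_def CQ_def a_def)
    moreover have "ln B' = ln (G * real d * real k) + ln (L ^ 3)"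
      unfolding B'_def G_def[symmetric] using G d k L by (intro ln_mult_pos) auto
    moreover have "ln (G * real d * real k) = ln (G * real d) + ln (real k)"
      using G d k by (intro ln_mult_pos) auto
    moreover have "ln (G * real d) = ln G + ln (real d)" using G d by (intro ln_mult_pos) auto
    moreover have "ln (L ^ 3) = 3 * ln L" using L by (simp add: ln_realpow)
    ultimately show ?thesis by simp
  qed
  have "(real d + 1) ^ s * (real (nat \<lfloor>log 2 W\<rfloor>) + 1) ^ s * ((2 * real q * (real q + 3)) ^ s * W) = B ^ s * W"
    by (simp add: B_def power_mult_distrib mult_ac)
  also have "B ^ s \<le> exp (l / a * ln B')"
  proof -
    have "B ^ s = exp (real s * ln B)" using B1 by (simp add: exp_of_nat_mult)
    also have "real s * ln B \<le> l / a * ln B'"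
      using s_le B1 BB' l a by (intro mult_mono) auto
    finally show ?thesis by simp
  qed
  also have "exp (l / a * ln B') * W = exp (l / a * ln B' + ln W)" using W_pos by (simp add: exp_add)
  also have "l / a * ln B' + ln W = log_entropy \<zeta> \<alpha> n d k"
    by (simp add: log_entropy_def lnB' ln_W a_def L_def l_def)
  finally show "(real d + 1) ^ s * (real (nat \<lfloor>log 2 W\<rfloor>) + 1) ^ s * ((2 * real q * (real q + 3)) ^ s * W)
      \<le> exp (log_entropy \<zeta> \<alpha> n d k)"
    using W_pos by (simp add: mult_right_mono)
qed

context tree_sample
begin

text \<open>
  If \<open>k > n\<close>, no partition is valid, and the supremum over the empty set is below every bound.
\<close>

lemma sup_deviation_rate:
  assumes k: "1 \<le> k" and d: "1 \<le> d" and \<alpha>: "0 < \<alpha>" "\<alpha> < 1" and n: "1 \<le> ln (real n)"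
    and U: "1296 \<le> U" "512 * \<zeta>\<^sup>2 * U \<le> real k"
    and entropy: "k \<le> n \<Longrightarrow> log_entropy \<zeta> \<alpha> n d k \<le> 3 * U"
  shows "1 - 5 * exp (- U)
    \<le> measure P {\<omega> \<in> space P. sup_deviation d \<alpha> k n D (\<lambda>i. X i \<omega>) (\<lambda>i. Y i \<omega>)
        \<le> ereal (9 * M * sqrt (U / real k))}"
proof (cases "k \<le> n")
  case True
  note * = \<zeta>_ge_1 \<alpha> k True d n
  show ?thesis
    by (rule sup_deviation_tail[OF k True _ _ depth_le[OF *] resolution_ge[OF *] resolution[OF *] U
          order_trans[OF entropy_le[OF *]]])
       (use \<alpha> entropy True in auto)
next
  case False
  have "\<not> valid_split_path d \<alpha> k n X' c" for X' c
  proof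
    assume "valid_split_path d \<alpha> k n X' c"
    then have "k \<le> card (points_in n X' (node d c))" by (rule valid_split_path_card)
    also have "\<dots> \<le> card {..<n}" by (rule card_mono) (auto simp: points_in_def)
    finally show False using False by simp
  qed
  then have "{\<omega> \<in> space P. sup_deviation d \<alpha> k n D (\<lambda>i. X i \<omega>) (\<lambda>i. Y i \<omega>) \<le> ereal (9 * M * sqrt (U / real k))}
      = space P"
    by (simp add: sup_deviation_le_iff[OF k])
  then show ?thesis by (simp add: P.prob_space)
qed

end

text \<open>
  Applied with \<open>L = ln n\<close>: although \<open>ln k\<close> may be as large as \<open>ln n\<close>, it is
  either comparable with \<open>ln (ln n)\<close> or negligible against \<open>k\<close>.
\<close>

lemma ln_mult_ln_le:
  fixes L k :: real
  assumes L: "1 \<le> L" and k: "1 \<le> k"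
  shows "L * ln k / k \<le> 4 * (L * ln L / k) + 4 / L\<^sup>2"
proof (cases "ln k \<le> 4 * ln L")
  case True
  then have "L * ln k \<le> L * (4 * ln L)" using L by (intro mult_left_mono) auto
  then have "L * ln k / k \<le> L * (4 * ln L) / k" using k by (intro divide_right_mono) auto
  also have "L * (4 * ln L) / k = 4 * (L * ln L / k)" by simp
  finally have "L * ln k / k \<le> 4 * (L * ln L / k)" .
  then show ?thesis by (rule add_increasing2[rotated]) simp
next
  case False
  define t where "t = exp (ln k / 4)"
  have t4: "t ^ 4 = k" using k by (simp add: t_def exp_of_nat_mult[symmetric])
  have "ln k = 4 * ln t" by (simp add: t_def)
  moreover have "ln t \<le> t" using ln_le_minus_one[of t] by (simp add: t_def)
  ultimately have ln_k: "ln k \<le> 4 * t" by linarith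
  have "ln L < ln t" using False by (simp add: t_def)
  moreover have "0 < t" by (simp add: t_def)
  ultimately have Lt: "L \<le> t" using L ln_less_cancel_iff[of L t] by linarith
  have t1: "1 \<le> t" using L Lt by linarith
  have "L * ln k / k \<le> t * (4 * t) / k"
    using Lt ln_k L k t1 by (intro divide_right_mono mult_mono) auto
  also have "\<dots> = 4 / t\<^sup>2" using t1 by (simp add: t4[symmetric] power2_eq_square power4_eq_xxxx)
  also have "\<dots> \<le> 4 / L\<^sup>2" using Lt L by (intro divide_left_mono power_mono mult_pos_pos) auto
  finally show ?thesis using L k by (simp add: add_increasing)
qed

theorem theorem1:
  fixes M \<zeta> \<alpha> :: real
    and d k :: "nat \<Rightarrow> nat"
    and P :: "nat \<Rightarrow> 'a measure"
    and D :: "nat \<Rightarrow> ((nat \<Rightarrow> real) \<times> real) measure"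
    and X :: "nat \<Rightarrow> nat \<Rightarrow> 'a \<Rightarrow> nat \<Rightarrow> real"
    and Y :: "nat \<Rightarrow> nat \<Rightarrow> 'a \<Rightarrow> real"
    and f :: "nat \<Rightarrow> (nat \<Rightarrow> real) \<Rightarrow> real"
  assumes "M > 0" and "\<zeta> \<ge> 1" and "0 < \<alpha>" and "\<alpha> < 1 / 2"
    and "\<And>n. d n \<ge> 1" and "\<And>n. k n \<ge> 1"
    and "\<And>n. sets (D n) = sets (example_space (d n) M)"
    and "\<And>n. iid_sample (P n) (D n) n (\<lambda>i \<omega>. (X n i \<omega>, Y n i \<omega>))"
    and "\<And>n i. i < n \<Longrightarrow>
           distributed (P n) (cube_lebesgue (d n)) (X n i) (\<lambda>x. ennreal (f n x))"
    and "\<And>n x. x \<in> cube (d n) \<Longrightarrow> 1 / \<zeta> \<le> f n x \<and> f n x \<le> \<zeta>"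
    and "(\<lambda>n. ln (real n) * max (ln (real (d n))) (ln (ln (real n))) / real (k n)) \<longlonglongrightarrow> 0"
  shows
    "(limsup (\<lambda>n. ereal (real (k n) / real n)) < 1 \<longrightarrow>
        (\<lambda>n. measure (P n) {\<omega> \<in> space (P n).
           sup_deviation (d n) \<alpha> (k n) n (D n) (\<lambda>i. X n i \<omega>) (\<lambda>i. Y n i \<omega>)
             \<le> ereal (9 * M * sqrt (ln (real n / real (k n))
                    * (ln (real (d n) * real (k n)) + 3 * ln (ln (real n)))
                    / ln (1 / (1 - \<alpha>))) * (1 / sqrt (real (k n))))}) \<longlonglongrightarrow> 1) \<and>
     (liminf (\<lambda>n. ereal (real (d n) / real n)) > 0 \<longrightarrow>
        (\<lambda>n. measure (P n) {\<omega> \<in> space (P n).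
           sup_deviation (d n) \<alpha> (k n) n (D n) (\<lambda>i. X n i \<omega>) (\<lambda>i. Y n i \<omega>)
             \<le> ereal (9 * M * sqrt (ln (real n) * ln (real (d n))
                    / ln (1 / (1 - \<alpha>))) * (1 / sqrt (real (k n))))}) \<longlonglongrightarrow> 1)"
proof -
  define a where "a = ln (1 / (1 - \<alpha>))"
  define C where "C = entropy_const \<zeta> \<alpha>"
  define h where "h n = ln (real n) * max (ln (real (d n))) (ln (ln (real n))) / real (k n)" for n
  have a: "0 < a" and a_rate: "depth_rate \<alpha> = a"
    using depth_rate_pos[of \<alpha>] assms(3,4) by (auto simp: a_def depth_rate_def)
  have C: "0 \<le> C" unfolding C_def using assms by (intro entropy_const_nonneg) auto
  have h0: "h \<longlonglongrightarrow> 0" using assms(11) by (simp add: h_def[abs_def])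
  have ln_large: "\<forall>\<^sub>F n in sequentially. 1 \<le> ln (real n)" by real_asymp
  have pos [simp]: "0 < real (d n)" "0 < real (k n)" "1 \<le> real (d n)" "1 \<le> real (k n)" for n
    using assms(5,6)[of n] by auto
  have ln_nonneg: "0 \<le> ln (real (d n))" "0 \<le> ln (real (k n))" for n
    using pos[of n] by (auto intro: ln_ge_zero)
  \<comment> \<open>Both limits come from one criterion; only the exponent differs.\<close>
  have rate_suffices: "(\<lambda>n. measure (P n) {\<omega> \<in> space (P n).
      sup_deviation (d n) \<alpha> (k n) n (D n) (\<lambda>i. X n i \<omega>) (\<lambda>i. Y n i \<omega>)
        \<le> ereal (9 * M * sqrt (U n) * (1 / sqrt (real (k n))))}) \<longlonglongrightarrow> 1"
    if U_top: "filterlim U at_top sequentially" and U_k: "(\<lambda>n. U n / real (k n)) \<longlonglongrightarrow> 0"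
      and entropy: "\<forall>\<^sub>F n in sequentially. k n \<le> n \<longrightarrow> log_entropy \<zeta> \<alpha> n (d n) (k n) \<le> 3 * U n"
    for U :: "nat \<Rightarrow> real"
  proof (rule tendsto_sandwich)
    have "\<forall>\<^sub>F n in sequentially. U n / real (k n) < 1 / (512 * \<zeta>\<^sup>2)"
      using order_tendstoD(2)[OF U_k] assms(2) by simp
    moreover have "\<forall>\<^sub>F n in sequentially. 1296 \<le> U n" using U_top by (auto simp: filterlim_at_top)
    ultimately show "\<forall>\<^sub>F n in sequentially. 1 - 5 * exp (- U n) \<le> measure (P n) {\<omega> \<in> space (P n).
      sup_deviation (d n) \<alpha> (k n) n (D n) (\<lambda>i. X n i \<omega>) (\<lambda>i. Y n i \<omega>)
        \<le> ereal (9 * M * sqrt (U n) * (1 / sqrt (real (k n))))}"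
      using entropy ln_large eventually_ge_at_top[of 1]
    proof eventually_elim
      case (elim n)
      interpret tree_sample "P n" "D n" n "X n" "Y n" "d n" M \<zeta> "f n"
        by unfold_locales (use assms elim in auto)
      have "U n < 1 / (512 * \<zeta>\<^sup>2) * real (k n)" using elim(1) by (simp only: pos_divide_less_eq[OF pos(2)])
      then have "512 * \<zeta>\<^sup>2 * U n \<le> 512 * \<zeta>\<^sup>2 * (1 / (512 * \<zeta>\<^sup>2) * real (k n))"
        by (intro mult_left_mono) auto
      also have "\<dots> = real (k n)" using assms(2) by simp
      finally have "512 * \<zeta>\<^sup>2 * U n \<le> real (k n)" .
      moreover have "sqrt (U n / real (k n)) = sqrt (U n) * (1 / sqrt (real (k n)))"
        by (simp add: real_sqrt_divide)
      ultimately show ?case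
        using sup_deviation_rate[of "k n" \<alpha> "U n"] assms elim by (simp add: mult.assoc)
    qed
    show "\<forall>\<^sub>F n in sequentially. measure (P n) {\<omega> \<in> space (P n).
      sup_deviation (d n) \<alpha> (k n) n (D n) (\<lambda>i. X n i \<omega>) (\<lambda>i. Y n i \<omega>)
        \<le> ereal (9 * M * sqrt (U n) * (1 / sqrt (real (k n))))} \<le> 1"
      using assms(8) by (intro always_eventually allI prob_space.prob_le_1) (auto simp: iid_sample_def)
    have "((\<lambda>x. 1 - 5 * exp (- x)) \<longlongrightarrow> 1) (at_top :: real filter)" by real_asymp
    then show "(\<lambda>n. 1 - 5 * exp (- U n)) \<longlonglongrightarrow> 1" by (rule filterlim_compose[OF _ U_top])
  qed simp
  show ?thesis unfolding a_def[symmetric]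
  proof (intro conjI impI)
    assume "limsup (\<lambda>n. ereal (real (k n) / real n)) < 1"
    then obtain r where r: "limsup (\<lambda>n. ereal (real (k n) / real n)) < ereal r" "ereal r < 1"
      using ereal_dense2 by blast
    then have "\<forall>\<^sub>F n in sequentially. ereal (real (k n) / real n) < ereal r" by (intro Limsup_lessD)
    then have kn: "\<forall>\<^sub>F n in sequentially. real (k n) / real n < r" by simp
    \<comment> \<open>Any number strictly between 0 and 1 that eventually bounds k / n serves; the maximum with 1 / 2 is visibly positive.\<close>
    define c where "c = ln (1 / max r (1 / 2))"
    have c: "0 < c" using r by (auto simp: c_def ln_div max_def)
    have l_ge: "\<forall>\<^sub>F n in sequentially. c \<le> ln (real n / real (k n)) \<and> ln (real n / real (k n)) \<le> ln (real n)"
      using kn eventually_ge_at_top[of 1]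
    proof eventually_elim
      case (elim n)
      have "real (k n) \<le> max r (1 / 2) * real n"
      proof -
        have "real (k n) \<le> r * real n" using elim by (simp add: field_simps)
        also have "\<dots> \<le> max r (1 / 2) * real n" by (intro mult_right_mono) auto
        finally show ?thesis .
      qed
      moreover have \<rho>: "0 < max r (1 / 2)" by simp
      ultimately have "1 / max r (1 / 2) * real (k n) \<le> 1 / max r (1 / 2) * (max r (1 / 2) * real n)"
        by (intro mult_left_mono) auto
      then have "1 / max r (1 / 2) * real (k n) \<le> real n" using \<rho> by simp
      then have "1 / max r (1 / 2) \<le> real n / real (k n)" by (simp only: pos_le_divide_eq[OF pos(2)])
      then have "c \<le> ln (real n / real (k n))" unfolding c_def by (intro ln_mono) auto
      moreover have "ln (real n / real (k n)) \<le> ln (real n)"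
        using elim by (simp add: ln_div)
      ultimately show ?case by simp
    qed
    define T where "T n = ln (real (d n) * real (k n)) + 3 * ln (ln (real n))" for n
    define U where "U n = ln (real n / real (k n)) * T n / a" for n
    have T: "T n = ln (real (d n)) + ln (real (k n)) + 3 * ln (ln (real n))" for n
      unfolding T_def ln_mult_pos[OF pos(1) pos(2)] ..
    show "(\<lambda>n. measure (P n) {\<omega> \<in> space (P n).
           sup_deviation (d n) \<alpha> (k n) n (D n) (\<lambda>i. X n i \<omega>) (\<lambda>i. Y n i \<omega>)
             \<le> ereal (9 * M * sqrt (ln (real n / real (k n))
                    * (ln (real (d n) * real (k n)) + 3 * ln (ln (real n)))
                    / a) * (1 / sqrt (real (k n))))}) \<longlonglongrightarrow> 1"
      unfolding T_def[symmetric] U_def[symmetric]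
    proof (rule rate_suffices)
      have "filterlim (\<lambda>n. c * (3 * ln (ln (real n))) / a) at_top sequentially"
        using c a by real_asymp
      then show "filterlim U at_top sequentially"
      proof (rule filterlim_at_top_mono)
        show "\<forall>\<^sub>F n in sequentially. c * (3 * ln (ln (real n))) / a \<le> U n"
          using l_ge ln_large
        proof eventually_elim
          case (elim n)
          then show ?case unfolding U_def using a c
            by (intro divide_right_mono mult_mono) (auto simp: T intro!: add_nonneg_nonneg ln_nonneg)
        qed
      qed
      show "(\<lambda>n. U n / real (k n)) \<longlonglongrightarrow> 0"
      proof (rule tendsto_sandwich)
        show "\<forall>\<^sub>F n in sequentially. 0 \<le> U n / real (k n)"
          using l_ge ln_large
        proof eventually_elim
          case (elim n)
          then show ?case unfolding U_def using a c by (auto simp: T ln_nonneg intro!: divide_nonneg_nonneg mult_nonneg_nonneg add_nonneg_nonneg)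
        qed
        show "\<forall>\<^sub>F n in sequentially. U n / real (k n) \<le> (8 * h n + 4 / (ln (real n))\<^sup>2) / a"
          using l_ge ln_large
        proof eventually_elim
          case (elim n)
          define L where "L = ln (real n)"
          have L: "1 \<le> L" using elim by (simp add: L_def)
          have ln_d: "L * ln (real (d n)) / real (k n) \<le> h n"
            unfolding h_def L_def[symmetric] using L by (intro divide_right_mono mult_left_mono) auto
          have ln_ln: "L * ln L / real (k n) \<le> h n"
            unfolding h_def L_def[symmetric] using L by (intro divide_right_mono mult_left_mono) auto
          have "U n * a = ln (real n / real (k n)) * T n" using a by (simp add: U_def)
          also have "\<dots> \<le> L * T n" using elim L by (intro mult_right_mono) (auto simp: T L_def ln_nonneg)
          finally have "U n * a / real (k n) \<le> L * T n / real (k n)" by (intro divide_right_mono) auto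
          also have "\<dots> = L * ln (real (d n)) / real (k n) + L * ln (real (k n)) / real (k n)
              + 3 * (L * ln L / real (k n))"
            by (simp add: T L_def[symmetric] algebra_simps add_divide_distrib)
          also have "\<dots> \<le> 8 * h n + 4 / L\<^sup>2"
            using ln_d ln_ln ln_mult_ln_le[OF L pos(4)[of n]] by linarith
          finally show ?case using a by (simp add: L_def pos_le_divide_eq mult_ac)
        qed
        have "(\<lambda>n. 4 / (ln (real n))\<^sup>2) \<longlonglongrightarrow> 0" by real_asymp
        then have "(\<lambda>n. (8 * h n + 4 / (ln (real n))\<^sup>2) / a) \<longlonglongrightarrow> (8 * 0 + 0) / a"
          by (intro tendsto_intros h0) (use a in auto)
        then show "(\<lambda>n. (8 * h n + 4 / (ln (real n))\<^sup>2) / a) \<longlonglongrightarrow> 0" by simp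
      qed simp
      have "\<forall>\<^sub>F n in sequentially. C + a + a * ln (8 * \<zeta>) / c \<le> 2 * (3 * ln (ln (real n)))"
        by real_asymp
      then show "\<forall>\<^sub>F n in sequentially. k n \<le> n \<longrightarrow> log_entropy \<zeta> \<alpha> n (d n) (k n) \<le> 3 * U n"
        using l_ge ln_large
      proof eventually_elim
        case (elim n)
        define l where "l = ln (real n / real (k n))"
        have l: "c \<le> l" using elim by (simp add: l_def)
        have "3 * ln (ln (real n)) \<le> T n" by (simp add: T ln_nonneg add_nonneg_nonneg)
        then have "C + a + a * ln (8 * \<zeta>) / c \<le> 2 * T n" using elim by linarith
        then have "l * (C + a + a * ln (8 * \<zeta>) / c) \<le> l * (2 * T n)" using l c by (intro mult_left_mono) auto
        moreover have "a * ln (8 * \<zeta>) \<le> l * (a * ln (8 * \<zeta>) / c)"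
          using mult_right_mono[OF l, of "a * ln (8 * \<zeta>) / c"] a c assms(2) by simp
        ultimately have "l * (C + T n) + a * ln (8 * \<zeta>) + a * l \<le> 3 * (l * T n)"
          by (simp add: algebra_simps)
        then have "(l * (C + T n) + a * ln (8 * \<zeta>) + a * l) / a \<le> 3 * (l * T n) / a"
          using a by (intro divide_right_mono) auto
        then show ?case
          using a by (simp add: log_entropy_def a_rate U_def l_def[symmetric] C_def[symmetric] T add_divide_distrib add.assoc)
      qed
    qed
  next
    assume "0 < liminf (\<lambda>n. ereal (real (d n) / real n))"
    then obtain r where r: "0 < ereal r" "ereal r < liminf (\<lambda>n. ereal (real (d n) / real n))"
      using ereal_dense2 by blast
    then have "\<forall>\<^sub>F n in sequentially. ereal r < ereal (real (d n) / real n)" by (intro less_LiminfD)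
    then have dn: "\<forall>\<^sub>F n in sequentially. r < real (d n) / real n" by simp
    define \<kappa> where "\<kappa> = ln r"
    have ln_d: "\<forall>\<^sub>F n in sequentially. ln (real n) + \<kappa> \<le> ln (real (d n))"
      using dn eventually_ge_at_top[of 1]
    proof eventually_elim
      case (elim n)
      then have "real n * r \<le> real (d n)" by (simp add: field_simps)
      then have "ln (real n * r) \<le> ln (real (d n))" using elim r by (intro ln_mono) auto
      then show ?case using elim r by (simp add: ln_mult \<kappa>_def)
    qed
    define U where "U n = ln (real n) * ln (real (d n)) / a" for n
    show "(\<lambda>n. measure (P n) {\<omega> \<in> space (P n).
           sup_deviation (d n) \<alpha> (k n) n (D n) (\<lambda>i. X n i \<omega>) (\<lambda>i. Y n i \<omega>)
             \<le> ereal (9 * M * sqrt (ln (real n) * ln (real (d n))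
                    / a) * (1 / sqrt (real (k n))))}) \<longlonglongrightarrow> 1"
      unfolding U_def[symmetric]
    proof (rule rate_suffices)
      have "filterlim (\<lambda>n. ln (real n) * (ln (real n) + \<kappa>) / a) at_top sequentially"
        using a by real_asymp
      then show "filterlim U at_top sequentially"
      proof (rule filterlim_at_top_mono)
        show "\<forall>\<^sub>F n in sequentially. ln (real n) * (ln (real n) + \<kappa>) / a \<le> U n"
          using ln_d ln_large
        proof eventually_elim
          case (elim n)
          then show ?case unfolding U_def using a by (intro divide_right_mono mult_left_mono) auto
        qed
      qed
      show "(\<lambda>n. U n / real (k n)) \<longlonglongrightarrow> 0"
      proof (rule tendsto_sandwich)
        show "\<forall>\<^sub>F n in sequentially. 0 \<le> U n / real (k n)"
          using ln_large by eventually_elim (use a in \<open>simp add: U_def ln_nonneg\<close>)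
        show "\<forall>\<^sub>F n in sequentially. U n / real (k n) \<le> h n / a"
          using ln_large
        proof eventually_elim
          case (elim n)
          have "ln (real n) * ln (real (d n)) / real (k n) \<le> h n"
            unfolding h_def using elim by (intro divide_right_mono mult_left_mono) auto
          then have "ln (real n) * ln (real (d n)) / real (k n) / a \<le> h n / a"
            using a by (intro divide_right_mono) auto
          then show ?case by (simp add: U_def mult.commute)
        qed
        show "(\<lambda>n. h n / a) \<longlonglongrightarrow> 0" using tendsto_divide[OF h0 tendsto_const, of a] a by simp
      qed simp
      have "\<forall>\<^sub>F n in sequentially. C - \<kappa> + 3 * ln (ln (real n)) + a * ln (8 * \<zeta>) + a \<le> ln (real n) + \<kappa>"
        by real_asymp
      then show "\<forall>\<^sub>F n in sequentially. k n \<le> n \<longrightarrow> log_entropy \<zeta> \<alpha> n (d n) (k n) \<le> 3 * U n"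
        using ln_d ln_large eventually_ge_at_top[of 1]
      proof eventually_elim
        case (elim n)
        show ?case
        proof
          assume kn: "k n \<le> n"
          define l where "l = ln (real n / real (k n))"
          define L where "L = ln (real n)"
          define E where "E = ln (real (d n))"
          have L: "1 \<le> L" using elim by (simp add: L_def)
          have lL: "l \<le> L" using elim by (simp add: l_def L_def ln_div)
          have kL: "ln (real (k n)) \<le> L" unfolding L_def using kn pos(2)[of n] by (intro ln_mono) auto
          have E: "L + \<kappa> \<le> E" "C - \<kappa> + 3 * ln L + a * ln (8 * \<zeta>) + a \<le> E"
            using elim by (auto simp: L_def E_def)
          have E0: "0 \<le> E" by (simp add: E_def ln_nonneg)
          define G where "G = C + E + ln (real (k n)) + 3 * ln L"
          have G: "0 \<le> G" "G \<le> C + 2 * E - \<kappa> + 3 * ln L" 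
            using C E0 L kL E ln_nonneg(2)[of n] by (auto simp: G_def intro!: add_nonneg_nonneg)
          have z0: "0 \<le> a * ln (8 * \<zeta>)" using a assms(2) by simp
          have "l * G + a * ln (8 * \<zeta>) + a * l \<le> L * G + L * (a * ln (8 * \<zeta>)) + L * a"
          proof (intro add_mono)
            show "l * G \<le> L * G" by (rule mult_right_mono[OF lL G(1)])
            show "a * ln (8 * \<zeta>) \<le> L * (a * ln (8 * \<zeta>))" using mult_right_mono[OF L z0] by simp
            show "a * l \<le> L * a" using mult_right_mono[OF lL, of a] a by (simp add: mult.commute)
          qed
          also have "\<dots> = L * (G + a * ln (8 * \<zeta>) + a)" by (simp add: algebra_simps)
          also have "\<dots> \<le> L * (3 * E)" using G E L by (intro mult_left_mono) auto
          finally have "(l * G + a * ln (8 * \<zeta>) + a * l) / a \<le> L * (3 * E) / a"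
            using a by (intro divide_right_mono) auto
          then show "log_entropy \<zeta> \<alpha> n (d n) (k n) \<le> 3 * U n"
            using a by (simp add: log_entropy_def a_rate U_def l_def[symmetric] C_def[symmetric]
                L_def[symmetric] E_def[symmetric] G_def[symmetric] add_divide_distrib mult.left_commute[of L 3])
        qed
      qed
    qed
  qed
qed

end
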